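(* Let $\mathscr{F}=\{H_1,H_2,H_3,H_4,H_5,H_6,H_{10},H_{11}\}$ be the family of graphs on five vertices specified in the context. For all integers $k\ge 1$: if $H\in\mathscr{F}\setminus\{H_{10}\}$, then \[GR_k(H)=\begin{cases}(R_2(H)-1)\cdot 5^{(k-2)/2}+1, & \text{if } k \text{ is even},\\ 4\cdot 5^{(k-1)/2}+1, & \text{if } k \text{ is odd},\end{cases}\] and if $H=H_{10}$, then $GR_1(H)=5$, $GR_2(H)=7$ and \[GR_k(H)=\begin{cases}5^{k/2}+1, & \text{if } k\ge 4 \text{ is even},\\ 2\cdot 5^{(k-1)/2}+1, & \text{if } k\ge 3 \text{ is odd}.\end{cases}\]
   Context: All graphs are finite, simple and undirected. $K_n$ denotes the complete graph on $n$ vertices. A $k$-edge coloring of $K_n$ is a map $c:E(K_n)\to\{1,\dots,k\}$ (not necessarily proper, not necessarily surjective). A triangle is rainbow if its three edges have pairwise different colors. A copy of $H$ means a (not necessarily induced) subgraph isomorphic to $H$; it is monochromatic if all its edges have the same color. For a graph $H$ and an integer $k\ge 1$, the Gallai-Ramsey number $GR_k(H)$ is the minimum integer $n$ such that every $k$-edge coloring of $K_n$ contains a rainbow triangle or a monochromatic copy of $H$. The Ramsey number $R_2(H)$ is the minimum integer $n$ such that every $2$-edge coloring of $K_n$ contains a monochromatic copy of $H$. The graphs $H_i$ in question all have vertex set $\{1,2,3,4,5\}$, with the following edge sets (writing $ij$ for the edge between $i$ and $j$): $H_1$: $12, 15, 25, 23, 34$ (a triangle with a path of length two attached at one vertex).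 $H_2$: $12, 15, 25, 23, 24$ (a triangle with two pendant edges at the same vertex). $H_3$: $12, 15, 25, 23, 45$ (a triangle with pendant edges at two different vertices). $H_4$: $12, 23, 34, 45, 15, 25$ (a $5$-cycle with one chord). $H_5$: $23, 25, 35, 34, 45, 12$ ($K_4$ minus an edge, with a pendant edge attached at a vertex of degree two). $H_6$: $23, 25, 35, 34, 45, 15$ ($K_4$ minus an edge, with a pendant edge attached at a vertex of degree three). $H_{10}$: $12, 15, 25, 34$ (the disjoint union of $K_3$ and $K_2$). $H_{11}$: $12, 23, 24, 15, 35, 45, 34$ ($K_{2,3}$ together with one edge joining two vertices of the part of size three). *)

theory Defs
  imports Main "HOL-Library.FuncSet"
begin

record 'a ugraph =
  uverts :: "'a set"
  uedges :: "'a set set"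

definition simple_graph :: "'a ugraph \<Rightarrow> bool" where
  "simple_graph G \<longleftrightarrow>
     finite (uverts G) \<and> (\<forall>e \<in> uedges G. e \<subseteq> uverts G \<and> card e = 2)"

definition complete_graph :: "nat \<Rightarrow> nat ugraph" where
  "complete_graph n = \<lparr>uverts = {1..n}, uedges = {e. e \<subseteq> {1..n} \<and> card e = 2}\<rparr>"

definition is_subgraph :: "'a ugraph \<Rightarrow> 'a ugraph \<Rightarrow> bool" where
  "is_subgraph G' G \<longleftrightarrow>
     simple_graph G' \<and> uverts G' \<subseteq> uverts G \<and> uedges G' \<subseteq> uedges G"

definition isomorphic :: "'a ugraph \<Rightarrow> 'b ugraph \<Rightarrow> bool" where
  "isomorphic G H \<longleftrightarrow>
     (\<exists>f. bij_betw f (uverts G) (uverts H) \<and>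
          (\<forall>x \<in> uverts G. \<forall>y \<in> uverts G. {x, y} \<in> uedges G \<longleftrightarrow> {f x, f y} \<in> uedges H))"

text \<open>Only the values of a colouring on the edges of \<open>K\<^sub>n\<close> matter; elsewhere it is arbitrary.\<close>

definition edge_coloring :: "nat \<Rightarrow> nat \<Rightarrow> (nat set \<Rightarrow> nat) \<Rightarrow> bool" where
  "edge_coloring k n c \<longleftrightarrow> c \<in> uedges (complete_graph n) \<rightarrow> {1..k}"

definition has_rainbow_triangle :: "nat \<Rightarrow> (nat set \<Rightarrow> nat) \<Rightarrow> bool" where
  "has_rainbow_triangle n c \<longleftrightarrow>
     (\<exists>x \<in> uverts (complete_graph n). \<exists>y \<in> uverts (complete_graph n).
        \<exists>z \<in> uverts (complete_graph n).
        x \<noteq> y \<and> y \<noteq> z \<and> x \<noteq> z \<and>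
        c {x, y} \<noteq> c {y, z} \<and> c {y, z} \<noteq> c {x, z} \<and> c {x, y} \<noteq> c {x, z})"

definition has_mono_copy :: "'a ugraph \<Rightarrow> nat \<Rightarrow> (nat set \<Rightarrow> nat) \<Rightarrow> bool" where
  "has_mono_copy H n c \<longleftrightarrow>
     (\<exists>G. is_subgraph G (complete_graph n) \<and> isomorphic H G \<and>
          (\<exists>i. \<forall>e \<in> uedges G. c e = i))"

definition gallai_ramsey :: "nat \<Rightarrow> 'a ugraph \<Rightarrow> nat" where
  "gallai_ramsey k H =
     (LEAST n. \<forall>c. edge_coloring k n c \<longrightarrow> has_rainbow_triangle n c \<or> has_mono_copy H n c)"

definition ramsey2 :: "'a ugraph \<Rightarrow> nat" where
  "ramsey2 H = (LEAST n. \<forall>c. edge_coloring 2 n c \<longrightarrow> has_mono_copy H n c)"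

definition H1 :: "nat ugraph" where
  "H1 = \<lparr>uverts = {1..5}, uedges = {{1,2}, {1,5}, {2,5}, {2,3}, {3,4}}\<rparr>"

definition H2 :: "nat ugraph" where
  "H2 = \<lparr>uverts = {1..5}, uedges = {{1,2}, {1,5}, {2,5}, {2,3}, {2,4}}\<rparr>"

definition H3 :: "nat ugraph" where
  "H3 = \<lparr>uverts = {1..5}, uedges = {{1,2}, {1,5}, {2,5}, {2,3}, {4,5}}\<rparr>"

definition H4 :: "nat ugraph" where
  "H4 = \<lparr>uverts = {1..5}, uedges = {{1,2}, {2,3}, {3,4}, {4,5}, {1,5}, {2,5}}\<rparr>"

definition H5 :: "nat ugraph" where
  "H5 = \<lparr>uverts = {1..5}, uedges = {{2,3}, {2,5}, {3,5}, {3,4}, {4,5}, {1,2}}\<rparr>"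

definition H6 :: "nat ugraph" where
  "H6 = \<lparr>uverts = {1..5}, uedges = {{2,3}, {2,5}, {3,5}, {3,4}, {4,5}, {1,5}}\<rparr>"

definition H10 :: "nat ugraph" where
  "H10 = \<lparr>uverts = {1..5}, uedges = {{1,2}, {1,5}, {2,5}, {3,4}}\<rparr>"

definition H11 :: "nat ugraph" where
  "H11 = \<lparr>uverts = {1..5}, uedges = {{1,2}, {2,3}, {2,4}, {1,5}, {3,5}, {4,5}, {3,4}}\<rparr>"

definition graph_family :: "nat ugraph set" where
  "graph_family = {H1, H2, H3, H4, H5, H6, H10, H11}"

lemma simple_graph_complete_graph: "simple_graph (complete_graph n)"
  by (simp add: simple_graph_def complete_graph_def)

lemma simple_graph_family: "H \<in> graph_family \<Longrightarrow> simple_graph H"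
  by (auto simp: graph_family_def simple_graph_def H1_def H2_def H3_def H4_def H5_def H6_def
      H10_def H11_def)

end

theory Submission
  imports Defs
begin

text \<open>
  Every graph \<open>H\<close> of the family except \<open>H10\<close> is connected, contains a triangle, and is contained both in
  the wheel with four spokes and in \<open>K\<^sub>3\<^sub>,\<^sub>3\<close> plus an edge; moreover \<open>9 \<le> R\<^sub>2(H) \<le> 11\<close>. These facts suffice.
  The lower bounds substitute extremal colourings into the triangle-free 2-colouring of \<open>K\<^sub>5\<close>.

  For the upper bound with \<open>k \<ge> 3\<close> colours take a smallest homogeneous set \<open>M\<close> with more vertices than the
  bound for \<open>k - 1\<close> colours allows. Since \<open>K\<^sub>3\<^sub>,\<^sub>3\<close> plus an edge is forbidden, at most two outside vertices see \<open>M\<close>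
  in any given colour, and outside vertices can be charged to subsets of \<open>M\<close> that miss a colour. By Gallai's
  theorem \<open>M\<close> splits into parts joined in only two colours. Call a part large if it has at least three
  vertices: two large parts joined in a colour both avoid this colour, and the wheel excludes monochromatic
  triangles of large parts, so there are at most five of them. Each number of large parts is settled by counting.

  For \<open>H10\<close> removing a monochromatic triangle removes its colour, which reduces the bound to the
  triangle-free case.
\<close>

section \<open>Gallai partitions\<close>

text \<open>A Gallai partition of the whole vertex set is not enough: a part above the bound for
  \<open>k - 1\<close> colours would be out of control. A part of a homogeneous set is again
  homogeneous, so a smallest homogeneous set above that bound has only parts below it; the price is
  the set of outside vertices, which every count has to pay for. Large means three vertices because
  that is a side of K_{3,3}: an edge inside one side of a monochromatic join of two triples is
  forbidden. The wheel needs only two vertices on each side and one hub, so that single vertices and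
  outside vertices can be the third corner of a forbidden triangle. With r = R_2(H) - 1, the range 8
  <= r <= 10 is what the arithmetic tolerates: twice the bound for k - 1 colours equals the bound
  for k colours when k = 3, r = 10 and when k = 4, r = 8. Two large parts then leave no room for any
  further vertex, and that case needs the finest argument.\<close>

definition rainbow_free :: "('a \<Rightarrow> 'a \<Rightarrow> nat) \<Rightarrow> 'a set \<Rightarrow> bool" where
  "rainbow_free c V \<longleftrightarrow> (\<forall>x\<in>V. \<forall>y\<in>V. \<forall>z\<in>V. x \<noteq> y \<and> y \<noteq> z \<and> x \<noteq> z \<longrightarrow>
     c x y = c y z \<or> c y z = c x z \<or> c x y = c x z)"

definition colored_by :: "('a \<Rightarrow> 'a \<Rightarrow> nat) \<Rightarrow> nat set \<Rightarrow> 'a set \<Rightarrow> bool" where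
  "colored_by c C V \<longleftrightarrow> (\<forall>x\<in>V. \<forall>y\<in>V. x \<noteq> y \<longrightarrow> c x y \<in> C)"

definition color_edges :: "('a \<Rightarrow> 'a \<Rightarrow> nat) \<Rightarrow> nat \<Rightarrow> 'a set \<Rightarrow> ('a \<times> 'a) set" where
  "color_edges c i M = {(x, y). x \<in> M \<and> y \<in> M \<and> x \<noteq> y \<and> c x y = i}"

lemma rainbow_freeD:
  assumes "rainbow_free c V" "x \<in> V" "y \<in> V" "z \<in> V" "x \<noteq> y" "y \<noteq> z" "x \<noteq> z"
  shows "c x y = c y z \<or> c y z = c x z \<or> c x y = c x z"
  using assms unfolding rainbow_free_def by blast

lemma rainbow_free_subset: "rainbow_free c V \<Longrightarrow> W \<subseteq> V \<Longrightarrow> rainbow_free c W"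
  unfolding rainbow_free_def by blast

lemma colored_by_subset: "colored_by c C V \<Longrightarrow> W \<subseteq> V \<Longrightarrow> C \<subseteq> D \<Longrightarrow> colored_by c D W"
  unfolding colored_by_def by blast

lemma colored_byD: "colored_by c C V \<Longrightarrow> x \<in> V \<Longrightarrow> y \<in> V \<Longrightarrow> x \<noteq> y \<Longrightarrow> c x y \<in> C"
  unfolding colored_by_def by blast

text \<open>Curried colourings let vertices be of any type, pairs included, and turn restriction
  into passing to a subset; the values \<open>c x x\<close> carry no meaning.\<close>

locale sym_coloring =
  fixes c :: "'a \<Rightarrow> 'a \<Rightarrow> nat"
  assumes sym: "c x y = c y x"
begin

lemma sym_color_edges: "(x, y) \<in> (color_edges c i M)\<^sup>* \<Longrightarrow> (y, x) \<in> (color_edges c i M)\<^sup>*"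
proof -
  have "sym (color_edges c i M)"
    by (auto simp: sym_def color_edges_def sym)
  then show "(x, y) \<in> (color_edges c i M)\<^sup>* \<Longrightarrow> (y, x) \<in> (color_edges c i M)\<^sup>*"
    by (meson sym_rtrancl symD)
qed

lemma color_edges_in:
  assumes "(x, y) \<in> (color_edges c i M)\<^sup>*" "x \<in> M" shows "y \<in> M"
  using assms by (induction rule: rtrancl_induct) (auto simp: color_edges_def)

text \<open>For an \<open>i\<close>-edge \<open>y z\<close> of the component, neither
  \<open>u y\<close> nor \<open>u z\<close> has colour \<open>i\<close>, since \<open>u\<close> lies
  outside. The triangle \<open>u\<close>, \<open>y\<close>, \<open>z\<close> is not rainbow, so
  these two edges agree.\<close>

lemma const_on_component:
  assumes rf: "rainbow_free c M" and xy: "(x, y) \<in> (color_edges c i M)\<^sup>*"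
    and ux: "(x, u) \<notin> (color_edges c i M)\<^sup>*" and u: "u \<in> M" and x: "x \<in> M"
  shows "c u x = c u y"
  using xy
proof (induction rule: rtrancl_induct)
  case base
  then show ?case by simp
next
  case (step y z)
  have yz: "y \<in> M" "z \<in> M" "y \<noteq> z" "c y z = i"
    using step.hyps(2) by (auto simp: color_edges_def)
  have xz: "(x, z) \<in> (color_edges c i M)\<^sup>*" using step.hyps by (rule rtrancl_into_rtrancl)
  have "u \<noteq> y" "u \<noteq> z" using ux step.hyps(1) xz by auto
  moreover have "(y, u) \<notin> color_edges c i M" using ux step.hyps(1) by (meson rtrancl_into_rtrancl)
  moreover have "(z, u) \<notin> color_edges c i M" using ux xz by (meson rtrancl_into_rtrancl)
  ultimately have "c u y \<noteq> i" "c u z \<noteq> i"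
    using u yz by (auto simp: color_edges_def sym)
  then have "c u y = c u z"
    using rainbow_freeD[OF rf u yz(1,2)] yz \<open>u \<noteq> y\<close> \<open>u \<noteq> z\<close> by auto
  then show ?case using step.IH by simp
qed

lemma const_between_components:
  assumes rf: "rainbow_free c M" and M: "x \<in> M" "y \<in> M"
    and xx: "(x, x') \<in> (color_edges c i M)\<^sup>*" and yy: "(y, y') \<in> (color_edges c i M)\<^sup>*"
    and xy: "(x, y) \<notin> (color_edges c i M)\<^sup>*"
  shows "c x y = c x' y'"
proof -
  have "c y x = c y x'" by (rule const_on_component[OF rf xx xy M(2,1)])
  moreover have "(y, x') \<notin> (color_edges c i M)\<^sup>*"
    using xx xy by (meson rtrancl_trans sym_color_edges)
  then have "c x' y = c x' y'"
    using const_on_component[OF rf yy _ color_edges_in[OF xx M(1)] M(2)] by blast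
  ultimately show ?thesis by (simp add: sym)
qed

text \<open>Cutting an \<open>i\<close>-path at its first arrival at \<open>v\<close> leaves a path
  inside \<open>F\<close> that ends at an \<open>i\<close>-neighbour of \<open>v\<close>.\<close>

lemma path_to_new_vertex:
  assumes "(z, v) \<in> (color_edges c i (insert v F))\<^sup>*" "z \<noteq> v"
  shows "\<exists>w\<in>F. (z, w) \<in> (color_edges c i F)\<^sup>* \<and> c w v = i"
  using assms
proof (induction rule: converse_rtrancl_induct)
  case base
  then show ?case by simp
next
  case (step z z')
  have z: "z \<in> F" "c z z' = i" using step by (auto simp: color_edges_def)
  show ?case
  proof (cases "z' = v")
    case True
    then show ?thesis using z by blast
  next
    case False
    then obtain w where w: "w \<in> F" "(z', w) \<in> (color_edges c i F)\<^sup>*" "c w v = i"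
      using step.IH by blast
    have "(z, z') \<in> color_edges c i F"
      using step.hyps(1) False z by (auto simp: color_edges_def)
    then have "(z, w) \<in> (color_edges c i F)\<^sup>*" using w(2) by (rule converse_rtrancl_into_rtrancl)
    then show ?thesis using w by blast
  qed
qed

lemma color_edge_at:
  assumes "(v, w) \<in> (color_edges c i M)\<^sup>*" "v \<noteq> w"
  obtains z where "z \<in> M" "z \<noteq> v" "c v z = i"
proof -
  obtain z where "(v, z) \<in> color_edges c i M" using assms by (meson converse_rtranclE)
  then show ?thesis using that unfolding color_edges_def by auto
qed

text \<open>The core of Gallai's theorem, by induction on the vertices. If every occurring colour
  connected \<open>insert v F\<close>, each would occur at \<open>v\<close>; both cases show that
  \<open>v\<close> sees at most two colours, although no two colours suffice.\<close>

lemma disconnected_color: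
  assumes "finite M" "rainbow_free c M" "\<And>D. finite D \<Longrightarrow> card D \<le> 2 \<Longrightarrow> \<not> colored_by c D M"
  shows "\<exists>i. (\<exists>x\<in>M. \<exists>y\<in>M. x \<noteq> y \<and> c x y = i) \<and> (\<exists>x\<in>M. \<exists>y\<in>M. (x, y) \<notin> (color_edges c i M)\<^sup>*)"
  using assms
proof (induction M rule: finite_induct)
  case empty
  have "colored_by c {} {}" by (simp add: colored_by_def)
  then show ?case using empty(2)[of "{}"] by simp
next
  case (insert v F)
  let ?M = "insert v F"
  have rF: "rainbow_free c F" by (rule rainbow_free_subset[OF insert.prems(1) subset_insertI])
  show ?case
  proof (rule ccontr)
    assume "\<not> ?case"
    then have no: "\<not> ((\<exists>x\<in>?M. \<exists>y\<in>?M. x \<noteq> y \<and> c x y = i) \<and>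
        (\<exists>x\<in>?M. \<exists>y\<in>?M. (x, y) \<notin> (color_edges c i ?M)\<^sup>*))" for i
      by (simp only: not_ex simp_thms)
    have conn: "(x, y) \<in> (color_edges c (c p q) ?M)\<^sup>*"
      if "p \<in> ?M" "q \<in> ?M" "p \<noteq> q" "x \<in> ?M" "y \<in> ?M" for p q x y
      using no[of "c p q"] that by blast
    have other: "\<exists>z\<in>F. c v z = c p q" if pq: "p \<in> ?M" "q \<in> ?M" "p \<noteq> q" for p q
    proof -
      obtain w where w: "w \<in> F" using pq by auto
      have "v \<noteq> w" using w insert.hyps by auto
      have "(v, w) \<in> (color_edges c (c p q) ?M)\<^sup>*" using conn pq w by blast
      then obtain z where "z \<in> ?M" "z \<noteq> v" "c v z = c p q" using \<open>v \<noteq> w\<close> by (rule color_edge_at)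
      then show ?thesis by blast
    qed
    have out: "\<exists>p\<in>?M. \<exists>q\<in>?M. p \<noteq> q \<and> c p q \<notin> D" if "finite D" "card D \<le> 2" for D
      using insert.prems(2)[OF that] by (auto simp: colored_by_def)
    show False
    proof (cases "\<exists>D. finite D \<and> card D \<le> 2 \<and> colored_by c D F")
      case True
      then obtain D where D: "finite D" "card D \<le> 2" "colored_by c D F" by blast
      obtain p q where pq: "p \<in> ?M" "q \<in> ?M" "p \<noteq> q" "c p q \<notin> D" using out[OF D(1,2)] by blast
      \<comment> \<open>\<open>F\<close> uses only colours of \<open>D\<close>, so the edge of the
        new colour that connectivity demands at \<open>y\<close> can only go to \<open>v\<close>.
        Hence \<open>v\<close> sees a single colour.\<close>
      have star: "c v y = c p q" if "y \<in> F" for y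
      proof -
        have "y \<noteq> v" using that insert.hyps by auto
        have "(y, v) \<in> (color_edges c (c p q) ?M)\<^sup>*" using conn pq that by blast
        then obtain z where "z \<in> ?M" "z \<noteq> y" "c y z = c p q"
          using \<open>y \<noteq> v\<close> by (rule color_edge_at)
        then show ?thesis
          using D(3) that pq(4) by (metis colored_byD insertE sym)
      qed
      obtain p' q' where pq': "p' \<in> ?M" "q' \<in> ?M" "p' \<noteq> q'" "c p' q' \<notin> {c p q}"
        using out[of "{c p q}"] by auto
      then show False using other[OF pq'(1-3)] star by auto
    next
      case False
      then obtain i where i: "\<exists>x\<in>F. \<exists>y\<in>F. x \<noteq> y \<and> c x y = i"
        and dis: "\<exists>x\<in>F. \<exists>y\<in>F. (x, y) \<notin> (color_edges c i F)\<^sup>*"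
        using insert.IH[OF rF] by blast
      let ?E = "(color_edges c i F)\<^sup>*"
      \<comment> \<open>Colour \<open>i\<close> disconnects \<open>F\<close> but connects
        \<open>insert v F\<close>, so every \<open>i\<close>-component of \<open>F\<close> contains
        an \<open>i\<close>-neighbour of \<open>v\<close>.\<close>
      have touch: "\<exists>w\<in>F. (z, w) \<in> ?E \<and> c w v = i" if "z \<in> F" for z
      proof -
        have "z \<noteq> v" using that insert.hyps by auto
        moreover have "(z, v) \<in> (color_edges c i ?M)\<^sup>*" using conn i that by blast
        ultimately show ?thesis by (rule path_to_new_vertex[rotated])
      qed
      \<comment> \<open>In the triangle \<open>v\<close>, \<open>u\<close>, \<open>w\<close> only
        \<open>v w\<close> has colour \<open>i\<close>, so the other two edges agree.\<close>
      have key: "c u w = c v u"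
        if "u \<in> F" "w \<in> F" "c v u \<noteq> i" "c w v = i" "(u, w) \<notin> ?E" for u w
      proof -
        have "u \<noteq> w" "u \<noteq> v" "w \<noteq> v" using that insert.hyps by auto
        moreover have "c u w \<noteq> i"
          using that(1,2,5) \<open>u \<noteq> w\<close> by (auto simp: color_edges_def)
        moreover have "c v w = i" using that(4) sym by metis
        ultimately show ?thesis
          using rainbow_freeD[OF insert.prems(1), of v u w] that by auto
      qed
      \<comment> \<open>All edges at \<open>v\<close> of colours other than \<open>i\<close> share
        one colour: \<open>u\<close> and \<open>u'\<close> are compared through
        \<open>i\<close>-neighbours of \<open>v\<close> in other components.\<close>
      have eq: "c v u = c v u'" if u: "u \<in> F" "u' \<in> F" "c v u \<noteq> i" "c v u' \<noteq> i" for u u'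
      proof (cases "(u, u') \<in> ?E")
        case True
        obtain z where z: "z \<in> F" "(u, z) \<notin> ?E"
          using dis u(1) by (metis rtrancl_trans sym_color_edges)
        obtain w where w: "w \<in> F" "(z, w) \<in> ?E" "c w v = i" using touch z by blast
        have uw: "(u, w) \<notin> ?E" using z w by (meson rtrancl_trans sym_color_edges)
        then have "(u', w) \<notin> ?E" using True by (meson rtrancl_trans)
        then have "c u w = c v u" "c u' w = c v u'" using key u w uw by blast+
        moreover have "c w u = c w u'"
          by (rule const_on_component[OF rF True uw w(1) u(1)])
        ultimately show ?thesis by (simp add: sym)
      next
        case False
        obtain w where w: "w \<in> F" "(u, w) \<in> ?E" "c w v = i" using touch u by blast
        obtain w' where w': "w' \<in> F" "(u', w') \<in> ?E" "c w' v = i" using touch u by blast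
        have 1: "(u, w') \<notin> ?E" using False w' by (meson rtrancl_trans sym_color_edges)
        have 2: "(u', w) \<notin> ?E" using False w by (meson rtrancl_trans sym_color_edges)
        have "c u w' = c v u" "c u' w = c v u'" using key u w w' 1 2 by blast+
        moreover have "c u w' = c w u'"
          using const_between_components[OF rF u(1) w'(1) w(2) _ 1] w'(2) sym_color_edges by blast
        ultimately show ?thesis by (simp add: sym)
      qed
      obtain l where l: "\<And>u. u \<in> F \<Longrightarrow> c v u \<in> {i, l}" using eq by (metis insertCI)
      have "card {i, l} \<le> 2" by (simp add: card_insert_if)
      then obtain p q where "p \<in> ?M" "q \<in> ?M" "p \<noteq> q" "c p q \<notin> {i, l}" using out[of "{i, l}"] by auto
      then show False using other[of p q] l by metis
    qed
  qed
qed

text \<open>Strong induction on the number of vertices: if two colours do not suffice, the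
  components of a disconnecting colour are contracted to representatives and the partition of these
  is pulled back. The parts are the fibres of \<open>\<pi>\<close>.\<close>

theorem gallai_partition:
  assumes "finite M" "2 \<le> card M" "rainbow_free c M" "colored_by c C M" "2 \<le> card C"
  obtains \<pi> :: "'a \<Rightarrow> 'a" and i j where "i \<in> C" "j \<in> C" "i \<noteq> j" "\<exists>x\<in>M. \<exists>y\<in>M. \<pi> x \<noteq> \<pi> y"
    "\<And>x y. x \<in> M \<Longrightarrow> y \<in> M \<Longrightarrow> \<pi> x \<noteq> \<pi> y \<Longrightarrow> c x y \<in> {i, j}"
    "\<And>x x' y. x \<in> M \<Longrightarrow> x' \<in> M \<Longrightarrow> y \<in> M \<Longrightarrow> \<pi> x = \<pi> x' \<Longrightarrow> \<pi> x \<noteq> \<pi> y \<Longrightarrow> c x y = c x' y"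
proof -
  have "\<exists>(\<pi> :: 'a \<Rightarrow> 'a) i j. i \<in> C \<and> j \<in> C \<and> i \<noteq> j \<and> (\<exists>x\<in>M. \<exists>y\<in>M. \<pi> x \<noteq> \<pi> y) \<and>
    (\<forall>x\<in>M. \<forall>y\<in>M. \<pi> x \<noteq> \<pi> y \<longrightarrow> c x y \<in> {i, j}) \<and>
    (\<forall>x\<in>M. \<forall>x'\<in>M. \<forall>y\<in>M. \<pi> x = \<pi> x' \<and> \<pi> x \<noteq> \<pi> y \<longrightarrow> c x y = c x' y)"
    using assms(1-4)
  proof (induction "card M" arbitrary: M rule: less_induct)
    case less
    show ?case
    proof (cases "\<exists>D. finite D \<and> card D \<le> 2 \<and> colored_by c D M")
      case True
      then obtain D where D: "finite D" "card D \<le> 2" "colored_by c D M" by blast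
      \<comment> \<open>Fewer than two colours may occur, so \<open>D\<close> is cut down to
        \<open>C\<close> and padded to two distinct colours of \<open>C\<close>; every vertex is
        then its own part.\<close>
      have "card (D \<inter> C) \<le> 2" using D by (meson card_mono inf_le1 order_trans)
      moreover have "finite C" using assms(5) by (metis card.infinite not_numeral_le_zero)
      ultimately obtain D' where D': "D \<inter> C \<subseteq> D'" "D' \<subseteq> C" "card D' = 2"
        using exists_subset_between[of "D \<inter> C" 2 C] assms(5) by blast
      then obtain i j where ij: "D' = {i, j}" "i \<noteq> j" by (meson card_2_iff)
      have "c x y \<in> {i, j}" if "x \<in> M" "y \<in> M" "x \<noteq> y" for x y
        using colored_byD[OF D(3) that] colored_byD[OF less.prems(4) that] D' ij by blast
      moreover have "\<exists>x\<in>M. \<exists>y\<in>M. x \<noteq> y"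
        using less.prems(2) by (metis card_le_Suc0_iff_eq less.prems(1) not_less_eq_eq numeral_2_eq_2)
      ultimately show ?thesis
        using D' ij by (intro exI[of _ "\<lambda>x. x"] exI[of _ i] exI[of _ j]) auto
    next
      case False
      then obtain i p q x0 y0 where pq: "p \<in> M" "q \<in> M" "p \<noteq> q" "c p q = i"
        and xy0: "x0 \<in> M" "y0 \<in> M" "(x0, y0) \<notin> (color_edges c i M)\<^sup>*"
        using disconnected_color[OF less.prems(1,3)] by blast
      let ?E = "(color_edges c i M)\<^sup>*"
      \<comment> \<open>A canonical representative: the predicate, and with it the choice, depends
        only on the \<open>i\<close>-component of \<open>x\<close>.\<close>
      define \<rho> where "\<rho> x = (SOME y. (x, y) \<in> ?E)" for x
      have \<rho>: "(x, \<rho> x) \<in> ?E" for x unfolding \<rho>_def by (rule someI[of _ x]) simp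
      have \<rho>_eq: "\<rho> x = \<rho> y \<longleftrightarrow> (x, y) \<in> ?E" for x y
      proof
        assume "\<rho> x = \<rho> y"
        then show "(x, y) \<in> ?E" using \<rho> by (metis rtrancl_trans sym_color_edges)
      next
        assume "(x, y) \<in> ?E"
        then have "(x, z) \<in> ?E \<longleftrightarrow> (y, z) \<in> ?E" for z by (meson rtrancl_trans sym_color_edges)
        then show "\<rho> x = \<rho> y" by (simp add: \<rho>_def)
      qed
      let ?M = "\<rho> ` M"
      have sub: "?M \<subseteq> M" using \<rho> color_edges_in by blast
      have "(p, q) \<in> color_edges c i M" using pq by (simp add: color_edges_def)
      then have "\<not> inj_on \<rho> M" using pq \<rho>_eq by (metis inj_onD r_into_rtrancl)
      then have lt: "card ?M < card M"
        using less.prems(1) by (metis card_image_le eq_card_imp_inj_on le_neq_implies_less)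
      have "\<rho> x0 \<noteq> \<rho> y0" using xy0 \<rho>_eq by blast
      then have "card {\<rho> x0, \<rho> y0} = 2" by simp
      then have "2 \<le> card ?M"
        using card_mono[of ?M "{\<rho> x0, \<rho> y0}"] xy0 less.prems(1) by auto
      then have "\<exists>(\<pi> :: 'a \<Rightarrow> 'a) i j. i \<in> C \<and> j \<in> C \<and> i \<noteq> j \<and> (\<exists>x\<in>?M. \<exists>y\<in>?M. \<pi> x \<noteq> \<pi> y) \<and>
        (\<forall>x\<in>?M. \<forall>y\<in>?M. \<pi> x \<noteq> \<pi> y \<longrightarrow> c x y \<in> {i, j}) \<and>
        (\<forall>x\<in>?M. \<forall>x'\<in>?M. \<forall>y\<in>?M. \<pi> x = \<pi> x' \<and> \<pi> x \<noteq> \<pi> y \<longrightarrow> c x y = c x' y)"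
        by (rule less.hyps[OF lt finite_imageI[OF less.prems(1)] _ rainbow_free_subset[OF less.prems(3) sub]
            colored_by_subset[OF less.prems(4) sub order_refl]])
      then obtain \<pi> :: "'a \<Rightarrow> 'a" and k l where \<pi>: "k \<in> C" "l \<in> C" "k \<noteq> l"
        "\<exists>x\<in>?M. \<exists>y\<in>?M. \<pi> x \<noteq> \<pi> y"
        "\<forall>x\<in>?M. \<forall>y\<in>?M. \<pi> x \<noteq> \<pi> y \<longrightarrow> c x y \<in> {k, l}"
        "\<forall>x\<in>?M. \<forall>x'\<in>?M. \<forall>y\<in>?M. \<pi> x = \<pi> x' \<and> \<pi> x \<noteq> \<pi> y \<longrightarrow> c x y = c x' y"
        by (elim exE conjE) (rule that)
      have c: "c x y = c (\<rho> x) (\<rho> y)" if "x \<in> M" "y \<in> M" "\<rho> x \<noteq> \<rho> y" for x y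
        using that \<rho> \<rho>_eq by (intro const_between_components[OF less.prems(3)]) auto
      show ?thesis
      proof (rule exI[of _ "\<pi> \<circ> \<rho>"], rule exI[of _ k], rule exI[of _ l], intro conjI)
        show "\<exists>x\<in>M. \<exists>y\<in>M. (\<pi> \<circ> \<rho>) x \<noteq> (\<pi> \<circ> \<rho>) y" using \<pi>(4) by simp
        show "\<forall>x\<in>M. \<forall>y\<in>M. (\<pi> \<circ> \<rho>) x \<noteq> (\<pi> \<circ> \<rho>) y \<longrightarrow> c x y \<in> {k, l}"
        proof (intro ballI impI)
          fix x y assume *: "x \<in> M" "y \<in> M" "(\<pi> \<circ> \<rho>) x \<noteq> (\<pi> \<circ> \<rho>) y"
          then show "c x y \<in> {k, l}"
            using \<pi>(5)[rule_format, of "\<rho> x" "\<rho> y"] c[of x y] by fastforce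
        qed
        show "\<forall>x\<in>M. \<forall>x'\<in>M. \<forall>y\<in>M. (\<pi> \<circ> \<rho>) x = (\<pi> \<circ> \<rho>) x' \<and> (\<pi> \<circ> \<rho>) x \<noteq> (\<pi> \<circ> \<rho>) y \<longrightarrow> c x y = c x' y"
        proof (intro ballI impI)
          fix x x' y assume *: "x \<in> M" "x' \<in> M" "y \<in> M"
            "(\<pi> \<circ> \<rho>) x = (\<pi> \<circ> \<rho>) x' \<and> (\<pi> \<circ> \<rho>) x \<noteq> (\<pi> \<circ> \<rho>) y"
          then have "c (\<rho> x) (\<rho> y) = c (\<rho> x') (\<rho> y)" by (intro \<pi>(6)[rule_format]) auto
          moreover have "\<rho> x \<noteq> \<rho> y" "\<rho> x' \<noteq> \<rho> y" using * by auto
          ultimately show "c x y = c x' y" using c[of x y] c[of x' y] * by simp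
        qed
      qed (rule \<pi>(1-3))+
    qed
  qed
  then obtain \<pi> :: "'a \<Rightarrow> 'a" and i j where \<pi>: "i \<in> C" "j \<in> C" "i \<noteq> j"
    "\<exists>x\<in>M. \<exists>y\<in>M. \<pi> x \<noteq> \<pi> y"
    "\<forall>x\<in>M. \<forall>y\<in>M. \<pi> x \<noteq> \<pi> y \<longrightarrow> c x y \<in> {i, j}"
    "\<forall>x\<in>M. \<forall>x'\<in>M. \<forall>y\<in>M. \<pi> x = \<pi> x' \<and> \<pi> x \<noteq> \<pi> y \<longrightarrow> c x y = c x' y"
    by (elim exE conjE) (rule that)
  show ?thesis
    by (rule that[OF \<pi>(1-4)]) (use \<pi>(5,6) in \<open>blast+\<close>)
qed

end

section \<open>Monochromatic wheels\<close>

text \<open>One less than the claimed Gallai-Ramsey number, for \<open>r = R\<^sub>2(H) - 1\<close>.\<close>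

fun gr_val :: "nat \<Rightarrow> nat \<Rightarrow> nat" where
  "gr_val r 0 = 1"
| "gr_val r (Suc 0) = 4"
| "gr_val r (Suc (Suc 0)) = r"
| "gr_val r (Suc (Suc (Suc k))) = 5 * gr_val r (Suc k)"

lemma gr_val_step:
  assumes "3 \<le> k"
  shows "gr_val r k = 5 * gr_val r (k - 2)"
  using assms by (induction r k rule: gr_val.induct) (simp_all add: numeral_2_eq_2)

text \<open>These are the inequalities consumed by the cases according to the number of large parts.
  Both ends of the range of \<open>r\<close> are sharp in
  \<open>2 * gr_val r (k - 1) \<le> 5 * gr_val r (k - 2)\<close>: equality holds for
  \<open>k = 3\<close>, \<open>r = 10\<close> and for \<open>k = 4\<close>, \<open>r = 8\<close>. As
  \<open>gr_val\<close> grows by the factor five every two steps, the case \<open>k - 2\<close>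
  yields the case \<open>k\<close>.\<close>

lemma gr_val_bounds:
  assumes "8 \<le> r" "r \<le> 10" "3 \<le> k"
  shows "4 \<le> gr_val r (k - 2)" "gr_val r (k - 1) + 2 \<le> 3 * gr_val r (k - 2)"
    "gr_val r (k - 1) + 5 \<le> 4 * gr_val r (k - 2)" "2 * gr_val r (k - 1) \<le> 5 * gr_val r (k - 2)"
    "gr_val r (k - 1) + 2 * k + 4 \<le> 5 * gr_val r (k - 2)" "4 \<le> k \<Longrightarrow> 20 \<le> gr_val r (k - 1)"
proof -
  have "4 \<le> gr_val r (k - 2) \<and> gr_val r (k - 1) + 2 \<le> 3 * gr_val r (k - 2) \<and>
    gr_val r (k - 1) + 5 \<le> 4 * gr_val r (k - 2) \<and> 2 * gr_val r (k - 1) \<le> 5 * gr_val r (k - 2) \<and>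
    gr_val r (k - 1) + 2 * k + 4 \<le> 5 * gr_val r (k - 2) \<and> (4 \<le> k \<longrightarrow> 20 \<le> gr_val r (k - 1))"
    using assms(3)
  proof (induction k rule: less_induct)
    case (less k)
    consider "k = 3" | "k = 4" | "k = 5" | "6 \<le> k" using less.prems by linarith
    then show ?case
    proof cases
      case 4
      define a b where "a = gr_val r (k - 2 - 2)" and "b = gr_val r (k - 2 - 1)"
      have eq: "gr_val r (k - 2) = 5 * a" "gr_val r (k - 1) = 5 * b"
        using gr_val_step[of "k - 2" r] gr_val_step[of "k - 1" r] 4 by (simp_all add: a_def b_def numeral_3_eq_3)
      have "k - 2 < k" "3 \<le> k - 2" "4 \<le> k - 2" using 4 by simp_all
      then have "4 \<le> a \<and> b + 2 \<le> 3 * a \<and> b + 5 \<le> 4 * a \<and> 2 * b \<le> 5 * a \<and>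
          b + 2 * (k - 2) + 4 \<le> 5 * a \<and> 20 \<le> b"
        using less.IH[of "k - 2"] unfolding a_def b_def by blast
      then show ?thesis unfolding eq using 4 by auto
    qed (use assms in \<open>simp_all add: numeral_eq_Suc\<close>)
  qed
  then show "4 \<le> gr_val r (k - 2)" "gr_val r (k - 1) + 2 \<le> 3 * gr_val r (k - 2)"
    "gr_val r (k - 1) + 5 \<le> 4 * gr_val r (k - 2)" "2 * gr_val r (k - 1) \<le> 5 * gr_val r (k - 2)"
    "gr_val r (k - 1) + 2 * k + 4 \<le> 5 * gr_val r (k - 2)" "4 \<le> k \<Longrightarrow> 20 \<le> gr_val r (k - 1)"
    by blast+
qed

lemma obtain_distinct_list:
  assumes "finite A" "n \<le> card A"
  obtains xs where "distinct xs" "set xs \<subseteq> A" "length xs = n"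
proof -
  obtain B where "B \<subseteq> A" "card B = n" using assms by (meson obtain_subset_with_card_n)
  moreover then obtain xs where "set xs = B" "distinct xs"
    using assms finite_distinct_list finite_subset by metis
  ultimately show ?thesis using that distinct_card by force
qed

lemma obtain_two:
  assumes "2 \<le> card A"
  obtains x y where "x \<in> A" "y \<in> A" "x \<noteq> y"
  using assms by (metis card_2_iff' obtain_subset_with_card_n subsetD)

lemma obtain_three:
  assumes "3 \<le> card A"
  obtains x y z where "x \<in> A" "y \<in> A" "z \<in> A" "x \<noteq> y" "y \<noteq> z" "x \<noteq> z"
proof -
  obtain B where "B \<subseteq> A" "card B = 3" using assms by (meson obtain_subset_with_card_n)
  then show ?thesis using that by (auto simp: card_3_iff)
qed

lemma obtain_five:
  assumes "5 \<le> card A"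
  obtains a b d e f where "a \<in> A" "b \<in> A" "d \<in> A" "e \<in> A" "f \<in> A" "distinct [a, b, d, e, f]"
proof -
  have "finite A" using assms by (metis card.infinite not_numeral_le_zero)
  then obtain xs where xs: "distinct xs" "set xs \<subseteq> A" "length xs = 5"
    using assms obtain_distinct_list by blast
  then obtain a b d e f where "xs = [a, b, d, e, f]" by (auto simp: numeral_eq_Suc length_Suc_conv)
  then show ?thesis using xs that by auto
qed

lemma card_le_2D:
  assumes "card A \<le> 2" "finite A" "x \<in> A" "y \<in> A" "z \<in> A" "x \<noteq> y" "x \<noteq> z"
  shows "y = z"
proof (rule ccontr)
  assume "y \<noteq> z"
  then have "card {x, y, z} = 3" using assms by simp
  moreover have "card {x, y, z} \<le> card A" using assms by (intro card_mono) auto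
  ultimately show False using assms by simp
qed

text \<open>Hub \<open>h\<close> and rim \<open>a\<close>, \<open>b\<close>, \<open>a'\<close>,
  \<open>b'\<close>; the diagonals \<open>a a'\<close> and \<open>b b'\<close> of the rim are left
  free.\<close>

definition has_wheel :: "('a \<Rightarrow> 'a \<Rightarrow> nat) \<Rightarrow> nat \<Rightarrow> 'a set \<Rightarrow> bool" where
  "has_wheel c e V \<longleftrightarrow> (\<exists>h a a' b b'. {h, a, a', b, b'} \<subseteq> V \<and> distinct [h, a, a', b, b'] \<and>
     c h a = e \<and> c h a' = e \<and> c h b = e \<and> c h b' = e \<and>
     c a b = e \<and> c a b' = e \<and> c a' b = e \<and> c a' b' = e)"

definition has_K33e :: "('a \<Rightarrow> 'a \<Rightarrow> nat) \<Rightarrow> nat \<Rightarrow> 'a set \<Rightarrow> bool" where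
  "has_K33e c e V \<longleftrightarrow> (\<exists>x1 x2 x3 y1 y2 y3. {x1, x2, x3, y1, y2, y3} \<subseteq> V \<and>
     distinct [x1, x2, x3, y1, y2, y3] \<and> c x1 x2 = e \<and>
     (\<forall>x\<in>{x1, x2, x3}. \<forall>y\<in>{y1, y2, y3}. c x y = e))"

lemma has_wheelI:
  assumes "{h, a, a', b, b'} \<subseteq> V" "distinct [h, a, a', b, b']"
    "c h a = e" "c h a' = e" "c h b = e" "c h b' = e" "c a b = e" "c a b' = e" "c a' b = e" "c a' b' = e"
  shows "has_wheel c e V"
  unfolding has_wheel_def using assms by (intro exI conjI)

lemma has_K33eI:
  assumes "{x1, x2, x3, y1, y2, y3} \<subseteq> V" "distinct [x1, x2, x3, y1, y2, y3]" "c x1 x2 = e"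
    "\<forall>x\<in>{x1, x2, x3}. \<forall>y\<in>{y1, y2, y3}. c x y = e"
  shows "has_K33e c e V"
  unfolding has_K33e_def using assms by (intro exI conjI)

lemma has_wheel_mono: "has_wheel c e W \<Longrightarrow> W \<subseteq> V \<Longrightarrow> has_wheel c e V"
  unfolding has_wheel_def
  by (elim exE conjE) (intro exI conjI; (assumption | (rule subset_trans, assumption, assumption)))

context sym_coloring
begin

text \<open>The colours other than \<open>e\<close> form a matching on \<open>W\<close>; its edges are placed on the two missing
  pairs of the wheel.\<close>

lemma wheel_from_matching:
  assumes "5 \<le> card W"
    and m: "\<And>x y z. x \<in> W \<Longrightarrow> y \<in> W \<Longrightarrow> z \<in> W \<Longrightarrow> x \<noteq> y \<Longrightarrow> y \<noteq> z \<Longrightarrow> x \<noteq> z \<Longrightarrow> c x y = e \<or> c x z = e"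
  shows "has_wheel c e W"
proof -
  \<comment> \<open>If \<open>a\<close> and \<open>a'\<close> are joined in \<open>e\<close> to
    \<open>p\<close>, \<open>q\<close>, \<open>s\<close>, the matching leaves one of these three
    joined in \<open>e\<close> to the other two. It becomes the hub, and \<open>a a'\<close> is one
    diagonal.\<close>
  have wheel: "has_wheel c e W" if "a \<in> W" "a' \<in> W" "p \<in> W" "q \<in> W" "s \<in> W" "distinct [a, a', p, q, s]"
    "c a p = e \<and> c a' p = e" "c a q = e \<and> c a' q = e" "c a s = e \<and> c a' s = e" for a a' p q s
  proof -
    have "c p q = e \<or> c p s = e" "c q p = e \<or> c q s = e" "c s p = e \<or> c s q = e"
      using m[of p q s] m[of q p s] m[of s p q] that by auto
    then consider "c p q = e" "c p s = e" | "c q p = e" "c q s = e" | "c s p = e" "c s q = e"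
      using sym by metis
    then show ?thesis
    proof cases
      case 1 then show ?thesis using that by (intro has_wheelI[of p a a' q s]) (auto simp: sym)
    next
      case 2 then show ?thesis using that by (intro has_wheelI[of q a a' p s]) (auto simp: sym)
    next
      case 3 then show ?thesis using that by (intro has_wheelI[of s a a' p q]) (auto simp: sym)
    qed
  qed
  have pair: "c a x = e \<and> c a' x = e"
    if "c a a' \<noteq> e" "a \<in> W" "a' \<in> W" "x \<in> W" "a \<noteq> a'" "a \<noteq> x" "a' \<noteq> x" for a a' x
    using that m[of a a' x] m[of a' a x] by (auto simp: sym)
  obtain v1 v2 v3 v4 v5 where v: "v1 \<in> W" "v2 \<in> W" "v3 \<in> W" "v4 \<in> W" "v5 \<in> W"
    and d: "distinct [v1, v2, v3, v4, v5]"
    using assms(1) by (rule obtain_five)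
  have ne: "v1 \<noteq> v2" "v1 \<noteq> v3" "v1 \<noteq> v4" "v1 \<noteq> v5" "v2 \<noteq> v3" "v2 \<noteq> v4" "v2 \<noteq> v5" "v3 \<noteq> v4" "v3 \<noteq> v5" "v4 \<noteq> v5"
    using d by auto
  note ne = ne ne[symmetric]
  \<comment> \<open>Either \<open>v1 v2\<close> can serve as the diagonal, or some pair between
    \<open>{v1, v2}\<close> and \<open>{v3, v4, v5}\<close> is a matching edge, and its ends are
    joined in \<open>e\<close> to everything else.\<close>
  consider "c v1 v3 = e \<and> c v2 v3 = e" "c v1 v4 = e \<and> c v2 v4 = e" "c v1 v5 = e \<and> c v2 v5 = e"
    | "c v1 v3 \<noteq> e" | "c v2 v3 \<noteq> e" | "c v1 v4 \<noteq> e" | "c v2 v4 \<noteq> e" | "c v1 v5 \<noteq> e" | "c v2 v5 \<noteq> e"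
    by blast
  then show ?thesis
  proof cases
    case 1
    then show ?thesis using wheel[OF v d] by simp
  next
    case 2
    show ?thesis
      by (rule wheel[OF v(1) v(3) v(2) v(4) v(5)]; (rule pair[OF 2])?) (simp_all add: v ne)
  next
    case 3
    show ?thesis
      by (rule wheel[OF v(2) v(3) v(1) v(4) v(5)]; (rule pair[OF 3])?) (simp_all add: v ne)
  next
    case 4
    show ?thesis
      by (rule wheel[OF v(1) v(4) v(2) v(3) v(5)]; (rule pair[OF 4])?) (simp_all add: v ne)
  next
    case 5
    show ?thesis
      by (rule wheel[OF v(2) v(4) v(1) v(3) v(5)]; (rule pair[OF 5])?) (simp_all add: v ne)
  next
    case 6
    show ?thesis
      by (rule wheel[OF v(1) v(5) v(2) v(3) v(4)]; (rule pair[OF 6])?) (simp_all add: v ne)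
  next
    case 7
    show ?thesis
      by (rule wheel[OF v(2) v(5) v(1) v(3) v(4)]; (rule pair[OF 7])?) (simp_all add: v ne)
  qed
qed

text \<open>The bound R(3,3) <= 6: three neighbours in one colour \<open>e\<close> span an
  \<open>e\<close>-edge or a triangle in the other colour.\<close>

lemma mono_triangle_of_six:
  assumes "finite Q" "6 \<le> card Q" "colored_by c {i, j} Q"
  shows "\<exists>x\<in>Q. \<exists>y\<in>Q. \<exists>z\<in>Q. x \<noteq> y \<and> y \<noteq> z \<and> x \<noteq> z \<and> c x y = c y z \<and> c x z = c y z"
proof -
  obtain v where v: "v \<in> Q" using assms by fastforce
  let ?N = "\<lambda>e. {x \<in> Q - {v}. c v x = e}"
  have eq: "Q - {v} = ?N i \<union> ?N j" using assms(3) v by (auto simp: colored_by_def)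
  have "5 \<le> card (Q - {v})" using assms(2) v by (simp add: card_Diff_singleton)
  also have "\<dots> \<le> card (?N i) + card (?N j)" by (subst eq) (rule card_Un_le)
  finally have "3 \<le> card (?N i) \<or> 3 \<le> card (?N j)" by linarith
  then obtain e where e: "e \<in> {i, j}" "3 \<le> card (?N e)" by blast
  obtain x y z where xyz: "x \<in> ?N e" "y \<in> ?N e" "z \<in> ?N e" "x \<noteq> y" "y \<noteq> z" "x \<noteq> z"
    using e(2) by (rule obtain_three)
  have cs: "c p q \<in> {i, j}" if "p \<in> ?N e" "q \<in> ?N e" "p \<noteq> q" for p q
    using colored_byD[OF assms(3)] that by auto
  show ?thesis
  proof (cases "\<exists>p\<in>?N e. \<exists>q\<in>?N e. p \<noteq> q \<and> c p q = e")
    case True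
    then obtain p q where "p \<in> ?N e" "q \<in> ?N e" "p \<noteq> q" "c p q = e" by blast
    then show ?thesis using v by (intro bexI[of _ v] bexI[of _ p] bexI[of _ q]) auto
  next
    case False
    then have "c x y \<noteq> e" "c y z \<noteq> e" "c x z \<noteq> e" using xyz by blast+
    then have "c x y = c y z" "c x z = c y z"
      using cs[OF xyz(1,2,4)] cs[OF xyz(2,3,5)] cs[OF xyz(1,3,6)] e(1) by auto
    then show ?thesis using xyz by (intro bexI[of _ x] bexI[of _ y] bexI[of _ z]) auto
  qed
qed

end

section \<open>Homogeneous sets\<close>

definition avoids :: "('a \<Rightarrow> 'a \<Rightarrow> nat) \<Rightarrow> nat \<Rightarrow> 'a set \<Rightarrow> bool" where
  "avoids c e X \<longleftrightarrow> (\<forall>x\<in>X. \<forall>y\<in>X. x \<noteq> y \<longrightarrow> c x y \<noteq> e)"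

definition joined :: "('a \<Rightarrow> 'a \<Rightarrow> nat) \<Rightarrow> nat \<Rightarrow> 'a set \<Rightarrow> 'a set \<Rightarrow> bool" where
  "joined c e X Y \<longleftrightarrow> (\<forall>x\<in>X. \<forall>y\<in>Y. c x y = e)"

lemma avoidsD: "avoids c e X \<Longrightarrow> x \<in> X \<Longrightarrow> y \<in> X \<Longrightarrow> x \<noteq> y \<Longrightarrow> c x y \<noteq> e"
  unfolding avoids_def by blast

lemma avoids_subset: "avoids c e X \<Longrightarrow> Y \<subseteq> X \<Longrightarrow> avoids c e Y"
  unfolding avoids_def by blast

text \<open>All that the upper bound uses about \<open>H\<close>, so that the graphs other than
  \<open>H10\<close> are treated at once. In \<open>two_colored\<close> the colours \<open>i\<close>
  and \<open>j\<close> may coincide.\<close>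

locale ramsey_bound = sym_coloring c for c :: "'a \<Rightarrow> 'a \<Rightarrow> nat" +
  fixes V :: "'a set" and r :: nat
  assumes finite_V: "finite V"
    and rainbow_free: "rainbow_free c V"
    and no_wheel: "\<not> has_wheel c e V"
    and no_K33e: "\<not> has_K33e c e V"
    and two_colored: "W \<subseteq> V \<Longrightarrow> colored_by c {i, j} W \<Longrightarrow> card W \<le> r"
    and r_ge: "8 \<le> r" and r_le: "r \<le> 10"
begin

lemma finite_sub: "X \<subseteq> V \<Longrightarrow> finite X"
  using finite_V finite_subset by blast

lemma joined_sym: "joined c e X Y \<Longrightarrow> joined c e Y X"
  unfolding joined_def using sym by metis

text \<open>An \<open>e\<close>-edge inside \<open>A\<close>, a third vertex of \<open>A\<close> and
  three vertices of \<open>B\<close> form K_{3,3} plus an edge.\<close>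

lemma join_avoids:
  assumes "A \<subseteq> V" "B \<subseteq> V" "A \<inter> B = {}" "3 \<le> card A" "3 \<le> card B" and j: "joined c e A B"
  shows "avoids c e A"
  unfolding avoids_def
proof (intro ballI impI notI)
  fix x y assume xy: "x \<in> A" "y \<in> A" "x \<noteq> y" "c x y = e"
  have "card {x, y} < card A" using xy assms(4) by simp
  then have "\<not> A \<subseteq> {x, y}" by (metis card_mono finite.emptyI finite.insertI not_le)
  then obtain z where z: "z \<in> A" "z \<noteq> x" "z \<noteq> y" by blast
  obtain u v w where u: "u \<in> B" "v \<in> B" "w \<in> B" "u \<noteq> v" "v \<noteq> w" "u \<noteq> w"
    using assms(5) by (rule obtain_three)
  have "\<forall>p\<in>{x, y, z}. \<forall>q\<in>{u, v, w}. c p q = e" using j xy z u by (auto simp: joined_def)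
  moreover have "distinct [x, y, z, u, v, w]" using xy z u assms(3) by auto
  moreover have "{x, y, z, u, v, w} \<subseteq> V" using xy z u assms(1,2) by auto
  ultimately have "has_K33e c e V" unfolding has_K33e_def using xy(4) by blast
  then show False using no_K33e by blast
qed

text \<open>A wheel with hub \<open>v\<close> whose rim alternates between two vertices of
  \<open>A\<close> and two of \<open>B\<close>; the unknown edges inside \<open>A\<close> and
  \<open>B\<close> are its diagonals.\<close>

lemma no_mono_triple:
  assumes "A \<subseteq> V" "B \<subseteq> V" "A \<inter> B = {}" "2 \<le> card A" "2 \<le> card B" "joined c e A B"
    "v \<in> V" "v \<notin> A" "v \<notin> B" "joined c e {v} A" "joined c e {v} B"
  shows False
proof -
  obtain x y where xy: "x \<in> A" "y \<in> A" "x \<noteq> y" using assms(4) by (rule obtain_two)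
  obtain u w where uw: "u \<in> B" "w \<in> B" "u \<noteq> w" using assms(5) by (rule obtain_two)
  have "has_wheel c e V"
    by (rule has_wheelI[of v x y u w]) (use assms xy uw in \<open>auto simp: joined_def\<close>)
  then show False using no_wheel by blast
qed

lemma near_clique_bound:
  assumes "W \<subseteq> V"
    "\<And>x y z. x \<in> W \<Longrightarrow> y \<in> W \<Longrightarrow> z \<in> W \<Longrightarrow> x \<noteq> y \<Longrightarrow> y \<noteq> z \<Longrightarrow> x \<noteq> z \<Longrightarrow> c x y = e \<or> c x z = e"
  shows "card W \<le> 4"
proof (rule ccontr)
  assume "\<not> card W \<le> 4"
  then have "has_wheel c e W" using assms(2) by (intro wheel_from_matching) simp_all
  then show False using has_wheel_mono assms(1) no_wheel by metis
qed

text \<open>Of each \<open>e\<close>-edge one end is kept. This serves when colour \<open>e\<close>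
  cannot be excluded from a large part but is confined to a matching there.\<close>

lemma matching_half:
  assumes "finite A"
    "\<And>x y z. x \<in> A \<Longrightarrow> y \<in> A \<Longrightarrow> z \<in> A \<Longrightarrow> x \<noteq> y \<Longrightarrow> x \<noteq> z \<Longrightarrow> c x y = e \<Longrightarrow> c x z = e \<Longrightarrow> y = z"
  shows "\<exists>B\<subseteq>A. avoids c e B \<and> card A \<le> 2 * card B"
  using assms
proof (induction "card A" arbitrary: A rule: less_induct)
  case less
  show ?case
  proof (cases "avoids c e A")
    case True
    then show ?thesis by (intro exI[of _ A]) simp
  next
    case False
    then obtain a b where ab: "a \<in> A" "b \<in> A" "a \<noteq> b" "c a b = e" by (auto simp: avoids_def)
    let ?A = "A - {a, b}"
    have card: "card ?A + 2 = card A"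
      using ab less.prems(1) card_Diff_subset[of "{a, b}" A] card_mono[of A "{a, b}"] by auto
    then have "\<exists>B\<subseteq>?A. avoids c e B \<and> card ?A \<le> 2 * card B"
      using less.prems by (intro less.hyps) auto
    then obtain B where B: "B \<subseteq> ?A" "avoids c e B" "card ?A \<le> 2 * card B" by blast
    have "c a x \<noteq> e" if "x \<in> B" for x
      using less.prems(2)[of a b x] ab that B(1) by blast
    then have "avoids c e (insert a B)"
      using B(2) by (auto simp: avoids_def sym)
    moreover have "finite B" using B(1) less.prems(1) finite_subset by blast
    then have "card (insert a B) = Suc (card B)" using B(1) by (intro card_insert_disjoint) auto
    ultimately show ?thesis using B ab card by (intro exI[of _ "insert a B"]) auto
  qed
qed

end

text \<open>\<open>G\<close> is the set to be bounded, \<open>C\<close> its colours,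
  \<open>M\<close> a homogeneous subset with representative \<open>m0\<close>, and
  \<open>\<pi>\<close> a Gallai partition of \<open>M\<close> in the colours \<open>i\<close> and
  \<open>j\<close>. \<open>part_le\<close> is what remains of the choice of \<open>M\<close> as
  smallest.\<close>

locale gallai_step = ramsey_bound c V r for c :: "'a \<Rightarrow> 'a \<Rightarrow> nat" and V r +
  fixes k :: nat and C :: "nat set" and G M :: "'a set" and m0 :: 'a and \<pi> :: "'a \<Rightarrow> 'a" and i j :: nat
  assumes k3: "3 \<le> k"
    and IH: "\<And>X D. X \<subseteq> V \<Longrightarrow> finite D \<Longrightarrow> card D < k \<Longrightarrow> colored_by c D X \<Longrightarrow> card X \<le> gr_val r (card D)"
    and G_sub: "G \<subseteq> V" and finite_C: "finite C" and card_C: "card C = k" and col_G: "colored_by c C G"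
    and M_sub: "M \<subseteq> G" and m0: "m0 \<in> M"
    and module: "\<And>t x y. t \<in> G \<Longrightarrow> t \<notin> M \<Longrightarrow> x \<in> M \<Longrightarrow> y \<in> M \<Longrightarrow> c t x = c t y"
    and M_large: "gr_val r (k - 1) < card M"
    and ij: "i \<in> C" "j \<in> C" "i \<noteq> j"
    and cross: "\<And>x y. x \<in> M \<Longrightarrow> y \<in> M \<Longrightarrow> \<pi> x \<noteq> \<pi> y \<Longrightarrow> c x y \<in> {i, j}"
    and part_module: "\<And>x x' y. x \<in> M \<Longrightarrow> x' \<in> M \<Longrightarrow> y \<in> M \<Longrightarrow> \<pi> x = \<pi> x' \<Longrightarrow> \<pi> x \<noteq> \<pi> y \<Longrightarrow> c x y = c x' y"
    and part_le: "\<And>x. x \<in> M \<Longrightarrow> card {y\<in>M. \<pi> y = \<pi> x} \<le> gr_val r (k - 1)"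
begin

definition part :: "'a \<Rightarrow> 'a set" where "part x = {y \<in> M. \<pi> y = \<pi> x}"

definition T :: "'a set" where "T = G - M"

definition T_colors :: "nat set" where "T_colors = (\<lambda>t. c t m0) ` T"

text \<open>A set of vertices, not of parts; two is the largest size of a part to which
  \<open>join_avoids\<close> does not apply.\<close>

definition small :: "'a set" where "small = {x \<in> M. card (part x) \<le> 2}"

text \<open>The colours \<open>i\<close> and \<open>j\<close> play symmetric roles; interpreting the
  locale with them exchanged supplies the mirrored half of a case distinction.\<close>

lemma swap: "gallai_step c V r k C G M m0 \<pi> j i"
proof unfold_locales
  show "c x y \<in> {j, i}" if "x \<in> M" "y \<in> M" "\<pi> x \<noteq> \<pi> y" for x y
    using cross[OF that] by blast
qed (fact k3 G_sub finite_C card_C col_G M_sub m0 M_large ij ij(3)[symmetric] | (rule IH module part_module part_le; assumption))+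

lemma M_V: "M \<subseteq> V" and T_V: "T \<subseteq> V" and finite_M: "finite M" and finite_T: "finite T"
  and finite_Tc: "finite T_colors" and card_G: "card G = card M + card T"
proof -
  show MV: "M \<subseteq> V" and TV: "T \<subseteq> V" using M_sub G_sub by (auto simp: T_def)
  then show fM: "finite M" and fT: "finite T" using finite_sub by blast+
  then show "finite T_colors" by (simp add: T_colors_def)
  show "card G = card M + card T"
    unfolding T_def using M_sub fM G_sub finite_sub by (metis card_Diff_subset card_mono le_add_diff_inverse)
qed

lemma part_sub: "part x \<subseteq> M" and part_subV: "part x \<subseteq> V" and finite_part: "finite (part x)"
  using M_V finite_M by (auto simp: part_def)

lemma part_self: "x \<in> M \<Longrightarrow> x \<in> part x"
  by (simp add: part_def)

lemma part_disjoint: "\<pi> x \<noteq> \<pi> y \<Longrightarrow> part x \<inter> part y = {}"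
  by (auto simp: part_def)

lemma T_color: "t \<in> T \<Longrightarrow> x \<in> M \<Longrightarrow> c t x = c t m0"
  by (rule module[OF _ _ _ m0]) (auto simp: T_def)

lemma T_colors_sub: "T_colors \<subseteq> C"
proof
  fix e assume "e \<in> T_colors"
  then obtain t where t: "t \<in> T" "e = c t m0" by (auto simp: T_colors_def)
  then have "t \<noteq> m0" "t \<in> G" "m0 \<in> G" using m0 M_sub by (auto simp: T_def)
  then show "e \<in> C" using col_G t(2) by (auto dest: colored_byD)
qed

lemma cross_const:
  assumes "x' \<in> part x" "y' \<in> part y" "x \<in> M" "y \<in> M" "\<pi> x \<noteq> \<pi> y"
  shows "c x' y' = c x y"
proof -
  have "x' \<in> M" "y' \<in> M" "\<pi> x' = \<pi> x" "\<pi> y' = \<pi> y" using assms by (auto simp: part_def)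
  then show ?thesis
    using part_module[of x' x y'] part_module[of y' y x] assms(3-5) sym by metis
qed

lemma joined_parts: "x \<in> M \<Longrightarrow> y \<in> M \<Longrightarrow> \<pi> x \<noteq> \<pi> y \<Longrightarrow> joined c (c x y) (part x) (part y)"
  unfolding joined_def using cross_const by blast

lemma joined_point_part: "x \<in> M \<Longrightarrow> y \<in> M \<Longrightarrow> \<pi> x \<noteq> \<pi> y \<Longrightarrow> joined c (c x y) {x} (part y)"
  unfolding joined_def using cross_const part_self by blast

lemma joined_T: "t \<in> T \<Longrightarrow> X \<subseteq> M \<Longrightarrow> joined c (c t m0) {t} X"
  unfolding joined_def using T_color by blast

lemma parts_avoid:
  assumes "x \<in> M" "y \<in> M" "\<pi> x \<noteq> \<pi> y" "3 \<le> card (part x)" "3 \<le> card (part y)"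
  shows "avoids c (c x y) (part x)"
  by (rule join_avoids[OF part_subV part_subV part_disjoint[OF assms(3)] assms(4,5) joined_parts[OF assms(1-3)]])

lemma no_triple:
  assumes "v \<in> M" "x \<in> M" "y \<in> M" "\<pi> v \<noteq> \<pi> x" "\<pi> v \<noteq> \<pi> y" "\<pi> x \<noteq> \<pi> y"
    "2 \<le> card (part x)" "2 \<le> card (part y)"
  shows "\<not> (c v x = c x y \<and> c v y = c x y)"
proof
  assume *: "c v x = c x y \<and> c v y = c x y"
  show False
    by (rule no_mono_triple[OF part_subV[of x] part_subV[of y] part_disjoint assms(7,8) joined_parts, of v])
      (use assms * joined_point_part[of v x] joined_point_part[of v y] M_V in \<open>auto simp: part_def\<close>)
qed

lemma T_no_triple:
  assumes "t \<in> T" "X \<subseteq> M" "Y \<subseteq> M" "X \<inter> Y = {}" "2 \<le> card X" "2 \<le> card Y" "joined c e X Y"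
  shows "c t m0 \<noteq> e"
proof
  assume e: "c t m0 = e"
  have "X \<subseteq> V" "Y \<subseteq> V" "t \<in> V" "t \<notin> X" "t \<notin> Y" using assms(1-3) M_V T_V by (auto simp: T_def)
  then show False
    using no_mono_triple[of X Y e t] assms joined_T[of t X] joined_T[of t Y] e by blast
qed

text \<open>One representative of each nonempty class of outside vertices may be added to \<open>X\<close>:
  since there is no rainbow triangle, the edges among the representatives only use colours of
  their edges to \<open>M\<close>.\<close>

lemma card_with_outside:
  assumes X: "X \<subseteq> M" and D: "D \<subseteq> C" "1 \<le> card D" and col: "colored_by c (C - D) X"
  shows "card X + card (T_colors - D) \<le> gr_val r (k - card D)"
proof -
  define \<rho> where "\<rho> e = (SOME t. t \<in> T \<and> c t m0 = e)" for e
  have \<rho>: "\<rho> e \<in> T \<and> c (\<rho> e) m0 = e" if "e \<in> T_colors" for e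
  proof -
    have "\<exists>t. t \<in> T \<and> c t m0 = e" using that by (auto simp: T_colors_def)
    then show ?thesis unfolding \<rho>_def by (rule someI_ex)
  qed
  let ?R = "\<rho> ` (T_colors - D)"
  have inj: "inj_on \<rho> (T_colors - D)" using \<rho> by (metis DiffD1 inj_onI)
  have RT: "?R \<subseteq> T" using \<rho> by blast
  have rr: "c p q \<in> C - D" if pq: "p \<in> ?R" "q \<in> ?R" "p \<noteq> q" for p q
  proof -
    obtain a b where ab: "a \<in> T_colors - D" "b \<in> T_colors - D" "p = \<rho> a" "q = \<rho> b" using pq by blast
    then have "p \<in> V" "q \<in> V" "m0 \<in> V" "p \<noteq> m0" "q \<noteq> m0"
      using \<rho> T_V M_V m0 by (auto simp: T_def)
    then have "c p q = c q m0 \<or> c q m0 = c p m0 \<or> c p q = c p m0"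
      using rainbow_freeD[OF rainbow_free] pq(3) by blast
    then have "c p q = b \<or> b = a \<or> c p q = a" using \<rho> ab by auto
    then show ?thesis using ab pq(3) T_colors_sub by blast
  qed
  have rx: "c p x \<in> C - D" if px: "p \<in> ?R" "x \<in> X" for p x
  proof -
    obtain a where "a \<in> T_colors - D" "p = \<rho> a" using px by blast
    then show ?thesis using \<rho>[of a] T_color[of p x] subsetD[OF X px(2)] T_colors_sub by auto
  qed
  have "colored_by c (C - D) (X \<union> ?R)"
    unfolding colored_by_def
  proof (intro ballI impI)
    fix p q assume pq: "p \<in> X \<union> ?R" "q \<in> X \<union> ?R" "p \<noteq> q"
    then consider "p \<in> X" "q \<in> X" | "p \<in> ?R" "q \<in> X" | "q \<in> ?R" "p \<in> X" | "p \<in> ?R" "q \<in> ?R"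
      by blast
    then show "c p q \<in> C - D"
    proof cases
      case 3
      then show ?thesis using rx sym[of p q] by simp
    qed (use rr rx pq(3) colored_byD[OF col] in \<open>blast+\<close>)
  qed
  moreover have cD: "card (C - D) = k - card D"
    using D finite_C card_C by (metis card_Diff_subset finite_subset)
  ultimately have "card (X \<union> ?R) \<le> gr_val r (k - card D)"
    using IH[of "X \<union> ?R" "C - D"] X RT M_V T_V finite_C D(2) k3 by auto
  moreover have "card (X \<union> ?R) = card X + card ?R"
    using X RT finite_M finite_T by (intro card_Un_disjoint) (auto intro: finite_subset simp: T_def)
  ultimately show ?thesis using inj by (simp add: card_image)
qed

lemma card_avoid1:
  assumes "X \<subseteq> M" "avoids c e X" "e \<in> C"
  shows "card X + card (T_colors - {e}) \<le> gr_val r (k - 1)"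
proof -
  have "colored_by c (C - {e}) X"
    using subset_trans[OF assms(1) M_sub] assms(2-) col_G unfolding colored_by_def avoids_def by blast
  then show ?thesis using card_with_outside[of X "{e}"] assms by simp
qed

lemma card_avoid2:
  assumes "X \<subseteq> M" "avoids c i X" "avoids c j X"
  shows "card X + card (T_colors - {i, j}) \<le> gr_val r (k - 2)"
proof -
  have "colored_by c (C - {i, j}) X"
    using subset_trans[OF assms(1) M_sub] assms(2-) col_G unfolding colored_by_def avoids_def by blast
  then show ?thesis using card_with_outside[of X "{i, j}"] assms ij by (simp add: numeral_2_eq_2)
qed

text \<open>Three outside vertices seeing \<open>M\<close> in colour \<open>e\<close> would make
  \<open>M\<close> avoid \<open>e\<close>, and \<open>M\<close> would obey the bound for
  \<open>k - 1\<close> colours.\<close>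

lemma T_class_le: "card {t \<in> T. c t m0 = e} \<le> 2"
proof (rule ccontr)
  assume "\<not> ?thesis"
  then have 3: "3 \<le> card {t \<in> T. c t m0 = e}" by simp
  then have "{t \<in> T. c t m0 = e} \<noteq> {}" by (metis card.empty not_numeral_le_zero)
  then have e: "e \<in> C" using T_colors_sub by (auto simp: T_colors_def)
  have "joined c e {t \<in> T. c t m0 = e} M" using T_color by (auto simp: joined_def)
  moreover have "3 \<le> card M" using M_large gr_val_bounds(1)[OF r_ge r_le, of "k + 1"] k3 by simp
  ultimately have "avoids c e M"
    using 3 M_V T_V joined_sym by (intro join_avoids[of M "{t \<in> T. c t m0 = e}"]) (auto simp: T_def)
  then show False using card_avoid1[of M e] e M_large by simp
qed

lemma card_T_le:
  assumes "\<And>t. t \<in> T \<Longrightarrow> P t \<Longrightarrow> c t m0 \<in> U" "finite U"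
  shows "card {t \<in> T. P t} \<le> 2 * card U"
proof -
  have "{t \<in> T. P t} \<subseteq> (\<Union>e\<in>U. {t \<in> T. c t m0 = e})" using assms by blast
  then have "card {t \<in> T. P t} \<le> card (\<Union>e\<in>U. {t \<in> T. c t m0 = e})"
    using assms(2) finite_T by (intro card_mono) auto
  also have "\<dots> \<le> (\<Sum>e\<in>U. card {t \<in> T. c t m0 = e})" using assms(2) by (rule card_UN_le)
  also have "\<dots> \<le> (\<Sum>e\<in>U. 2)" by (intro sum_mono T_class_le)
  finally show ?thesis by simp
qed

lemma card_T: "card T \<le> 2 * card T_colors"
  using card_T_le[of "\<lambda>_. True" T_colors] finite_Tc by (auto simp: T_colors_def)

text \<open>With three vertices \<open>Z\<close> would avoid both colours. But the parts in question
  have at most two vertices, so \<open>Z\<close> meets two parts, and an edge between them has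
  colour \<open>i\<close> or \<open>j\<close>.\<close>

lemma small_both:
  assumes Z: "Z \<subseteq> small" "Z \<inter> P = {}" "Z \<inter> Q = {}" "P \<subseteq> V" "Q \<subseteq> V" "3 \<le> card P" "3 \<le> card Q"
    "joined c i Z P" "joined c j Z Q"
  shows "card Z \<le> 2"
proof (rule ccontr)
  assume "\<not> card Z \<le> 2"
  then have 3: "3 \<le> card Z" by simp
  have ZV: "Z \<subseteq> V" "Z \<subseteq> M" using Z(1) M_V by (auto simp: small_def)
  have i: "avoids c i Z" by (rule join_avoids[OF ZV(1) Z(4,2) 3 Z(6,8)])
  have j: "avoids c j Z" by (rule join_avoids[OF ZV(1) Z(5,3) 3 Z(7,9)])
  obtain z where z: "z \<in> Z" using 3 by fastforce
  have "\<not> Z \<subseteq> part z"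
    using 3 z Z(1) card_mono[OF finite_part, of Z z] by (auto simp: small_def)
  then obtain z' where z': "z' \<in> Z" "z' \<notin> part z" by blast
  have M: "z \<in> M" "z' \<in> M" using z z'(1) ZV(2) by blast+
  have ne: "\<pi> z \<noteq> \<pi> z'" using z'(2) M by (simp add: part_def eq_commute)
  then have "z \<noteq> z'" by blast
  then have "c z z' \<noteq> i" "c z z' \<noteq> j" using avoidsD[OF i z z'(1)] avoidsD[OF j z z'(1)] by blast+
  then show False using cross[OF M ne] by simp
qed

text \<open>Edges of \<open>Z\<close> in colours other than \<open>j\<close> lie inside parts of at
  most two vertices, hence form a matching, and \<open>near_clique_bound\<close> applies.\<close>

lemma small_avoid:
  assumes Z: "Z \<subseteq> small" "avoids c i Z"
  shows "card Z \<le> 4"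
proof (rule near_clique_bound[where e = j])
  show "Z \<subseteq> V" using Z(1) M_V by (auto simp: small_def)
  fix x y z assume xyz: "x \<in> Z" "y \<in> Z" "z \<in> Z" "x \<noteq> y" "y \<noteq> z" "x \<noteq> z"
  show "c x y = j \<or> c x z = j"
  proof (rule ccontr)
    assume n: "\<not> ?thesis"
    have M: "x \<in> M" "y \<in> M" "z \<in> M" using xyz Z(1) by (auto simp: small_def)
    have "c x y \<noteq> i" "c x z \<noteq> i" using Z(2) xyz by (auto dest: avoidsD)
    then have "\<pi> x = \<pi> y" "\<pi> x = \<pi> z" using cross[of x y] cross[of x z] M n by auto
    then have "x \<in> part x" "y \<in> part x" "z \<in> part x" using M by (auto simp: part_def)
    moreover have "card (part x) \<le> 2" using xyz Z(1) by (auto simp: small_def)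
    ultimately show False using card_le_2D[of "part x" x y z] finite_part xyz by blast
  qed
qed

end

section \<open>Colourings with few large parts\<close>

context gallai_step
begin

text \<open>One representative for each large part; the final count distinguishes cases by
  \<open>card Q\<close>.\<close>

definition big_reps :: "'a set \<Rightarrow> bool" where
  "big_reps Q \<longleftrightarrow> Q \<subseteq> M \<and> inj_on \<pi> Q \<and> (\<forall>q\<in>Q. 3 \<le> card (part q)) \<and> (\<forall>x\<in>M. \<pi> x \<in> \<pi> ` Q \<or> x \<in> small)"

lemma small_M: "small \<subseteq> M"
  by (auto simp: small_def)

lemma finite_small: "finite small"
  using small_M finite_M finite_subset by blast

lemma small_part_ne:
  assumes "s \<in> small" "3 \<le> card (part a)"
  shows "\<pi> s \<noteq> \<pi> a"
  using assms by (auto simp: small_def part_def)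

lemma small_point:
  assumes "s \<in> small" "a \<in> M" "3 \<le> card (part a)"
  shows "c s a = i \<or> c s a = j"
  using cross[of s a] small_part_ne[OF assms(1,3)] assms small_M by blast

lemma joined_small:
  assumes "Z \<subseteq> small" "a \<in> M" "3 \<le> card (part a)" "\<And>z. z \<in> Z \<Longrightarrow> c z a = e"
  shows "joined c e Z (part a)"
  unfolding joined_def
proof (intro ballI)
  fix z x assume "z \<in> Z" "x \<in> part a"
  moreover have "joined c (c z a) {z} (part a)"
    using joined_point_part[of z a] small_part_ne[of z a] assms \<open>z \<in> Z\<close> small_M by blast
  ultimately show "c z x = e" using assms(4) by (auto simp: joined_def)
qed

lemma small_disjoint: "Z \<subseteq> small \<Longrightarrow> 3 \<le> card (part a) \<Longrightarrow> Z \<inter> part a = {}"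
  using small_part_ne by (fastforce simp: part_def)

lemma small_no_triple:
  assumes "s \<in> small" "a \<in> M" "b \<in> M" "\<pi> a \<noteq> \<pi> b" "3 \<le> card (part a)" "3 \<le> card (part b)"
  shows "\<not> (c s a = c a b \<and> c s b = c a b)"
  using no_triple[of s a b] small_part_ne[of s a] small_part_ne[of s b] assms small_M by auto

lemma bigD:
  assumes "big_reps Q"
  shows "Q \<subseteq> M" "finite Q" "inj_on \<pi> Q" "\<And>q. q \<in> Q \<Longrightarrow> q \<in> M" "\<And>q. q \<in> Q \<Longrightarrow> 3 \<le> card (part q)"
    "\<And>p q. p \<in> Q \<Longrightarrow> q \<in> Q \<Longrightarrow> p \<noteq> q \<Longrightarrow> \<pi> p \<noteq> \<pi> q"
    "\<And>x. x \<in> M \<Longrightarrow> x \<notin> small \<Longrightarrow> \<pi> x \<in> \<pi> ` Q"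
  using assms finite_M finite_subset unfolding big_reps_def by (blast, blast, blast, blast, blast, metis inj_onD, blast)

lemma card_M:
  assumes "big_reps Q"
  shows "card M = (\<Sum>q\<in>Q. card (part q)) + card small"
proof -
  note b = bigD[OF assms]
  have "x \<in> (\<Union>q\<in>Q. part q) \<union> small" if "x \<in> M" for x
    using b(7)[OF that] that by (auto simp: part_def)
  then have "M = (\<Union>q\<in>Q. part q) \<union> small"
    using small_M part_sub by blast
  moreover have "small \<inter> part q = {}" if "q \<in> Q" for q
    using that b(5) by (intro small_disjoint) auto
  then have "card ((\<Union>q\<in>Q. part q) \<union> small) = card (\<Union>q\<in>Q. part q) + card small"
    using b(2) finite_part finite_small by (intro card_Un_disjoint) auto
  moreover have "card (\<Union>q\<in>Q. part q) = (\<Sum>q\<in>Q. card (part q))"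
    using b(2) finite_part part_disjoint[OF b(6)] by (intro card_UN_disjoint) blast+
  ultimately show ?thesis by simp
qed

lemma big_cross:
  assumes "big_reps Q" "p \<in> Q" "q \<in> Q" "p \<noteq> q"
  shows "c p q = i \<or> c p q = j"
  using cross[of p q] bigD[OF assms(1)] assms(2-4) by blast

lemma big_no_triple:
  assumes "big_reps Q" "p \<in> Q" "q \<in> Q" "s \<in> Q" "p \<noteq> q" "q \<noteq> s" "p \<noteq> s"
  shows "\<not> (c p q = c q s \<and> c p s = c q s)"
  using no_triple[of p q s] bigD(4,6)[OF assms(1)] bigD(5)[OF assms(1), of q] bigD(5)[OF assms(1), of s]
    assms(2-) by auto

lemma big_avoid:
  assumes "big_reps Q" "p \<in> Q" "q \<in> Q" "p \<noteq> q"
  shows "avoids c (c p q) (part p)"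
  using parts_avoid[of p q] bigD(4,5,6)[OF assms(1)] assms(2-) by blast

lemma big_T_color:
  assumes "big_reps Q" "p \<in> Q" "q \<in> Q" "p \<noteq> q"
  shows "c p q \<notin> T_colors"
proof
  assume "c p q \<in> T_colors"
  then obtain t where t: "t \<in> T" "c p q = c t m0" by (auto simp: T_colors_def)
  have "2 \<le> card (part p)" "2 \<le> card (part q)"
    using bigD(5)[OF assms(1), of p] bigD(5)[OF assms(1), of q] assms(2,3) by auto
  then show False
    using T_no_triple[OF t(1) part_sub part_sub part_disjoint _ _ joined_parts, of p q] t(2)
      bigD(4,6)[OF assms(1)] assms(2-) by simp
qed

text \<open>Two small and two outside vertices make four. With three small vertices, an outside
  vertex of colour \<open>i\<close> would be the hub of a wheel, and the small ones avoid
  \<open>i\<close>, so that \<open>small_avoid\<close> gives four again.\<close>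

lemma side_le_i:
  assumes "a \<in> M" "3 \<le> card (part a)"
  shows "card {s \<in> small. c s a = i} + card {t \<in> T. c t m0 = i} \<le> 4"
proof (cases "3 \<le> card {s \<in> small. c s a = i}")
  case False
  then show ?thesis using T_class_le[of i] by simp
next
  case True
  let ?S = "{s \<in> small. c s a = i}"
  have j: "joined c i ?S (part a)" using assms by (intro joined_small) auto
  have d: "?S \<inter> part a = {}" using assms by (intro small_disjoint) auto
  have SM: "?S \<subseteq> M" using small_M by blast
  have "\<not> (t \<in> T \<and> c t m0 = i)" for t
    using T_no_triple[of t ?S "part a" i] SM part_sub d True assms(2) j by auto
  then have "{t \<in> T. c t m0 = i} = {}" by blast
  moreover have "avoids c i ?S"
    using SM M_V d True assms(2) j by (intro join_avoids[OF _ part_subV]) auto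
  then have "card ?S \<le> 4" by (intro small_avoid) auto
  ultimately show ?thesis by (metis add.right_neutral card.empty)
qed

lemma side_le_j:
  assumes "a \<in> M" "3 \<le> card (part a)"
  shows "card {s \<in> small. c s a = j} + card {t \<in> T. c t m0 = j} \<le> 4"
proof -
  interpret sw: gallai_step c V r k C G M m0 \<pi> j i by (rule swap)
  show ?thesis using assms by (rule sw.side_le_i)
qed

text \<open>Each of \<open>i\<close> and \<open>j\<close> accounts for at most four small and
  outside vertices, and the other \<open>k - 2\<close> colours for two outside vertices each. This
  is the summand \<open>2 * k + 4\<close> in \<open>gr_val_bounds\<close>.\<close>

lemma one_big:
  assumes Q: "big_reps {a}"
  shows "card G \<le> gr_val r k"
proof -
  have a: "a \<in> M" "3 \<le> card (part a)" using bigD[OF Q] by auto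
  have "small = {s \<in> small. c s a = i} \<union> {s \<in> small. c s a = j}" using small_point a by blast
  then have S: "card small \<le> card {s \<in> small. c s a = i} + card {s \<in> small. c s a = j}"
    by (metis card_Un_le)
  let ?O = "{t \<in> T. c t m0 \<notin> {i, j}}"
  have "T = {t \<in> T. c t m0 = i} \<union> {t \<in> T. c t m0 = j} \<union> ?O" by auto
  then have T: "card T \<le> card {t \<in> T. c t m0 = i} + card {t \<in> T. c t m0 = j} + card ?O"
    by (metis (no_types, lifting) add_le_mono1 card_Un_le order_trans)
  have "card ?O \<le> 2 * card (C - {i, j})"
    using T_colors_sub finite_C by (intro card_T_le) (auto simp: T_colors_def)
  also have "card (C - {i, j}) = k - 2"
    using ij finite_C card_C by (simp add: numeral_2_eq_2)
  finally have O: "card ?O \<le> 2 * (k - 2)" .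
  have "card (part a) \<le> gr_val r (k - 1)" using part_le[OF a(1)] by (simp add: part_def)
  moreover have "card M = card (part a) + card small" using card_M[OF Q] by simp
  ultimately show ?thesis
    using S T O side_le_i[OF a] side_le_j[OF a] card_G gr_val_bounds(5)[OF r_ge r_le k3] gr_val_step[OF k3, of r] k3
    by linarith
qed

text \<open>If \<open>q\<close> saw three other large parts in one colour, these would be joined
  pairwise in the other colour, a monochromatic triangle of large parts.\<close>

lemma big_both:
  assumes Q: "big_reps Q" "4 \<le> card Q" and q: "q \<in> Q"
  shows "\<exists>p\<in>Q. \<exists>p'\<in>Q. p \<noteq> q \<and> p' \<noteq> q \<and> c q p = i \<and> c q p' = j"
proof -
  have "\<exists>p\<in>Q. p \<noteq> q \<and> c q p \<noteq> e" if e: "e \<in> {i, j}" for e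
  proof (rule ccontr)
    assume "\<not> ?thesis"
    then have all: "c q p = e" if "p \<in> Q" "p \<noteq> q" for p using that by blast
    have "3 \<le> card (Q - {q})" using Q q bigD(2)[OF Q(1)] by simp
    then obtain x y z where xyz: "x \<in> Q - {q}" "y \<in> Q - {q}" "z \<in> Q - {q}" "x \<noteq> y" "y \<noteq> z" "x \<noteq> z"
      by (rule obtain_three)
    have n: "c x y \<noteq> e" "c y z \<noteq> e" "c x z \<noteq> e"
      using big_no_triple[OF Q(1) q, of x y] big_no_triple[OF Q(1) q, of y z] big_no_triple[OF Q(1) q, of x z]
        all xyz by auto
    have "c x y = i \<or> c x y = j" "c y z = i \<or> c y z = j" "c x z = i \<or> c x z = j"
      using big_cross[OF Q(1)] xyz by auto
    then have "c x y = c y z" "c x z = c y z" using n e by auto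
    then show False using big_no_triple[OF Q(1), of x y z] xyz by blast
  qed
  from this[of i] this[of j] show ?thesis using big_cross[OF Q(1) q] by blast
qed

text \<open>The part avoids \<open>i\<close> and \<open>j\<close>, and no outside vertex sees
  \<open>M\<close> in these colours, since it would be the hub of a wheel over two large parts. So
  all of \<open>T_colors\<close> can be charged to this part.\<close>

lemma both_bound:
  assumes Q: "big_reps Q" and q: "q \<in> Q" "p \<in> Q" "p' \<in> Q" "p \<noteq> q" "p' \<noteq> q" "c q p = i" "c q p' = j"
  shows "card (part q) + card T_colors \<le> gr_val r (k - 2)"
proof -
  have "avoids c i (part q)" "avoids c j (part q)"
    using big_avoid[OF Q q(1,2)] big_avoid[OF Q q(1,3)] q(4-) by auto
  moreover have "i \<notin> T_colors" "j \<notin> T_colors"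
    using big_T_color[OF Q q(1,2)] big_T_color[OF Q q(1,3)] q(4-) by auto
  ultimately show ?thesis using card_avoid2[OF part_sub, of q] by simp
qed

text \<open>Six representatives with at most one outside \<open>Q\<close> contain a monochromatic
  triangle with two corners in \<open>Q\<close>, hence a wheel. So there are exactly five large
  parts and no small vertices, and five copies of \<open>card T_colors\<close> are saved while the
  outside vertices cost only two.\<close>

lemma five_big:
  assumes Q: "big_reps Q" "5 \<le> card Q"
  shows "card G \<le> gr_val r k"
proof -
  note b = bigD[OF Q(1)]
  have no_six: "\<not> 6 \<le> card P" if "Q \<subseteq> P" "P \<subseteq> M" "inj_on \<pi> P" "card (P - Q) \<le> 1" for P
  proof
    assume 6: "6 \<le> card P"
    have fP: "finite P" using that finite_M finite_subset by blast
    have "colored_by c {i, j} P"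
      using cross that(2,3) unfolding colored_by_def by (meson inj_onD subsetD)
    then obtain x y z where xyz: "x \<in> P" "y \<in> P" "z \<in> P" "x \<noteq> y" "y \<noteq> z" "x \<noteq> z" "c x y = c y z" "c x z = c y z"
      using mono_triangle_of_six[OF fP 6] by blast
    have eq: "u = v" if "u \<in> P" "u \<notin> Q" "v \<in> P" "v \<notin> Q" for u v
      using card_le_Suc0_iff_eq[of "P - Q"] fP \<open>card (P - Q) \<le> 1\<close> that by auto
    have key: False if "x \<in> P" "y \<in> Q" "z \<in> Q" "x \<noteq> y" "y \<noteq> z" "x \<noteq> z" "c x y = c y z" "c x z = c y z" for x y z
    proof -
      have "2 \<le> card (part y)" "2 \<le> card (part z)" using b(5)[of y] b(5)[of z] that(2,3) by simp_all
      moreover have "x \<in> M" "y \<in> M" "z \<in> M" "\<pi> x \<noteq> \<pi> y" "\<pi> x \<noteq> \<pi> z" "\<pi> y \<noteq> \<pi> z"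
        using that \<open>P \<subseteq> M\<close> \<open>Q \<subseteq> P\<close> \<open>inj_on \<pi> P\<close> by (auto dest: inj_onD)
      ultimately show False using no_triple[of x y z] that(7,8) by blast
    qed
    consider "y \<in> Q" "z \<in> Q" | "x \<in> Q" "z \<in> Q" | "x \<in> Q" "y \<in> Q"
      using eq xyz by blast
    then show False
    proof cases
      case 1 then show ?thesis using key[of x y z] xyz by blast
    next
      case 2 then show ?thesis using key[of y x z] xyz sym by metis
    next
      case 3 then show ?thesis using key[of z x y] xyz sym by metis
    qed
  qed
  have Q5: "card Q = 5" using no_six[of Q] Q(2) b by simp
  have "v \<notin> small" for v
  proof
    assume v: "v \<in> small"
    have "inj_on \<pi> (insert v Q)" "v \<notin> Q"
      using b(3) small_part_ne[OF v b(5)] by fastforce+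
    then show False
      using no_six[of "insert v Q"] subsetD[OF small_M v] b(1,2) Q5 by (simp add: insert_Diff_if subset_insertI)
  qed
  then have "small = {}" by blast
  then have M: "card M = (\<Sum>q\<in>Q. card (part q))" using card_M[OF Q(1)] by simp
  have "(\<Sum>q\<in>Q. card (part q) + card T_colors) \<le> (\<Sum>q\<in>Q. gr_val r (k - 2))"
  proof (rule sum_mono)
    fix q assume q: "q \<in> Q"
    then obtain p p' where "p \<in> Q" "p' \<in> Q" "p \<noteq> q" "p' \<noteq> q" "c q p = i" "c q p' = j"
      using big_both[OF Q(1) _ q] Q(2) by auto
    then show "card (part q) + card T_colors \<le> gr_val r (k - 2)"
      using both_bound[OF Q(1) q] by blast
  qed
  then have "(\<Sum>q\<in>Q. card (part q)) + 5 * card T_colors \<le> 5 * gr_val r (k - 2)"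
    using Q5 by (simp add: sum.distrib)
  then show ?thesis using M card_T card_G gr_val_step[OF k3, of r] by linarith
qed

text \<open>Since \<open>a\<close> is joined to both others in \<open>i\<close>, the join of
  \<open>b\<close> and \<open>d\<close> has colour \<open>j\<close>. So the parts of
  \<open>b\<close> and \<open>d\<close> avoid both colours, but that of \<open>a\<close> is only
  known to avoid \<open>i\<close>. All small vertices see \<open>a\<close> in \<open>j\<close>, so
  their number decides whether it avoids \<open>j\<close> too.\<close>

lemma three_big:
  assumes Q: "big_reps {a, b, d}" and d: "distinct [a, b, d]" and cols: "c a b = i" "c a d = i"
  shows "card G \<le> gr_val r k"
proof -
  have abd: "a \<in> {a, b, d}" "b \<in> {a, b, d}" "d \<in> {a, b, d}" by simp_all
  have ne: "a \<noteq> b" "a \<noteq> d" "b \<noteq> d" using d by auto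
  note M = bigD(4)[OF Q abd(1)] bigD(4)[OF Q abd(2)] bigD(4)[OF Q abd(3)]
  note large = bigD(5)[OF Q abd(1)] bigD(5)[OF Q abd(2)] bigD(5)[OF Q abd(3)]
  have bd: "c b d = j"
    using big_no_triple[OF Q abd] big_cross[OF Q abd(2,3)] ne cols by auto
  have sym': "c b a = i" "c d a = i" "c d b = j" using cols bd sym by metis+
  have B: "card (part b) + card T_colors \<le> gr_val r (k - 2)"
    using both_bound[OF Q, of b a d] abd ne sym' bd by simp
  have D: "card (part d) + card T_colors \<le> gr_val r (k - 2)"
    using both_bound[OF Q, of d a b] abd ne sym' bd by simp
  have \<tau>: "i \<notin> T_colors" "j \<notin> T_colors"
    using big_T_color[OF Q, of a b] big_T_color[OF Q, of b d] abd ne cols bd by auto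
  have s: "c s a = j \<and> (c s b = i \<or> c s d = i)" if "s \<in> small" for s
  proof -
    have pt: "c s a = i \<or> c s a = j" "c s b = i \<or> c s b = j" "c s d = i \<or> c s d = j"
      using small_point[OF that] M large by auto
    have tr: "\<not> (c s a = c a b \<and> c s b = c a b)" "\<not> (c s a = c a d \<and> c s d = c a d)"
      "\<not> (c s b = c b d \<and> c s d = c b d)"
      using small_no_triple[OF that M(1,2) _ large(1,2)] small_no_triple[OF that M(1,3) _ large(1,3)]
        small_no_triple[OF that M(2,3) _ large(2,3)] bigD(6)[OF Q] ne by auto
    show ?thesis using pt tr cols bd ij(3) by auto
  qed
  have two: "card Z \<le> 2" if "Z \<subseteq> small" "q \<in> {b, d}" "\<And>z. z \<in> Z \<Longrightarrow> c z q = i" for Z q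
  proof -
    have q: "q \<in> M" "3 \<le> card (part q)" using that(2) M large by auto
    show ?thesis
      by (rule small_both[OF that(1) small_disjoint[OF that(1) q(2)] small_disjoint[OF that(1) large(1)]
            part_subV part_subV q(2) large(1) joined_small[OF that(1) q that(3)] joined_small[OF that(1) M(1) large(1)]])
        (use s that(1) in auto)
  qed
  have "small = {s \<in> small. c s b = i} \<union> {s \<in> small. c s d = i}" using s by blast
  then have "card small \<le> card {s \<in> small. c s b = i} + card {s \<in> small. c s d = i}" by (metis card_Un_le)
  moreover have "card {s \<in> small. c s b = i} \<le> 2" "card {s \<in> small. c s d = i} \<le> 2"
    by (rule two[of _ b]; auto) (rule two[of _ d]; auto)
  ultimately have S4: "card small \<le> 4" by simp
  have cM: "card M = card (part a) + card (part b) + card (part d) + card small"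
    using card_M[OF Q] ne by simp
  have Aij: "avoids c i (part a)" using big_avoid[OF Q, of a b] ne cols by simp
  show ?thesis
  \<comment> \<open>Three small vertices force \<open>part a\<close> to avoid \<open>j\<close>;
    otherwise two of them fit into
    \<open>gr_val r (k - 1) + 2 \<le> 3 * gr_val r (k - 2)\<close>.\<close>
  proof (cases "3 \<le> card small")
    case True
    have "joined c j small (part a)" using s M large by (intro joined_small) auto
    then have "avoids c j (part a)"
      using True large(1) small_disjoint[OF subset_refl large(1)] small_M M_V joined_sym
      by (intro join_avoids[of "part a" small]) (auto simp: part_subV Int_commute)
    then have "card (part a) + card T_colors \<le> gr_val r (k - 2)"
      using card_avoid2[OF part_sub Aij] \<tau> by simp
    then show ?thesis
      using B D cM S4 card_T card_G gr_val_bounds(1)[OF r_ge r_le k3] gr_val_step[OF k3, of r] by linarith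
  next
    case False
    have "card (part a) + card T_colors \<le> gr_val r (k - 1)"
      using card_avoid1[OF part_sub Aij ij(1)] \<tau> by simp
    then show ?thesis
      using B D cM False card_T card_G gr_val_bounds(2)[OF r_ge r_le k3] gr_val_step[OF k3, of r] by linarith
  qed
qed

text \<open>If the edges from \<open>q\<close> to \<open>v\<close>, \<open>x\<close>,
  \<open>y\<close> had one colour, the edges among \<open>v\<close>, \<open>x\<close>,
  \<open>y\<close> would all have the other one: a wheel with hub \<open>v\<close> over the parts of
  \<open>x\<close> and \<open>y\<close>.\<close>

lemma fan:
  assumes Q: "big_reps Q" and v: "v \<in> M" "\<pi> v \<notin> \<pi> ` Q" and q: "q \<in> Q" "x \<in> Q" "y \<in> Q"
    and ne: "q \<noteq> x" "q \<noteq> y" "x \<noteq> y"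
  shows "\<not> (c v q = c q x \<and> c q x = c q y)"
proof
  assume *: "c v q = c q x \<and> c q x = c q y"
  note b = bigD[OF Q]
  have \<pi>: "\<pi> v \<noteq> \<pi> q" "\<pi> v \<noteq> \<pi> x" "\<pi> v \<noteq> \<pi> y" using v q by auto
  have large: "2 \<le> card (part z)" if "z \<in> Q" for z using b(5)[OF that] by simp
  have "c x y \<noteq> c q x" using big_no_triple[OF Q q] ne * by metis
  moreover have "c v x \<noteq> c q x"
    using no_triple[of v q x] v b(4) q \<pi> b(6)[of q x] ne large * by metis
  moreover have "c v y \<noteq> c q x"
    using no_triple[of v q y] v b(4) q \<pi> b(6)[of q y] ne large * by metis
  moreover have "c x y \<in> {i, j}" "c q x \<in> {i, j}" "c v x \<in> {i, j}" "c v y \<in> {i, j}"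
    using big_cross[OF Q] q ne cross[OF v(1)] b(4) \<pi> by blast+
  ultimately have "c v x = c x y" "c v y = c x y" by auto
  then show False using no_triple[of v x y] v b(4) q \<pi> b(6)[of x y] ne large by metis
qed

text \<open>Two of the three joins at a large part share a colour, so by \<open>fan\<close> every
  small vertex sees this part in the other colour. Thus small vertices look alike from all large
  parts; they see one in \<open>i\<close> and one in \<open>j\<close>, and \<open>small_both\<close>
  leaves at most two.\<close>

lemma four_big:
  assumes Q: "big_reps Q" "card Q = 4"
  shows "card G \<le> gr_val r k"
proof -
  note b = bigD[OF Q(1)]
  have same: "c s q = c s' q" if "s \<in> small" "s' \<in> small" "q \<in> Q" for s s' q
  proof (rule ccontr)
    assume n: "c s q \<noteq> c s' q"
    have "card (Q - {q}) = 3" using Q(2) that(3) b(2) by simp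
    then obtain x y z where xyz: "x \<in> Q - {q}" "y \<in> Q - {q}" "z \<in> Q - {q}" "x \<noteq> y" "y \<noteq> z" "x \<noteq> z"
      using obtain_three[of "Q - {q}"] by auto
    have "\<pi> s \<notin> \<pi> ` Q" "\<pi> s' \<notin> \<pi> ` Q" using small_part_ne[OF that(1) b(5)] small_part_ne[OF that(2) b(5)] by blast+
    then have f: "\<not> (c t q = c q p \<and> c q p = c q p')"
      if "t \<in> {s, s'}" "p \<in> {x, y, z}" "p' \<in> {x, y, z}" "p \<noteq> p'" for t p p'
      using fan[OF Q(1), of t q p p'] that \<open>s \<in> small\<close> \<open>s' \<in> small\<close> \<open>q \<in> Q\<close> small_M xyz by auto
    have "c q x = i \<or> c q x = j" "c q y = i \<or> c q y = j" "c q z = i \<or> c q z = j"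
      "c s q = i \<or> c s q = j" "c s' q = i \<or> c s' q = j"
      using big_cross[OF Q(1) that(3)] small_point[OF _ b(4)[OF that(3)] b(5)[OF that(3)]] that xyz by auto
    then have "c q x = c s q \<or> c q x = c s' q" "c q y = c s q \<or> c q y = c s' q" "c q z = c s q \<or> c q z = c s' q"
      using n by auto
    moreover have "\<not> (c s q = c q x \<and> c q x = c q y)" "\<not> (c s q = c q y \<and> c q y = c q z)" "\<not> (c s q = c q x \<and> c q x = c q z)"
      "\<not> (c s' q = c q x \<and> c q x = c q y)" "\<not> (c s' q = c q y \<and> c q y = c q z)" "\<not> (c s' q = c q x \<and> c q x = c q z)"
      by (rule f; simp add: xyz)+
    ultimately show False by metis
  qed
  have "card small \<le> 2"
  proof (cases "small = {}")
    case False
    then obtain s where s: "s \<in> small" by blast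
    \<comment> \<open>If \<open>s\<close> missed \<open>e\<close>, it would see all large parts in
      the other colour, in which two of them are joined.\<close>
    have "\<exists>q\<in>Q. c s q = e" if "e \<in> {i, j}" for e
    proof (rule ccontr)
      assume n: "\<not> ?thesis"
      obtain q where q: "q \<in> Q" using Q(2) by fastforce
      then obtain p p' where "p \<in> Q" "p' \<in> Q" "p \<noteq> q" "p' \<noteq> q" "c q p = i" "c q p' = j"
        using big_both[OF Q(1) _ q] Q(2) by auto
      then obtain p where p: "p \<in> Q" "p \<noteq> q" "c q p \<noteq> e" using that ij(3) by metis
      then have "c q p \<in> {i, j}" "c s q \<in> {i, j}" "c s p \<in> {i, j}" "c s q \<noteq> e" "c s p \<noteq> e"
        using big_cross[OF Q(1) q p(1)] small_point[OF s] b(4,5) q n by auto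
      then show False
        using small_no_triple[OF s, of q p] that p q b(4,5) b(6)[of q p] by auto
    qed
    then obtain p q where pq: "p \<in> Q" "q \<in> Q" "c s p = i" "c s q = j" by blast
    have "joined c i small (part p)" "joined c j small (part q)"
      using same[OF _ s] pq b(4,5) by (auto intro!: joined_small)
    then show ?thesis
      using small_both[OF subset_refl small_disjoint small_disjoint part_subV part_subV, of p q] b(5) pq by blast
  qed simp
  moreover have "(\<Sum>q\<in>Q. card (part q) + card T_colors) \<le> (\<Sum>q\<in>Q. gr_val r (k - 2))"
  proof (rule sum_mono)
    fix q assume q: "q \<in> Q"
    then obtain p p' where "p \<in> Q" "p' \<in> Q" "p \<noteq> q" "p' \<noteq> q" "c q p = i" "c q p' = j"
      using big_both[OF Q(1) _ q] Q(2) by auto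
    then show "card (part q) + card T_colors \<le> gr_val r (k - 2)"
      using both_bound[OF Q(1) q] by blast
  qed
  then have "(\<Sum>q\<in>Q. card (part q)) + 4 * card T_colors \<le> 4 * gr_val r (k - 2)"
    using Q(2) by (simp add: sum.distrib)
  ultimately show ?thesis
    using card_M[OF Q(1)] card_T card_G gr_val_step[OF k3, of r] gr_val_bounds(1)[OF r_ge r_le k3] by linarith
qed

end

context gallai_step
begin

text \<open>The two large parts are joined in colour \<open>i\<close>. The tight case is a 5-cycle in colour \<open>i\<close> through
  both large parts and three single vertices, two of which see \<open>a\<close> in colour \<open>j\<close>; there colour \<open>j\<close>
  is a matching inside each large part.\<close>

lemma two_big:
  assumes Q: "big_reps {a, b}" and ab: "a \<noteq> b" "c a b = i"
  shows "card G \<le> gr_val r k"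
proof -
  have in2: "a \<in> {a, b}" "b \<in> {a, b}" by simp_all
  note M = bigD(4)[OF Q in2(1)] bigD(4)[OF Q in2(2)]
  note large = bigD(5)[OF Q in2(1)] bigD(5)[OF Q in2(2)]
  have \<pi>: "\<pi> a \<noteq> \<pi> b" using bigD(6)[OF Q in2 ab(1)] .
  have ba: "c b a = i" using ab(2) sym by metis
  define A B where "A = part a" and "B = part b"
  define S where "S f g = {s \<in> small. c s a = f \<and> c s b = g}" for f g
  have AB: "A \<subseteq> M" "B \<subseteq> M" "A \<subseteq> V" "B \<subseteq> V" "A \<inter> B = {}" "3 \<le> card A" "3 \<le> card B" "finite A" "finite B"
    using part_sub part_subV part_disjoint[OF \<pi>] large finite_part by (auto simp: A_def B_def)
  have S_small: "S f g \<subseteq> small" for f g by (auto simp: S_def)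
  have SM: "S f g \<subseteq> M" "S f g \<subseteq> V" "finite (S f g)" for f g
    using S_small small_M M_V finite_small finite_subset by blast+
  have SA: "small \<inter> A = {}" "small \<inter> B = {}"
    using small_disjoint[OF subset_refl] large by (auto simp: A_def B_def)
  have jA: "joined c f Z A" if "Z \<subseteq> small" "\<And>z. z \<in> Z \<Longrightarrow> c z a = f" for Z f
    unfolding A_def using that M(1) large(1) by (intro joined_small)
  have jB: "joined c f Z B" if "Z \<subseteq> small" "\<And>z. z \<in> Z \<Longrightarrow> c z b = f" for Z f
    unfolding B_def using that M(2) large(2) by (intro joined_small)
  have jAB: "joined c i A B" "joined c i B A"
    using joined_parts[OF M \<pi>] joined_parts[OF M(2,1)] \<pi> ab ba by (auto simp: A_def B_def)
  have aA: "avoids c i A" and aB: "avoids c i B"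
    using big_avoid[OF Q in2 ab(1)] big_avoid[OF Q in2(2,1)] ab ba by (auto simp: A_def B_def)
  \<comment> \<open>The type \<open>S i i\<close> is empty: such a vertex would be the hub of a
    wheel over \<open>A\<close> and \<open>B\<close>.\<close>
  have types: "small = S i j \<union> S j i \<union> S j j"
    using small_point[OF _ M(1) large(1)] small_point[OF _ M(2) large(2)]
      small_no_triple[OF _ M \<pi> large] ab(2) by (auto simp: S_def)
  have "card small = card (S i j \<union> S j i) + card (S j j)"
    by (subst types, rule card_Un_disjoint) (use SM ij(3) in \<open>auto simp: S_def\<close>)
  also have "card (S i j \<union> S j i) = card (S i j) + card (S j i)"
    by (rule card_Un_disjoint) (use SM ij(3) in \<open>auto simp: S_def\<close>)
  finally have cM: "card M = card A + card B + (card (S i j) + card (S j i) + card (S j j))"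
    using card_M[OF Q] ab(1) by (simp add: A_def B_def)
  have iT: "i \<notin> T_colors" using big_T_color[OF Q in2 ab(1)] ab(2) by simp
  \<comment> \<open>\<open>\<tau>\<close> is charged to sets that avoid \<open>i\<close>,
    \<open>\<tau>'\<close> to sets that avoid both colours. As \<open>i\<close> is no outside
    colour, they differ by at most one.\<close>
  define \<tau> \<tau>' where "\<tau> = card T_colors" and "\<tau>' = card (T_colors - {i, j})"
  have \<tau>: "card (T_colors - {i}) = \<tau>" "\<tau> \<le> \<tau>' + 1" "j \<notin> T_colors \<Longrightarrow> \<tau>' = \<tau>" "card T \<le> 2 * \<tau>"
  proof -
    have eq: "T_colors - {i} = T_colors" "T_colors - {i, j} = T_colors - {j}" using iT by blast+
    show "card (T_colors - {i}) = \<tau>" by (simp add: eq \<tau>_def)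
    show "\<tau> \<le> \<tau>' + 1" using card_Diff_singleton_if[of T_colors j]
      by (cases "card T_colors") (auto simp: eq \<tau>_def \<tau>'_def)
    show "\<tau>' = \<tau>" if "j \<notin> T_colors" using that by (simp add: eq \<tau>_def \<tau>'_def)
    show "card T \<le> 2 * \<tau>" using card_T by (simp add: \<tau>_def)
  qed
  let ?F1 = "gr_val r (k - 1)" and ?F0 = "gr_val r (k - 2)"
  note bounds = gr_val_bounds[OF r_ge r_le k3] gr_val_step[OF k3, of r]
  have avoid1: "card X + \<tau> \<le> ?F1" if "X \<subseteq> M" "avoids c i X" for X
    using card_avoid1[OF that ij(1)] \<tau>(1) by simp
  have avoid2: "card X + \<tau>' \<le> ?F0" if "X \<subseteq> M" "avoids c i X" "avoids c j X" for X
    using card_avoid2[OF that] by (simp add: \<tau>'_def)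
  \<comment> \<open>Vertices of \<open>S j i\<close> see \<open>B\<close> in \<open>i\<close> just
    as \<open>A\<close> does, so they are counted together with \<open>A\<close>; likewise
    \<open>S i j\<close> with \<open>B\<close>. If \<open>S j j\<close> is empty,
    \<open>2 * ?F1 \<le> 5 * ?F0\<close> already settles the count.\<close>
  have "avoids c i (A \<union> S j i)"
  proof (rule join_avoids)
    have "joined c i (S j i) B" by (rule jB[OF S_small]) (simp add: S_def)
    then show "joined c i (A \<union> S j i) B" using jAB(1) unfolding joined_def by blast
    have "card A \<le> card (A \<union> S j i)" using AB SM(3) by (intro card_mono) simp_all
    then show "3 \<le> card (A \<union> S j i)" using AB(6) by linarith
  qed (use AB SM SA S_small in blast)+
  note aAS = this
  then have "card (A \<union> S j i) + \<tau> \<le> ?F1" using AB(1) SM(1) by (intro avoid1) blast+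
  moreover have "card (A \<union> S j i) = card A + card (S j i)"
    using AB SM SA S_small by (intro card_Un_disjoint) blast+
  ultimately have ASji: "card A + card (S j i) + \<tau> \<le> ?F1" by simp
  have "avoids c i (B \<union> S i j)"
  proof (rule join_avoids)
    have "joined c i (S i j) A" by (rule jA[OF S_small]) (simp add: S_def)
    then show "joined c i (B \<union> S i j) A" using jAB(2) unfolding joined_def by blast
    have "card B \<le> card (B \<union> S i j)" using AB SM(3) by (intro card_mono) simp_all
    then show "3 \<le> card (B \<union> S i j)" using AB(7) by linarith
  qed (use AB SM SA S_small in blast)+
  note aBS = this
  then have "card (B \<union> S i j) + \<tau> \<le> ?F1" using AB(2) SM(1) by (intro avoid1) blast+
  moreover have "card (B \<union> S i j) = card B + card (S i j)"
    using AB SM SA S_small by (intro card_Un_disjoint) blast+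
  ultimately have BSij: "card B + card (S i j) + \<tau> \<le> ?F1" by simp
  have Sij: "card (S i j) \<le> 2"
    by (rule small_both[OF S_small _ _ AB(3,4,6,7) jA[OF S_small] jB[OF S_small]])
      (use SA S_small in \<open>auto simp: S_def\<close>)
  have Sji: "card (S j i) \<le> 2"
    by (rule small_both[OF S_small _ _ AB(4,3,7,6) jB[OF S_small] jA[OF S_small]])
      (use SA S_small in \<open>auto simp: S_def\<close>)
  define Tj where "Tj = {t \<in> T. c t m0 = j}"
  have Tj: "Tj \<subseteq> V" "Tj \<inter> M = {}" "finite Tj" "joined c j Tj M"
  proof -
    have sub: "Tj \<subseteq> T" by (auto simp: Tj_def)
    then show "Tj \<subseteq> V" "finite Tj" using T_V finite_T finite_subset by blast+
    show "Tj \<inter> M = {}" using sub by (auto simp: T_def)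
    show "joined c j Tj M"
      unfolding joined_def
    proof (intro ballI)
      fix t x assume "t \<in> Tj" "x \<in> M"
      then show "c t x = j" using T_color[of t x] by (simp add: Tj_def)
    qed
  qed
  have avoid_j: "avoids c j X" if "X \<subseteq> M" "3 \<le> card X" "Z \<subseteq> small" "Z \<inter> X = {}" "joined c j Z X" "3 \<le> card Z + card Tj" for X Z
  proof (rule join_avoids)
    have ZM: "Z \<subseteq> M" "finite Z" using that(3) small_M finite_small finite_subset by blast+
    show "X \<subseteq> V" "Z \<union> Tj \<subseteq> V" using that(1) ZM M_V Tj by blast+
    show "X \<inter> (Z \<union> Tj) = {}" using that(1,4) Tj by blast
    have "card (Z \<union> Tj) = card Z + card Tj" using ZM Tj by (intro card_Un_disjoint) blast+
    then show "3 \<le> card (Z \<union> Tj)" using that by simp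
    have "joined c j (Z \<union> Tj) X" using that(1,5) Tj(4) unfolding joined_def by blast
    then show "joined c j X (Z \<union> Tj)" by (rule joined_sym)
  qed (rule that(2))
  have dis: "(S j i \<union> S j j) \<inter> A = {}" "(S i j \<union> S j j) \<inter> B = {}" "S j j \<inter> A = {}" "S j j \<inter> B = {}"
    "S j i \<union> S j j \<subseteq> small" "S i j \<union> S j j \<subseteq> small"
    using SA S_small by blast+
  have jX: "joined c j (S j i \<union> S j j) A" "joined c j (S i j \<union> S j j) B"
    by (rule jA[OF dis(5)]; auto simp: S_def) (rule jB[OF dis(6)]; auto simp: S_def)
  have cX: "card (S j i \<union> S j j) = card (S j i) + card (S j j)" "card (S i j \<union> S j j) = card (S i j) + card (S j j)"
    by (rule card_Un_disjoint; use SM ij(3) in \<open>auto simp: S_def\<close>)+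
  show ?thesis
  \<comment> \<open>With three vertices in \<open>S j j\<close> both large parts avoid both colours,
    and \<open>S j j\<close> itself has at most four vertices.\<close>
  proof (cases "3 \<le> card (S j j)")
    case True
    have j: "joined c j (S j j) A" "joined c j (S j j) B" using jX unfolding joined_def by blast+
    have "avoids c j A" "avoids c j B"
      using avoid_j[OF AB(1,6) S_small dis(3) j(1)] avoid_j[OF AB(2,7) S_small dis(4) j(2)] True by auto
    then have AB0: "card A + \<tau>' \<le> ?F0" "card B + \<tau>' \<le> ?F0" using avoid2 AB aA aB by blast+
    interpret sw: gallai_step c V r k C G M m0 \<pi> j i by (rule swap)
    have "avoids c j (S j j)"
      using True AB SM dis j by (intro join_avoids[OF SM(2) AB(3)]) auto
    then have "card (S j j) \<le> 4" by (intro sw.small_avoid S_small)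
    then show ?thesis using AB0 cM card_G Sij Sji \<tau>(2,4) bounds(1,7) by linarith
  next
    case Sjj: False
    show ?thesis
    \<comment> \<open>If this holds, one large part avoids both colours. Two vertices of
      \<open>S j j\<close>, two of the small type not counted with the other part, and one for the
      gap between \<open>\<tau>\<close> and \<open>\<tau>'\<close> make up the 5 in
      \<open>?F1 + 5 \<le> 4 * ?F0\<close>.\<close>
    proof (cases "3 \<le> card (S j i) + card (S j j) + card Tj \<or> 3 \<le> card (S i j) + card (S j j) + card Tj")
      case True
      then show ?thesis
      proof
        assume 3: "3 \<le> card (S j i) + card (S j j) + card Tj"
        then have "avoids c j A" using avoid_j[OF AB(1,6) dis(5,1) jX(1)] cX by simp
        then have "card A + \<tau>' \<le> ?F0" using avoid2 AB aA by blast
        then show ?thesis using BSij cM card_G Sij Sji Sjj \<tau>(2,4) bounds(3,7) by linarith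
      next
        assume 3: "3 \<le> card (S i j) + card (S j j) + card Tj"
        then have "avoids c j B" using avoid_j[OF AB(2,7) dis(6,2) jX(2)] cX by simp
        then have "card B + \<tau>' \<le> ?F0" using avoid2 AB aB by blast
        then show ?thesis using ASji cM card_G Sij Sji Sjj \<tau>(2,4) bounds(3,7) by linarith
      qed
    next
      case few: False
      show ?thesis
      proof (cases "S j j = {}")
        case True
        then show ?thesis using ASji BSij cM card_G \<tau>(4) bounds(4,7) by simp
      next
        case False
        then obtain v where v: "v \<in> S j j" by blast
        have Sjj1: "1 \<le> card (S j j)" using False SM(3) by (simp add: Suc_le_eq card_gt_0_iff)
        have vA: "v \<in> M" "v \<notin> A" "v \<notin> B" using v SM dis by blast+
        have cv: "c v x = j" "c x v = j" if "x \<in> A \<union> B" for x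
          using jX v that sym[of x v] by (auto simp: joined_def)
        \<comment> \<open>A vertex of \<open>S j j\<close> sees both large parts in
          \<open>j\<close>, so it can join either of them without creating an
          \<open>i\<close>-edge.\<close>
        have addv: "card X + 1 + \<tau> \<le> ?F1" if "X \<subseteq> M" "avoids c i X" "v \<notin> X" "\<And>x. x \<in> X \<Longrightarrow> c v x \<noteq> i" for X
        proof -
          have "avoids c i (insert v X)" using that sym unfolding avoids_def by (metis insertE)
          then have "card (insert v X) + \<tau> \<le> ?F1" using that(1) vA(1) by (intro avoid1) auto
          moreover have "finite X" using that(1) finite_M finite_subset by blast
          ultimately show ?thesis using that(3) by simp
        qed
        have Av: "card A + 1 + \<tau> \<le> ?F1" and Bv: "card B + 1 + \<tau> \<le> ?F1"
          using addv[OF AB(1) aA vA(2)] addv[OF AB(2) aB vA(3)] cv ij(3) by auto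
        consider "card (S j j) = 2" | "S j i = {}" "card (S j j) = 1" | "S i j = {}" "card (S j j) = 1"
          | "card (S j j) = 1" "S j i \<noteq> {}" "S i j \<noteq> {}"
          using Sjj1 Sjj by fastforce
        then show ?thesis
        proof cases
          case 1
          then have "card (S j i) = 0" "card (S i j) = 0" using few by auto
          then show ?thesis using 1 Av Bv cM card_G \<tau>(4) bounds(4,7) by linarith
        next
          case 2
          then show ?thesis using Av BSij cM card_G \<tau>(4) bounds(4,7) by simp
        next
          case 3
          then show ?thesis using Bv ASji cM card_G \<tau>(4) bounds(4,7) by simp
        next
          case 4
          then have pos: "1 \<le> card (S j i)" "1 \<le> card (S i j)"
            using SM(3) by (simp_all add: Suc_le_eq card_gt_0_iff)
          then have one: "card (S j i) = 1" "card (S i j) = 1" "card Tj = 0" using few 4(1) by auto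
          then obtain x y where xy: "S j i = {x}" "S i j = {y}" by (meson card_1_singletonE)
          have xM: "x \<in> M" "x \<notin> A" "x \<noteq> v" "y \<in> M" "y \<notin> B" "y \<noteq> v"
          proof -
            have *: "x \<in> S j i" "y \<in> S i j" using xy by auto
            then show "x \<in> M" "x \<notin> A" "y \<in> M" "y \<notin> B" using SM dis by blast+
            show "x \<noteq> v" "y \<noteq> v" using * v ij(3) by (auto simp: S_def)
          qed
          have cx: "c x z = j" if "z \<in> A" for z using jX(1) xy that by (auto simp: joined_def)
          have cy: "c y z = j" if "z \<in> B" for z using jX(2) xy that by (auto simp: joined_def)
          show ?thesis
          \<comment> \<open>If \<open>v x\<close> does not have colour \<open>i\<close>, then
            \<open>A\<close> absorbs both \<open>x\<close> and \<open>v\<close>; similarly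
            \<open>B\<close> with \<open>y\<close>. Otherwise \<open>A\<close>, \<open>B\<close>,
            \<open>x\<close>, \<open>v\<close>, \<open>y\<close> form the 5-cycle in colour
            \<open>i\<close>.\<close>
          proof (cases "c v x = i \<and> c v y = i")
            case False
            then consider "c v x \<noteq> i" | "c v y \<noteq> i" by blast
            then show ?thesis
            proof cases
              case 1
              have "card (insert x A) + 1 + \<tau> \<le> ?F1"
                using aAS xy(1) xM(1,3) vA(2) AB(1) cv 1 ij(3) by (intro addv) auto
              then show ?thesis using BSij 4(1) one xM(2) AB(8) cM card_G \<tau>(4) bounds(4,7) by simp
            next
              case 2
              have "card (insert y B) + 1 + \<tau> \<le> ?F1"
                using aBS xy(2) xM(4,6) vA(3) AB(2) cv 2 ij(3) by (intro addv) auto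
              then show ?thesis using ASji 4(1) one xM(5) AB(9) cM card_G \<tau>(4) bounds(4,7) by simp
            qed
          next
            case True
            have "Tj = {}" using one(3) Tj(3) by simp
            then have "j \<notin> T_colors" by (auto simp: Tj_def T_colors_def)
            then have \<tau>': "\<tau>' = \<tau>" by (rule \<tau>(3))
            \<comment> \<open>Two \<open>j\<close>-neighbours \<open>q\<close>, \<open>s\<close> of
              \<open>p\<close> in \<open>X\<close> would give a \<open>j\<close>-wheel with hub
              \<open>p\<close> and rim \<open>v\<close>, \<open>q\<close>, \<open>w\<close>,
              \<open>s\<close>. So \<open>j\<close> is a matching on \<open>X\<close>, and half of
              \<open>X\<close> avoids both colours.\<close>
            have half: "card X \<le> 2 * (?F0 - \<tau>)"
              if X: "X \<subseteq> M" "avoids c i X" "v \<notin> X" "w \<notin> X" "w \<noteq> v" "w \<in> M"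
                "\<And>z. z \<in> X \<Longrightarrow> c v z = j" "\<And>z. z \<in> X \<Longrightarrow> c w z = j" for X w
            proof -
              have fX: "finite X" using X(1) finite_M finite_subset by blast
              have "q = s" if "p \<in> X" "q \<in> X" "s \<in> X" "p \<noteq> q" "p \<noteq> s" "c p q = j" "c p s = j" for p q s
              proof (rule ccontr)
                assume "q \<noteq> s"
                have "has_wheel c j V"
                proof (rule has_wheelI[of p v w q s])
                  show "{p, v, w, q, s} \<subseteq> V" using that X vA(1) M_V by blast
                  show "distinct [p, v, w, q, s]" using that X \<open>q \<noteq> s\<close> by auto
                  show "c p v = j" "c p w = j" using X(7,8)[OF that(1)] sym by metis+
                qed (use that X(7,8) in simp_all)
                then show False using no_wheel by blast
              qed
              then obtain X' where X': "X' \<subseteq> X" "avoids c j X'" "card X \<le> 2 * card X'"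
                using matching_half[OF fX, of j] by blast
              then have "card X' + \<tau> \<le> ?F0"
                using avoid2[of X'] avoids_subset[OF X(2)] X(1) \<tau>' by auto
              then show ?thesis using X'(3) by linarith
            qed
            have "card A \<le> 2 * (?F0 - \<tau>)"
              by (rule half[OF AB(1) aA vA(2) xM(2,3,1)]) (use cv cx in auto)
            moreover have "card B \<le> 2 * (?F0 - \<tau>)"
              by (rule half[OF AB(2) aB vA(3) xM(5,6,4)]) (use cv cy in auto)
            \<comment> \<open>Guards the truncated subtraction in
              \<open>?F0 - \<tau>\<close>.\<close>
            moreover have "\<tau> \<le> ?F0" using avoid2[of "{}"] \<tau>' by (simp add: avoids_def)
            ultimately show ?thesis using 4(1) one(1,2) cM card_G \<tau>(4) bounds(1,7) by linarith
          qed
        qed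
      qed
    qed
  qed
qed

end

section \<open>Partitions without large parts, and the union of all cases\<close>

lemma inj_reps:
  fixes f :: "'a \<Rightarrow> 'b"
  obtains Q where "Q \<subseteq> A" "inj_on f Q" "f ` Q = f ` A"
  using subset_image_inj[of "f ` A" f A] by (metis order_refl)

context gallai_step
begin

text \<open>All parts have one or two vertices. At most five have two, by R(3,3) <= 6 and the wheel,
  and the representatives are two-coloured, so \<open>M\<close> has at most 15 vertices. For
  \<open>k \<ge> 4\<close> it would have more than 20, hence \<open>k = 3\<close>.\<close>

lemma no_big:
  assumes Q: "big_reps {}"
  shows "card G \<le> gr_val r k"
proof -
  have small: "small = M" using Q small_M by (auto simp: big_reps_def)
  obtain R where R: "R \<subseteq> M" "inj_on \<pi> R" "\<pi> ` R = \<pi> ` M" by (rule inj_reps)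
  have fR: "finite R" using R(1) finite_M finite_subset by blast
  have ne: "\<pi> x \<noteq> \<pi> y" if "x \<in> R" "y \<in> R" "x \<noteq> y" for x y using R(2) that by (auto dest: inj_onD)
  have col: "c x y \<in> {i, j}" if "x \<in> R" "y \<in> R" "x \<noteq> y" for x y
    using cross[of x y] ne[OF that] that R(1) by blast
  then have colR: "colored_by c {i, j} R" unfolding colored_by_def by blast
  let ?D = "{q \<in> R. card (part q) = 2}"
  have "card ?D \<le> 5"
  proof (rule ccontr)
    assume "\<not> ?thesis"
    moreover have "finite ?D" using fR by simp
    moreover have "colored_by c {i, j} ?D" by (rule colored_by_subset[OF colR]) auto
    ultimately obtain x y z where xyz: "x \<in> ?D" "y \<in> ?D" "z \<in> ?D" "x \<noteq> y" "y \<noteq> z" "x \<noteq> z" "c x y = c y z" "c x z = c y z"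
      using mono_triangle_of_six[of ?D i j] by auto
    then show False using no_triple[of x y z] ne R(1) by auto
  qed
  moreover have "card M \<le> card R + card ?D"
  proof -
    have "M = (\<Union>q\<in>R. part q)"
    proof
      show "M \<subseteq> (\<Union>q\<in>R. part q)"
      proof
        fix x assume x: "x \<in> M"
        then have "\<pi> x \<in> \<pi> ` R" using R(3) by simp
        then show "x \<in> (\<Union>q\<in>R. part q)" using x by (auto simp: part_def)
      qed
    qed (use part_sub in blast)
    then have "card M \<le> (\<Sum>q\<in>R. card (part q))" using card_UN_le[OF fR, of part] by simp
    also have "\<dots> \<le> (\<Sum>q\<in>R. 1 + (if card (part q) = 2 then 1 else 0))"
    proof (rule sum_mono)
      fix q assume "q \<in> R"
      then have "card (part q) \<le> 2" using small R(1) by (auto simp: small_def)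
      then show "card (part q) \<le> 1 + (if card (part q) = 2 then 1 else 0)" by auto
    qed
    also have "\<dots> = card R + card ?D" using fR by (simp only: sum.distrib) (simp add: sum.If_cases Int_def)
    finally show ?thesis .
  qed
  ultimately have M5: "card M \<le> card R + 5" by simp
  have "R \<subseteq> V" using R(1) M_V by blast
  then have Rr: "card R \<le> r" using two_colored colR by blast
  have k: "k = 3" using gr_val_bounds(6)[OF r_ge r_le k3] M5 Rr M_large r_le k3 by linarith
  then have F: "gr_val r k = 20" by (simp add: numeral_eq_Suc)
  show ?thesis
  \<comment> \<open>The count is tight: an outside vertex of colour \<open>i\<close> or
    \<open>j\<close> extends the two-coloured set \<open>R\<close>, so \<open>card R\<close> is at
    most 9, and 9 + 5 + 6 = 20. Otherwise outside vertices only use the third colour.\<close>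
  proof (cases "\<exists>t\<in>T. c t m0 \<in> {i, j}")
    case True
    then obtain t where t: "t \<in> T" "c t m0 \<in> {i, j}" by blast
    then have tM: "t \<notin> M" "t \<in> V" using T_V by (auto simp: T_def)
    have "c t x \<in> {i, j}" "c x t \<in> {i, j}" if "x \<in> R" for x
      using T_color[OF t(1), of x] t(2) that R(1) sym[of x t] by auto
    then have "colored_by c {i, j} (insert t R)" using col unfolding colored_by_def by blast
    then have "card (insert t R) \<le> r" using tM \<open>R \<subseteq> V\<close> by (intro two_colored) auto
    then have "card R + 1 \<le> r" using tM R(1) fR by (simp add: card_insert_if split: if_splits) blast
    moreover have "card T_colors \<le> 3" using T_colors_sub finite_C card_C k card_mono by metis
    ultimately show ?thesis using F M5 card_T card_G r_le by linarith
  next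
    case False
    then have "T_colors \<subseteq> C - {i, j}" using T_colors_sub by (auto simp: T_colors_def)
    then have "card T_colors \<le> card (C - {i, j})" using finite_C by (intro card_mono) auto
    also have "\<dots> = 1" using ij finite_C card_C k by simp
    finally show ?thesis using F M5 Rr card_T card_G r_le by linarith
  qed
qed

lemma card_G_le: "card G \<le> gr_val r k"
proof -
  interpret sw: gallai_step c V r k C G M m0 \<pi> j i by (rule swap)
  obtain Q where Q: "Q \<subseteq> {x \<in> M. 3 \<le> card (part x)}" "inj_on \<pi> Q" "\<pi> ` Q = \<pi> ` {x \<in> M. 3 \<le> card (part x)}"
    by (rule inj_reps)
  have big: "big_reps Q"
    unfolding big_reps_def
  proof (intro conjI ballI)
    fix x assume "x \<in> M"
    then show "\<pi> x \<in> \<pi> ` Q \<or> x \<in> small" unfolding Q(3) small_def by auto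
  qed (use Q in auto)
  have fQ: "finite Q" using bigD(2)[OF big] .
  consider "card Q = 0" | "card Q = 1" | "card Q = 2" | "card Q = 3" | "card Q = 4" | "5 \<le> card Q" by linarith
  then show ?thesis
  proof cases
    case 1
    then show ?thesis using no_big big fQ by simp
  next
    case 2
    then show ?thesis using one_big big by (metis card_1_singletonE)
  next
    case 3
    then obtain a b where ab: "Q = {a, b}" "a \<noteq> b" by (auto simp: card_2_iff)
    then have "c a b = i \<or> c a b = j" using big_cross[OF big, of a b] by simp
    then show ?thesis using two_big sw.two_big big ab by blast
  next
    case 4
    then obtain a b d where abd: "Q = {a, b, d}" "distinct [a, b, d]" by (auto simp: card_3_iff)
    have three: ?thesis if "{x, y, z} = Q" "distinct [x, y, z]" "c x y = c x z" for x y z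
    proof -
      have "c x y = i \<or> c x y = j" using big_cross[OF big, of x y] that by auto
      then show ?thesis using three_big[of x y z] sw.three_big[of x y z] big that by metis
    qed
    have "c a b \<in> {i, j}" "c a d \<in> {i, j}" "c b d \<in> {i, j}"
      using big_cross[OF big] abd by auto
    then have "c a b = c a d \<or> c a b = c b d \<or> c a d = c b d" by auto
    then consider "c a b = c a d" | "c b a = c b d" | "c d a = c d b" using sym by metis
    then show ?thesis
    proof cases
      case 1 then show ?thesis using three[of a b d] abd by auto
    next
      case 2 then show ?thesis using three[of b a d] abd by auto
    next
      case 3 then show ?thesis using three[of d a b] abd by auto
    qed
  next
    case 5
    then show ?thesis using four_big big by blast
  next
    case 6
    then show ?thesis using five_big big by blast
  qed
qed

end

section \<open>Induction on the number of colours\<close>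

theorem (in ramsey_bound) card_le_gr_val:
  assumes "X \<subseteq> V" "finite D" "colored_by c D X"
  shows "card X \<le> gr_val r (card D)"
  using assms
proof (induction "card D" arbitrary: X D rule: less_induct)
  case less
  have fX: "finite X" using less.prems(1) by (rule finite_sub)
  consider "card D = 0" | "card D = 1" | "card D = 2" | "3 \<le> card D" by linarith
  then show ?case
  proof cases
    case 1
    then have "D = {}" using less.prems(2) by simp
    then have "\<forall>x\<in>X. \<forall>y\<in>X. x = y" using less.prems(3) by (auto simp: colored_by_def)
    then show ?thesis using 1 fX by (simp add: card_le_Suc0_iff_eq)
  next
    case 2
    then obtain e where "D = {e}" by (rule card_1_singletonE)
    then have "card X \<le> 4"
      using less.prems(1,3) by (intro near_clique_bound[of X e]) (auto simp: colored_by_def)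
    then show ?thesis using 2 by simp
  next
    case 3
    then obtain e f where "D = {e, f}" by (auto simp: card_2_iff)
    then show ?thesis using 3 less.prems two_colored by (simp add: numeral_2_eq_2)
  next
    case 4
    let ?F1 = "gr_val r (card D - 1)"
    show ?thesis
    proof (rule ccontr)
      assume n: "\<not> ?thesis"
      note bounds = gr_val_bounds[OF r_ge r_le 4] gr_val_step[OF 4, of r]
      \<comment> \<open>A counterexample \<open>X\<close> is itself such a set, so a smallest one
        exists.\<close>
      define is_mod where "is_mod M \<longleftrightarrow> M \<subseteq> X \<and> ?F1 < card M \<and> (\<forall>t\<in>X - M. \<forall>x\<in>M. \<forall>y\<in>M. c t x = c t y)" for M
      have "is_mod X" unfolding is_mod_def using n bounds(5,7) by auto
      then obtain M where M: "is_mod M" "\<And>N. is_mod N \<Longrightarrow> card M \<le> card N"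
        using ex_has_least_nat[of is_mod X card] by blast
      have MX: "M \<subseteq> X" "?F1 < card M" "\<And>t x y. t \<in> X \<Longrightarrow> t \<notin> M \<Longrightarrow> x \<in> M \<Longrightarrow> y \<in> M \<Longrightarrow> c t x = c t y"
        using M(1) unfolding is_mod_def by blast+
      have fM: "finite M" using MX(1) fX finite_subset by blast
      have M2: "2 \<le> card M" using MX(2) gr_val_bounds(1)[OF r_ge r_le, of "card D + 1"] 4 by simp
      have rf: "rainbow_free c M" using MX(1) less.prems(1) rainbow_free_subset[OF rainbow_free] by blast
      have cM: "colored_by c D M" using colored_by_subset[OF less.prems(3) MX(1)] by blast
      have D2: "2 \<le> card D" using 4 by simp
      show False
      proof (rule gallai_partition[OF fM M2 rf cM D2])
      fix \<pi> :: "'a \<Rightarrow> 'a" and i j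
      assume p: "i \<in> D" "j \<in> D" "i \<noteq> j" "\<exists>x\<in>M. \<exists>y\<in>M. \<pi> x \<noteq> \<pi> y"
        "\<And>x y. x \<in> M \<Longrightarrow> y \<in> M \<Longrightarrow> \<pi> x \<noteq> \<pi> y \<Longrightarrow> c x y \<in> {i, j}"
        "\<And>x x' y. x \<in> M \<Longrightarrow> x' \<in> M \<Longrightarrow> y \<in> M \<Longrightarrow> \<pi> x = \<pi> x' \<Longrightarrow> \<pi> x \<noteq> \<pi> y \<Longrightarrow> c x y = c x' y"
      \<comment> \<open>A part is homogeneous in all of \<open>X\<close>: towards the rest of
        \<open>M\<close> by the partition, towards the outside because \<open>M\<close> is. Being
        smaller than \<open>M\<close>, it stays within the bound.\<close>
      have part_le: "card {y \<in> M. \<pi> y = \<pi> x} \<le> ?F1" if x: "x \<in> M" for x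
      proof (rule ccontr)
        let ?P = "{y \<in> M. \<pi> y = \<pi> x}"
        assume n: "\<not> ?thesis"
        have "c t u = c t v" if "t \<in> X - ?P" "u \<in> ?P" "v \<in> ?P" for t u v
        proof (cases "t \<in> M")
          case True
          then have "c u t = c v t" using that by (intro p(6)) auto
          then show ?thesis using sym[of u t] sym[of v t] by simp
        next
          case False
          then show ?thesis using MX(3)[of t u v] that by blast
        qed
        then have "is_mod ?P" unfolding is_mod_def
        proof (intro conjI ballI)
          show "?P \<subseteq> X" using MX(1) by blast
          show "?F1 < card ?P" using n by simp
        qed
        moreover obtain y where "y \<in> M" "\<pi> y \<noteq> \<pi> x" using p(4) by metis
        then have "?P \<subset> M" by blast
        then have "card ?P < card M" using fM psubset_card_mono by blast
        ultimately show False using M(2)[of ?P] by linarith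
      qed
      obtain m0 where m0: "m0 \<in> M" using M2 by fastforce
      interpret gallai_step c V r "card D" D X M m0 \<pi> i j
      proof unfold_locales
        show "card Y \<le> gr_val r (card E)" if "Y \<subseteq> V" "finite E" "card E < card D" "colored_by c E Y" for Y E
          using less.hyps[OF that(3,1,2,4)] .
      qed (fact 4 less.prems refl MX(1,2) m0 p(1-3) part_le | (rule MX(3) p(5,6) part_le; assumption))+
      show False using card_G_le n by blast
      qed
    qed
  qed
qed

section \<open>Copies of the graphs of the family\<close>

text \<open>An embedding into a curried colouring replaces the subgraph with its isomorphism;
  \<open>has_mono_copy_iff\<close> relates the two forms.\<close>

definition mono_copy_in :: "nat ugraph \<Rightarrow> ('a \<Rightarrow> 'a \<Rightarrow> nat) \<Rightarrow> 'a set \<Rightarrow> bool" where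
  "mono_copy_in H c V \<longleftrightarrow> (\<exists>g e. inj_on g (uverts H) \<and> g ` uverts H \<subseteq> V \<and>
     (\<forall>x y. {x, y} \<in> uedges H \<longrightarrow> c (g x) (g y) = e))"

lemma mono_copy_in_mono: "mono_copy_in H c W \<Longrightarrow> W \<subseteq> V \<Longrightarrow> mono_copy_in H c V"
  unfolding mono_copy_in_def by (meson subset_trans)

lemma mono_copy_in_transfer:
  assumes "mono_copy_in H c V" "inj_on \<phi> (uverts H')" "\<phi> ` uverts H' \<subseteq> uverts H"
    "\<forall>E\<in>uedges H'. \<phi> ` E \<in> uedges H"
  shows "mono_copy_in H' c V"
proof -
  obtain g e where g: "inj_on g (uverts H)" "g ` uverts H \<subseteq> V" "\<And>x y. {x, y} \<in> uedges H \<Longrightarrow> c (g x) (g y) = e"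
    using assms(1) unfolding mono_copy_in_def by blast
  have "inj_on (g \<circ> \<phi>) (uverts H')" using assms(2,3) g(1) by (meson comp_inj_on inj_on_subset)
  moreover have "(g \<circ> \<phi>) ` uverts H' \<subseteq> V" using assms(3) g(2) by auto
  moreover have "c ((g \<circ> \<phi>) x) ((g \<circ> \<phi>) y) = e" if "{x, y} \<in> uedges H'" for x y
    using g(3)[of "\<phi> x" "\<phi> y"] assms(4) that by fastforce
  ultimately show ?thesis unfolding mono_copy_in_def by blast
qed

lemma verts_family:
  "uverts H1 = {1..5}" "uverts H2 = {1..5}" "uverts H3 = {1..5}" "uverts H4 = {1..5}"
  "uverts H5 = {1..5}" "uverts H6 = {1..5}" "uverts H10 = {1..5}" "uverts H11 = {1..5}"
  by (simp_all add: H1_def H2_def H3_def H4_def H5_def H6_def H10_def H11_def)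

lemma edges_family:
  "uedges H1 = {{1,2}, {1,5}, {2,5}, {2,3}, {3,4}}"
  "uedges H2 = {{1,2}, {1,5}, {2,5}, {2,3}, {2,4}}"
  "uedges H3 = {{1,2}, {1,5}, {2,5}, {2,3}, {4,5}}"
  "uedges H4 = {{1,2}, {2,3}, {3,4}, {4,5}, {1,5}, {2,5}}"
  "uedges H5 = {{2,3}, {2,5}, {3,5}, {3,4}, {4,5}, {1,2}}"
  "uedges H6 = {{2,3}, {2,5}, {3,5}, {3,4}, {4,5}, {1,5}}"
  "uedges H10 = {{1,2}, {1,5}, {2,5}, {3,4}}"
  "uedges H11 = {{1,2}, {2,3}, {2,4}, {1,5}, {3,5}, {4,5}, {3,4}}"
  by (simp_all add: H1_def H2_def H3_def H4_def H5_def H6_def H10_def H11_def)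

lemma atLeastAtMost_1_5: "{1..5::nat} = {1, 2, 3, 4, 5}"
  by auto

text \<open>A map on the vertices 1 to 5 written as the list of its values, the last one being also
  the default.\<close>

definition pick5 :: "'a \<Rightarrow> 'a \<Rightarrow> 'a \<Rightarrow> 'a \<Rightarrow> 'a \<Rightarrow> nat \<Rightarrow> 'a" where
  "pick5 a b d e f n = (if n = 1 then a else if n = 2 then b else if n = 3 then d else if n = 4 then e else f)"

lemma pick5_simps [simp]:
  "pick5 a b d e f (Suc 0) = a" "pick5 a b d e f 2 = b" "pick5 a b d e f 3 = d"
  "pick5 a b d e f 4 = e" "pick5 a b d e f 5 = f"
  by (simp_all add: pick5_def)

lemma pick5_copy:
  assumes "uverts H = {1..5}" "distinct [a, b, d, e, f]" "{a, b, d, e, f} \<subseteq> V"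
    "\<And>x y. {x, y} \<in> uedges H \<Longrightarrow> c (pick5 a b d e f x) (pick5 a b d e f y) = i"
  shows "mono_copy_in H c V"
  unfolding mono_copy_in_def assms(1) atLeastAtMost_1_5
  using assms(2-) by (intro exI[of _ "pick5 a b d e f"] exI[of _ i]) (auto simp: inj_on_def)

text \<open>This reduces the family without \<open>H10\<close> to \<open>H5\<close>,
  \<open>H6\<close> and \<open>H11\<close>. The arguments of \<open>pick5\<close> are the images of
  1 to 5 under the inclusion.\<close>

lemma subgraph_copies:
  shows "mono_copy_in H5 c V \<Longrightarrow> mono_copy_in H1 c V" "mono_copy_in H6 c V \<Longrightarrow> mono_copy_in H2 c V"
    "mono_copy_in H5 c V \<Longrightarrow> mono_copy_in H3 c V" "mono_copy_in H11 c V \<Longrightarrow> mono_copy_in H4 c V"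
proof -
  show "mono_copy_in H1 c V" if "mono_copy_in H5 c V"
    by (rule mono_copy_in_transfer[OF that, of "pick5 4 3 2 1 5"], unfold verts_family atLeastAtMost_1_5)
      (simp_all add: edges_family doubleton_eq_iff)
  show "mono_copy_in H2 c V" if "mono_copy_in H6 c V"
    by (rule mono_copy_in_transfer[OF that, of "pick5 3 5 4 1 2"], unfold verts_family atLeastAtMost_1_5)
      (simp_all add: edges_family doubleton_eq_iff)
  show "mono_copy_in H3 c V" if "mono_copy_in H5 c V"
    by (rule mono_copy_in_transfer[OF that, of "pick5 5 2 1 4 3"], unfold verts_family atLeastAtMost_1_5)
      (simp_all add: edges_family doubleton_eq_iff)
  show "mono_copy_in H4 c V" if "mono_copy_in H11 c V"
    by (rule mono_copy_in_transfer[OF that, of "pick5 3 4 5 1 2"], unfold verts_family atLeastAtMost_1_5)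
      (simp_all add: edges_family doubleton_eq_iff)
qed

context sym_coloring
begin

lemma H5_copyI:
  assumes "distinct [a1, a2, a3, a4, a5]" "{a1, a2, a3, a4, a5} \<subseteq> V"
    "c a2 a3 = i" "c a2 a5 = i" "c a3 a5 = i" "c a3 a4 = i" "c a4 a5 = i" "c a1 a2 = i"
  shows "mono_copy_in H5 c V"
  by (rule pick5_copy[OF verts_family(5) assms(1,2), of c i])
    (use assms(3-) sym in \<open>auto simp: edges_family doubleton_eq_iff\<close>)

lemma H6_copyI:
  assumes "distinct [a1, a2, a3, a4, a5]" "{a1, a2, a3, a4, a5} \<subseteq> V"
    "c a2 a3 = i" "c a2 a5 = i" "c a3 a5 = i" "c a3 a4 = i" "c a4 a5 = i" "c a1 a5 = i"
  shows "mono_copy_in H6 c V"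
  by (rule pick5_copy[OF verts_family(6) assms(1,2), of c i])
    (use assms(3-) sym in \<open>auto simp: edges_family doubleton_eq_iff\<close>)

lemma H10_copyI:
  assumes "distinct [a1, a2, a3, a4, a5]" "{a1, a2, a3, a4, a5} \<subseteq> V"
    "c a1 a2 = i" "c a1 a5 = i" "c a2 a5 = i" "c a3 a4 = i"
  shows "mono_copy_in H10 c V"
  by (rule pick5_copy[OF verts_family(7) assms(1,2), of c i])
    (use assms(3-) sym in \<open>auto simp: edges_family doubleton_eq_iff\<close>)

lemma H11_copyI:
  assumes "distinct [a1, a2, a3, a4, a5]" "{a1, a2, a3, a4, a5} \<subseteq> V"
    "c a1 a2 = i" "c a2 a3 = i" "c a2 a4 = i" "c a1 a5 = i" "c a3 a5 = i" "c a4 a5 = i" "c a3 a4 = i"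
  shows "mono_copy_in H11 c V"
  by (rule pick5_copy[OF verts_family(8) assms(1,2), of c i])
    (use assms(3-) sym in \<open>auto simp: edges_family doubleton_eq_iff\<close>)

lemma wheel_copies:
  assumes "has_wheel c i V"
  shows "mono_copy_in H5 c V" "mono_copy_in H6 c V" "mono_copy_in H11 c V"
proof -
  obtain h a a' b b' where w: "{h, a, a', b, b'} \<subseteq> V" "distinct [h, a, a', b, b']"
    "c h a = i" "c h a' = i" "c h b = i" "c h b' = i" "c a b = i" "c a b' = i" "c a' b = i" "c a' b' = i"
    using assms unfolding has_wheel_def by blast
  then have w': "c a h = i" "c a' h = i" "c b h = i" "c b' h = i" "c b a = i" "c b' a = i" "c b a' = i" "c b' a' = i"
    using sym by metis+
  note [simp] = w(3-) w'
  have d: "h \<noteq> a" "h \<noteq> a'" "h \<noteq> b" "h \<noteq> b'" "a \<noteq> a'" "a \<noteq> b" "a \<noteq> b'" "a' \<noteq> b" "a' \<noteq> b'" "b \<noteq> b'"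
    using w(2) by auto
  note [simp] = d d[symmetric]
  have [simp]: "h \<in> V" "a \<in> V" "a' \<in> V" "b \<in> V" "b' \<in> V" using w(1) by auto
  show "mono_copy_in H5 c V" by (rule H5_copyI[of b' a h a' b V i]) simp_all
  show "mono_copy_in H6 c V" by (rule H6_copyI[of b' a b a' h V i]) simp_all
  show "mono_copy_in H11 c V" by (rule H11_copyI[of b' a h b a' V i]) simp_all
qed

lemma K33e_copies:
  assumes "has_K33e c i V"
  shows "mono_copy_in H5 c V" "mono_copy_in H6 c V" "mono_copy_in H11 c V"
proof -
  obtain x1 x2 x3 y1 y2 y3 where w: "{x1, x2, x3, y1, y2, y3} \<subseteq> V" "distinct [x1, x2, x3, y1, y2, y3]"
    "c x1 x2 = i" "\<forall>x\<in>{x1, x2, x3}. \<forall>y\<in>{y1, y2, y3}. c x y = i"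
    using assms unfolding has_K33e_def by (elim exE conjE) (rule that)
  have x: "c x1 y1 = i" "c x1 y2 = i" "c x1 y3 = i" "c x2 y1 = i" "c x2 y2 = i" "c x2 y3 = i"
    "c x3 y1 = i" "c x3 y2 = i" "c x3 y3 = i"
    using w(4) by simp_all
  have y: "c y1 x1 = i" "c y2 x1 = i" "c y3 x1 = i" "c y1 x2 = i" "c y2 x2 = i" "c y3 x2 = i"
    "c y1 x3 = i" "c y2 x3 = i" "c y3 x3 = i" "c x2 x1 = i"
    by (subst sym, rule x w(3))+
  note [simp] = w(3) x y
  have d: "x1 \<noteq> x2" "x1 \<noteq> x3" "x2 \<noteq> x3" "y1 \<noteq> y2" "y1 \<noteq> y3" "y2 \<noteq> y3"
    "x1 \<noteq> y1" "x1 \<noteq> y2" "x1 \<noteq> y3" "x2 \<noteq> y1" "x2 \<noteq> y2" "x2 \<noteq> y3" "x3 \<noteq> y1" "x3 \<noteq> y2" "x3 \<noteq> y3"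
    using w(2) by auto
  note [simp] = d d[symmetric]
  have [simp]: "x1 \<in> V" "x2 \<in> V" "x3 \<in> V" "y1 \<in> V" "y2 \<in> V" "y3 \<in> V" using w(1) by auto
  show "mono_copy_in H5 c V" by (rule H5_copyI[of x3 y1 x1 y2 x2 V i]) simp_all
  show "mono_copy_in H6 c V" by (rule H6_copyI[of y1 y2 x1 y3 x2 V i]) simp_all
  show "mono_copy_in H11 c V" by (rule H11_copyI[of x3 y1 x1 x2 y2 V i]) simp_all
qed

end

section \<open>Two-colour Ramsey numbers\<close>

context sym_coloring
begin

lemma majority_nbrs:
  assumes "finite Q" "v \<in> Q" "colored_by c {i, j} Q" "2 * m \<le> card Q"
  obtains e f where "{e, f} = {i, j}" "m \<le> card {x \<in> Q - {v}. c v x = e}"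
proof -
  let ?N = "\<lambda>e. {x \<in> Q - {v}. c v x = e}"
  have eq: "Q - {v} = ?N i \<union> ?N j" using assms(2,3) by (auto simp: colored_by_def)
  have "card Q = Suc (card (Q - {v}))" using assms(1,2) by (metis card.remove)
  moreover have "card (Q - {v}) \<le> card (?N i) + card (?N j)" by (subst eq) (rule card_Un_le)
  ultimately have "m \<le> card (?N i) \<or> m \<le> card (?N j)" using assms(4) by linarith
  then show ?thesis using that[of i j] that[of j i] by blast
qed

text \<open>Some \<open>v\<close> has five neighbours in colour \<open>e\<close>. A vertex with two
  \<open>e\<close>-neighbours among them gives, with \<open>v\<close>, a \<open>K4\<close> minus an
  edge, and a further neighbour is pendant at \<open>v\<close>. Hence \<open>e\<close> is a matching
  there and the other colour contains a wheel.\<close>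

lemma ramsey_H6:
  assumes "finite Q" "10 \<le> card Q" "colored_by c {i, j} Q"
  shows "mono_copy_in H6 c Q"
proof (rule ccontr)
  assume no: "\<not> ?thesis"
  obtain v where v: "v \<in> Q" using assms(2) by fastforce
  obtain e f where ef: "{e, f} = {i, j}" "5 \<le> card {x \<in> Q - {v}. c v x = e}"
    using majority_nbrs[OF assms(1) v assms(3), of 5] assms(2) by auto
  let ?N = "{x \<in> Q - {v}. c v x = e}"
  have f: "c x y = f" if "x \<in> ?N" "y \<in> ?N" "x \<noteq> y" "c x y \<noteq> e" for x y
    using colored_byD[OF assms(3), of x y] that ef(1) by auto
  have "has_wheel c f ?N"
  proof (rule wheel_from_matching[OF ef(2)])
    fix x y z assume xyz: "x \<in> ?N" "y \<in> ?N" "z \<in> ?N" "x \<noteq> y" "y \<noteq> z" "x \<noteq> z"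
    show "c x y = f \<or> c x z = f"
    proof (rule ccontr)
      assume "\<not> ?thesis"
      then have e: "c x y = e" "c x z = e" using f[of x y] f[of x z] xyz by blast+
      have "\<not> ?N \<subseteq> {x, y, z}"
        using ef(2) card_mono[of "{x, y, z}" ?N] card_insert_le_m1[of 3 "{y, z}" x] xyz by auto
      then obtain t where t: "t \<in> ?N" "t \<notin> {x, y, z}" by blast
      have "mono_copy_in H6 c Q"
        by (rule H6_copyI[of t y x z v Q e]) (use xyz t v e sym in auto)
      then show False using no by blast
    qed
  qed
  then show False using no wheel_copies(2) has_wheel_mono[of c f ?N Q] by blast
qed

text \<open>Here the pendant edge hangs at a vertex of degree two, and the argument for
  \<open>H6\<close> works only after monochromatic copies of \<open>K4\<close> have been excluded.
  The aim is again that \<open>e\<close> is a matching on five \<open>e\<close>-neighbours of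
  \<open>v\<close>.\<close>

lemma ramsey_H5:
  assumes "finite Q" "10 \<le> card Q" "colored_by c {i, j} Q"
  shows "mono_copy_in H5 c Q"
proof (rule ccontr)
  assume no: "\<not> ?thesis"
  have no_wheel: "\<not> has_wheel c e W" if "W \<subseteq> Q" for e W
    using no wheel_copies(1) has_wheel_mono[of c e W Q] that by blast
  have H5: False if "distinct [a1, a2, a3, a4, a5]" "{a1, a2, a3, a4, a5} \<subseteq> Q"
    "c a2 a3 = e" "c a2 a5 = e" "c a3 a5 = e" "c a3 a4 = e" "c a4 a5 = e" "c a1 a2 = e" for a1 a2 a3 a4 a5 e
    using H5_copyI[OF that] no by blast
  have no_K4: False
    if K: "{x, y, z, t} \<subseteq> Q" "distinct [x, y, z, t]" "c x y = e" "c x z = e" "c x t = e" "c y z = e" "c y t = e" "c z t = e"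
      and ef: "{e, f} = {i, j}" for x y z t e f
  proof -
    let ?W = "Q - {x, y, z, t}"
    have other: "c p q = f" if "p \<in> Q" "q \<in> Q" "p \<noteq> q" "c p q \<noteq> e" for p q
      using colored_byD[OF assms(3), of p q] that ef by auto
    \<comment> \<open>Each vertex of a \<open>K4\<close> has degree two after deletion of a suitable
      edge, so an \<open>e\<close>-edge from \<open>w\<close> would serve as the pendant
      edge.\<close>
    have out: "c w x \<noteq> e \<and> c w y \<noteq> e \<and> c w z \<noteq> e" if "w \<in> ?W" for w
      using H5[of w x y t z e] H5[of w y x t z e] H5[of w z x t y e] K that sym[of y x] sym[of z x] sym[of t x]
        sym[of z y] sym[of t y] sym[of t z] by auto
    have "card ?W = card Q - card {x, y, z, t}" using assms(1) K(1) by (intro card_Diff_subset) auto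
    then have 6: "6 \<le> card ?W" using assms(2) K(2) by simp
    \<comment> \<open>An \<open>f\<close>-edge \<open>u w\<close>, a third outside vertex and
      \<open>x\<close>, \<open>y\<close>, \<open>z\<close> form K_{3,3} plus an edge in colour
      \<open>f\<close>.\<close>
    have W: "c u w = e" if uw: "u \<in> ?W" "w \<in> ?W" "u \<noteq> w" for u w
    proof (rule ccontr)
      assume n: "c u w \<noteq> e"
      have "\<not> ?W \<subseteq> {u, w}" using 6 card_mono[of "{u, w}" ?W] card_insert_le_m1[of 2 "{w}" u] uw by auto
      then obtain s where s: "s \<in> ?W" "s \<noteq> u" "s \<noteq> w" by blast
      have k: "c p q = f" if "p \<in> ?W" "q \<in> {x, y, z}" for p q
        using out[OF that(1)] other[of p q] that K(1) by auto
      have "c u w = f" using n other[of u w] uw by blast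
      moreover have "\<forall>p\<in>{u, w, s}. \<forall>q\<in>{x, y, z}. c p q = f" using k uw s by blast
      ultimately have "has_K33e c f Q"
        by (intro has_K33eI[of u w s x y z]) (use uw s K(1,2) in auto)
      then show False using no K33e_copies(1) by blast
    qed
    have "has_wheel c e ?W" using 6 W by (intro wheel_from_matching) auto
    then show False using no_wheel by blast
  qed
  obtain v where v: "v \<in> Q" using assms(2) by fastforce
  obtain e f where ef: "{e, f} = {i, j}" "5 \<le> card {x \<in> Q - {v}. c v x = e}"
    using majority_nbrs[OF assms(1) v assms(3), of 5] assms(2) by auto
  have fe: "{f, e} = {i, j}" using ef(1) by blast
  let ?N = "{x \<in> Q - {v}. c v x = e}"
  have other: "c x y = f" if "x \<in> ?N" "y \<in> ?N" "x \<noteq> y" "c x y \<noteq> e" for x y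
    using colored_byD[OF assms(3), of x y] that ef(1) by auto
  \<comment> \<open>Together with \<open>v\<close> the path gives \<open>K4\<close> minus an edge on
    \<open>y\<close>, \<open>v\<close>, \<open>z\<close>, \<open>t\<close>, with \<open>x\<close>
    pendant at \<open>y\<close>, which has degree two.\<close>
  have no_P4: False if "x \<in> ?N" "y \<in> ?N" "z \<in> ?N" "t \<in> ?N" "distinct [x, y, z, t]" "c x y = e" "c y z = e" "c z t = e" for x y z t
    using H5[of x y v t z e] that v sym[of y v] sym[of z t] by auto
  have no_tri: False if "x \<in> ?N" "y \<in> ?N" "z \<in> ?N" "distinct [x, y, z]" "c x y = e" "c y z = e" "c x z = e" for x y z
    using no_K4[of v x y z e f] that v ef by auto
  have "has_wheel c f ?N"
  proof (rule wheel_from_matching[OF ef(2)])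
    fix q p s assume qps: "q \<in> ?N" "p \<in> ?N" "s \<in> ?N" "q \<noteq> p" "p \<noteq> s" "q \<noteq> s"
    show "c q p = f \<or> c q s = f"
    proof (rule ccontr)
      assume "\<not> ?thesis"
      then have e: "c q p = e" "c q s = e" "c p q = e" "c s q = e"
        using other[of q p] other[of q s] qps sym by auto
      have "card (?N - {q, p, s}) = card ?N - card {q, p, s}" using assms(1) qps by (intro card_Diff_subset) auto
      then have "2 \<le> card (?N - {q, p, s})" using ef(2) qps by simp
      then obtain t u where tu: "t \<in> ?N - {q, p, s}" "u \<in> ?N - {q, p, s}" "t \<noteq> u" by (rule obtain_two)
      have ne: "t \<noteq> q" "t \<noteq> p" "t \<noteq> s" "u \<noteq> q" "u \<noteq> p" "u \<noteq> s" and N: "t \<in> ?N" "u \<in> ?N" using tu by auto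
      have ps: "c p s = f" using no_tri[of p q s] other[of p s] qps e by auto
      have t: "c t p = f" "c t s = f" "c u p = f" "c u s = f"
        using no_P4[of t p q s] no_P4[of t s q p] no_P4[of u p q s] no_P4[of u s q p]
          other[of t p] other[of t s] other[of u p] other[of u s] qps N ne e by auto
      have tu_e: "c t u = e"
      proof (rule ccontr)
        assume "c t u \<noteq> e"
        then have "c t u = f" using other[of t u] N tu(3) by blast
        then show False
          using no_K4[of p s t u f e] fe ps t qps N ne tu(3) sym[of p t] sym[of p u] sym[of s t] sym[of s u] by auto
      qed
      have tq: "c t q = f"
        using no_P4[of u t q p] other[of t q] tu_e sym[of u t] qps N ne tu(3) e by auto
      \<comment> \<open>Colour \<open>f\<close> contains \<open>K4\<close> minus the edge
        \<open>t u\<close> on \<open>t\<close>, \<open>p\<close>, \<open>s\<close>,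
        \<open>u\<close>, with \<open>q\<close> pendant at \<open>t\<close>.\<close>
      show False
        using H5[of q t p u s f] qps N ne tu(3) t ps tq sym[of q t] sym[of p u] by auto
    qed
  qed
  then show False using no_wheel[of ?N f] by blast
qed

end

section \<open>\<open>H11\<close> on eleven vertices: the handshake lemma and monochromatic copies
  of \<open>K4\<close>\<close>

lemma even_sum_degrees:
  assumes "finite Q" "\<And>x y. R x y \<longleftrightarrow> R y x"
  shows "even (\<Sum>x\<in>Q. card {y \<in> Q. y \<noteq> x \<and> R x y})"
  using assms(1)
proof (induction Q rule: finite_induct)
  case empty
  then show ?case by simp
next
  case (insert v Q)
  have step: "card {y \<in> insert v Q. y \<noteq> x \<and> R x y} = card {y \<in> Q. y \<noteq> x \<and> R x y} + (if R v x then 1 else 0)"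
    if "x \<in> Q" for x
  proof (cases "R v x")
    case True
    then have "{y \<in> insert v Q. y \<noteq> x \<and> R x y} = insert v {y \<in> Q. y \<noteq> x \<and> R x y}"
      using that insert.hyps assms(2) by auto
    then show ?thesis using True insert.hyps by simp
  next
    case False
    then have "{y \<in> insert v Q. y \<noteq> x \<and> R x y} = {y \<in> Q. y \<noteq> x \<and> R x y}" using assms(2) by auto
    then show ?thesis using False by simp
  qed
  have "{y \<in> insert v Q. y \<noteq> v \<and> R v y} = {y \<in> Q. R v y}" using insert.hyps by auto
  moreover have "(\<Sum>x\<in>Q. (if R v x then 1 else 0)) = card {y \<in> Q. R v y}"
    using insert.hyps by (simp add: sum.If_cases Int_def)
  ultimately have "(\<Sum>x\<in>insert v Q. card {y \<in> insert v Q. y \<noteq> x \<and> R x y}) =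
      2 * card {y \<in> Q. R v y} + (\<Sum>x\<in>Q. card {y \<in> Q. y \<noteq> x \<and> R x y})"
    using insert.hyps step by (simp add: sum.distrib)
  then show ?case using insert.IH by simp
qed

lemma obtain_third:
  assumes "distinct [a, b, d]" "p \<in> {a, b, d}" "q \<in> {a, b, d}" "p \<noteq> q"
  obtains s where "{p, q, s} = {a, b, d}" "distinct [p, q, s]"
proof -
  have "card ({a, b, d} - {p, q}) = card {a, b, d} - card {p, q}" using assms by (intro card_Diff_subset) auto
  then have "card ({a, b, d} - {p, q}) = 1" using assms by simp
  then obtain s where s: "{a, b, d} - {p, q} = {s}" by (rule card_1_singletonE)
  show ?thesis
  proof (rule that[of s])
    show "{p, q, s} = {a, b, d}" using s assms(2,3) by blast
    show "distinct [p, q, s]" using s assms(4) by auto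
  qed
qed

locale H11_free = sym_coloring c for c :: "'a \<Rightarrow> 'a \<Rightarrow> nat" +
  fixes Q :: "'a set" and e f :: nat
  assumes finite_Q: "finite Q" and card_Q: "11 \<le> card Q" and ef: "e \<noteq> f"
    and col: "x \<in> Q \<Longrightarrow> y \<in> Q \<Longrightarrow> x \<noteq> y \<Longrightarrow> c x y = e \<or> c x y = f"
    and no_H11: "\<not> mono_copy_in H11 c Q"
begin

lemma swap: "H11_free c Q f e"
  using finite_Q card_Q ef col no_H11 by unfold_locales blast+

text \<open>\<open>H11\<close> in the form used from here on: K_{2,3} with sides
  \<open>{x, y}\<close> and \<open>{p, q, s}\<close>, plus the edge \<open>p q\<close>.\<close>

lemma no_book:
  assumes "distinct [x, y, p, q, s]" "{x, y, p, q, s} \<subseteq> Q" "c x p = g" "c x q = g" "c x s = g"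
    "c y p = g" "c y q = g" "c y s = g" "c p q = g"
  shows False
proof -
  have "mono_copy_in H11 c Q"
    by (rule H11_copyI[of s x p q y Q g]) (use assms sym in auto)
  then show False using no_H11 by blast
qed

lemma no_wheel: "W \<subseteq> Q \<Longrightarrow> \<not> has_wheel c g W"
  using no_H11 wheel_copies(3) has_wheel_mono[of c g W Q] by blast

text \<open>The side of two is \<open>{p, q}\<close>; \<open>w\<close> and the other two vertices of
  \<open>K\<close> form the side of three.\<close>

lemma K4_one_nbr:
  assumes K: "K \<subseteq> Q" "card K = 4" "\<And>x y. x \<in> K \<Longrightarrow> y \<in> K \<Longrightarrow> x \<noteq> y \<Longrightarrow> c x y = e"
    and w: "w \<in> Q - K" and pq: "p \<in> K" "q \<in> K" "p \<noteq> q" "c w p = e" "c w q = e"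
  shows False
proof -
  have fK: "finite K" using K(1) finite_Q finite_subset by blast
  have "card (K - {p, q}) = card K - card {p, q}" using pq fK by (intro card_Diff_subset) auto
  then have "2 \<le> card (K - {p, q})" using K(2) pq by simp
  then obtain u u' where u: "u \<in> K - {p, q}" "u' \<in> K - {p, q}" "u \<noteq> u'" by (rule obtain_two)
  show False
    by (rule no_book[of p q u u' w e]) (use u pq w K(1,3) sym[of w] in auto)
qed

text \<open>Each vertex outside \<open>K\<close> has at most one \<open>e\<close>-neighbour in
  \<open>K\<close>, so \<open>f\<close> is dense towards \<open>K\<close>. This forces the vertices
  outside to span only \<open>e\<close>-edges, and at least seven of them contain a wheel.\<close>

lemma no_K4:
  assumes K: "K \<subseteq> Q" "card K = 4" "\<And>x y. x \<in> K \<Longrightarrow> y \<in> K \<Longrightarrow> x \<noteq> y \<Longrightarrow> c x y = e"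
  shows False
proof -
  let ?W = "Q - K"
  have fK: "finite K" using K(1) finite_Q finite_subset by blast
  have W7: "7 \<le> card ?W" using K(1,2) fK card_Q card_Diff_subset[OF fK K(1)] by simp
  have KW: "c w p = e \<or> c w p = f" "w \<noteq> p" if "w \<in> ?W" "p \<in> K" for w p
    using col[of w p] that K(1) by auto
  have one: "p = q" if "w \<in> ?W" "p \<in> K" "q \<in> K" "c w p = e" "c w q = e" for w p q
    using K4_one_nbr[OF K, of w p q] that by blast
  have others: "c w p = f" if "w \<in> ?W" "a \<in> K" "c w a = e" "p \<in> K" "p \<noteq> a" for w a p
    using KW(1)[OF that(1,4)] one[OF that(1,4,2) _ that(3)] that(5) by blast
  \<comment> \<open>Otherwise the sides \<open>{a, b}\<close> and \<open>{w, w', w''}\<close> with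
    the edge \<open>w w'\<close> form \<open>H11\<close> in colour \<open>f\<close>.\<close>
  have pair: "c w'' a = e \<or> c w'' b = e"
    if "w \<in> ?W" "w' \<in> ?W" "w'' \<in> ?W" "distinct [w, w', w'']" "a \<in> K" "b \<in> K" "a \<noteq> b" "c w w' = f"
      "c w a = f" "c w b = f" "c w' a = f" "c w' b = f" for w w' w'' a b
  proof (rule ccontr)
    assume "\<not> ?thesis"
    then have "c w'' a = f" "c w'' b = f" using KW that by blast+
    then have "c a u = f" "c b u = f" if "u \<in> {w, w', w''}" for u
      using that \<open>c w a = f\<close> \<open>c w b = f\<close> \<open>c w' a = f\<close> \<open>c w' b = f\<close> sym[of a u] sym[of b u] by auto
    moreover have "distinct [a, b, w, w', w'']" "{a, b, w, w', w''} \<subseteq> Q" using that(1-7) K(1) by auto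
    ultimately show False using no_book[of a b w w' w'' f] that(8) by simp
  qed
  have third: "\<exists>w''\<in>?W. distinct [w, w', w'']" if "w \<in> ?W" "w' \<in> ?W" "w \<noteq> w'" for w w'
  proof -
    have "card (?W - {w, w'}) = card ?W - card {w, w'}" using that finite_Q by (intro card_Diff_subset) auto
    then have "card (?W - {w, w'}) \<noteq> 0" using W7 that(3) by simp
    then have "?W - {w, w'} \<noteq> {}" by (metis card.empty)
    then show ?thesis using that by auto
  qed
  \<comment> \<open>Otherwise three vertices of \<open>K\<close> see both \<open>w\<close> and
    \<open>w'\<close> in \<open>f\<close>, and by \<open>pair\<close> a third outside vertex would
    have two \<open>e\<close>-neighbours in \<open>K\<close>.\<close>
  have miss: "\<exists>z\<in>K. \<exists>t\<in>K. z \<noteq> t \<and> c w z = e \<and> c w' t = e"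
    if w: "w \<in> ?W" "w' \<in> ?W" "w \<noteq> w'" "c w w' = f" for w w'
  proof (rule ccontr)
    assume n: "\<not> ?thesis"
    let ?B = "{p \<in> K. c w p = e \<or> c w' p = e}"
    have "p = q" if "p \<in> ?B" "q \<in> ?B" for p q
      using that n one[OF w(1), of p q] one[OF w(2), of p q] by (metis (mono_tags, lifting) mem_Collect_eq)
    then have "card ?B \<le> 1" using fK by (simp add: card_le_Suc0_iff_eq)
    moreover have "card (K - ?B) = card K - card ?B" using fK by (intro card_Diff_subset) auto
    ultimately have "3 \<le> card (K - ?B)" using K(2) by simp
    then obtain p q s where pqs: "p \<in> K - ?B" "q \<in> K - ?B" "s \<in> K - ?B" "p \<noteq> q" "q \<noteq> s" "p \<noteq> s"
      by (rule obtain_three)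
    then have fs: "c u x = f" if "u \<in> {w, w'}" "x \<in> {p, q, s}" for u x
      using KW[of u x] that w by auto
    obtain w'' where w'': "w'' \<in> ?W" "distinct [w, w', w'']" using third[OF w(1-3)] by blast
    have "c w'' p = e \<or> c w'' q = e" "c w'' p = e \<or> c w'' s = e" "c w'' q = e \<or> c w'' s = e"
      using pair[OF w(1,2) w'', of p q] pair[OF w(1,2) w'', of p s] pair[OF w(1,2) w'', of q s]
        pqs w(4) fs by auto
    then show False using one[OF w''(1)] pqs by blast
  qed
  have "c w w' = e" if w: "w \<in> ?W" "w' \<in> ?W" "w \<noteq> w'" for w w'
  proof (rule ccontr)
    assume "c w w' \<noteq> e"
    then have ww': "c w w' = f" using col[of w w'] w by blast
    then obtain z t where zt: "z \<in> K" "t \<in> K" "z \<noteq> t" "c w z = e" "c w' t = e"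
      using miss[OF w] by blast
    have "card (K - {z, t}) = card K - card {z, t}" using zt fK by (intro card_Diff_subset) auto
    then have "card (K - {z, t}) = 2" using K(2) zt by simp
    then obtain x y where xy: "K - {z, t} = {x, y}" "x \<noteq> y" by (auto simp: card_2_iff)
    then have K4: "K = {x, y, z, t}" "x \<in> K" "y \<in> K" "x \<noteq> z" "x \<noteq> t" "y \<noteq> z" "y \<noteq> t" using zt by auto
    have fxy: "c w x = f" "c w y = f" "c w' x = f" "c w' y = f"
      using others[OF w(1) zt(1,4)] others[OF w(2) zt(2,5)] K4(2-) by blast+
    let ?O = "?W - {w, w'}"
    have O: "c u x = e \<or> c u y = e" if "u \<in> ?O" for u
      using pair[OF w(1,2), of u x y] that w(3) K4 xy(2) ww' fxy by auto
    have "card ?O = card ?W - card {w, w'}" using w finite_Q by (intro card_Diff_subset) auto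
    then have "5 \<le> card ?O" using W7 w(3) by simp
    moreover have eq: "?O = {u \<in> ?O. c u x = e} \<union> {u \<in> ?O. c u y = e}"
    proof (intro equalityI subsetI)
      fix u assume "u \<in> ?O"
      then show "u \<in> {u \<in> ?O. c u x = e} \<union> {u \<in> ?O. c u y = e}" using O[of u] by simp
    qed blast
    have "card ?O \<le> card {u \<in> ?O. c u x = e} + card {u \<in> ?O. c u y = e}"
      by (subst eq) (rule card_Un_le)
    ultimately have "3 \<le> card {u \<in> ?O. c u x = e} \<or> 3 \<le> card {u \<in> ?O. c u y = e}" by linarith
    \<comment> \<open>Three of the five remaining vertices share the \<open>e\<close>-neighbour
      \<open>a\<close>. By \<open>miss\<close> they are pairwise joined in \<open>e\<close>, so with
      \<open>a\<close> they form a second \<open>K4\<close>, in which \<open>w\<close> turns out to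
      have two \<open>e\<close>-neighbours.\<close>
    then obtain a where a: "a \<in> {x, y}" "3 \<le> card {u \<in> ?O. c u a = e}" by blast
    obtain p q s where pqs: "p \<in> {u \<in> ?O. c u a = e}" "q \<in> {u \<in> ?O. c u a = e}" "s \<in> {u \<in> ?O. c u a = e}"
      "p \<noteq> q" "q \<noteq> s" "p \<noteq> s"
      using a(2) by (rule obtain_three)
    have aK: "a \<in> K" "a \<noteq> z" "a \<noteq> t" using a K4 by auto
    have clique: "c u u' = e" if u: "u \<in> {p, q, s}" "u' \<in> {p, q, s}" "u \<noteq> u'" for u u'
    proof (rule ccontr)
      assume n: "c u u' \<noteq> e"
      have uO: "u \<in> ?W" "u' \<in> ?W" "c u a = e" "c u' a = e" using u pqs by auto
      then have "c u u' = f" using col[of u u'] u(3) n by blast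
      then obtain b b' where b: "b \<in> K" "b' \<in> K" "b \<noteq> b'" "c u b = e" "c u' b' = e"
        using miss[OF uO(1,2) u(3)] by blast
      then show False using one[OF uO(1) b(1) aK(1)] one[OF uO(2) b(2) aK(1)] uO(3,4) by blast
    qed
    have wp: "c w u = e" if u: "u \<in> {p, q}" for u
    proof (rule ccontr)
      assume "c w u \<noteq> e"
      then have wu: "c w u = f" using col[of w u] u pqs w by auto
      obtain u' where u': "u' \<in> {p, q}" "u' \<noteq> u" using u pqs by blast
      have uW: "u \<in> ?W" "u' \<in> ?W" "distinct [w, u, u']" "c u a = e" "c u' a = e" using u u' pqs w by auto
      obtain b where b: "b \<in> {x, y}" "b \<noteq> a" using a xy by blast
      then have bK: "b \<in> K" "b \<noteq> z" "b \<noteq> t" using K4 by auto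
      have "c w b = f" using b fxy by blast
      moreover have "c w t = f" using others[OF w(1) zt(1,4,2)] zt(3) by blast
      moreover have "c u b = f" "c u t = f"
        using others[OF uW(1) aK(1) uW(4)] bK zt(2) b(2) aK(3) by blast+
      ultimately have "c u' b = e \<or> c u' t = e"
        using pair[OF w(1) uW(1-3) bK(1) zt(2) bK(3) wu] by blast
      moreover have "c u' b = f" "c u' t = f"
        using others[OF uW(2) aK(1) uW(5)] bK zt(2) b(2) aK(3) by blast+
      ultimately show False using ef by simp
    qed
    show False
    proof (rule K4_one_nbr[of "{a, p, q, s}" w p q])
      show "{a, p, q, s} \<subseteq> Q" using aK K(1) pqs by blast
      have "a \<notin> {p, q, s}" using aK pqs by blast
      then show "card {a, p, q, s} = 4" using pqs by auto
      show "c u u' = e" if "u \<in> {a, p, q, s}" "u' \<in> {a, p, q, s}" "u \<noteq> u'" for u u'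
        using that clique pqs sym[of a] by auto
      show "w \<in> Q - {a, p, q, s}" using w pqs aK by blast
    qed (use pqs wp in auto)
  qed
  then have "has_wheel c e ?W" using W7 by (intro wheel_from_matching) auto
  then show False using no_wheel by blast
qed

lemma no_K4_list:
  assumes "distinct [x, y, z, t]" "{x, y, z, t} \<subseteq> Q"
    "c x y = e" "c x z = e" "c x t = e" "c y z = e" "c y t = e" "c z t = e"
  shows False
  by (rule no_K4[of "{x, y, z, t}"]) (use assms sym in auto)

end

section \<open>Six neighbours of one vertex in one colour\<close>

locale H11_free_nbrs = H11_free +
  fixes v and N
  assumes v: "v \<in> Q" and N_sub: "N \<subseteq> Q - {v}" and N_col: "x \<in> N \<Longrightarrow> c v x = e" and card_N: "card N = 6"
begin

lemma N_Q: "x \<in> N \<Longrightarrow> x \<in> Q" "x \<in> N \<Longrightarrow> x \<noteq> v" "x \<in> N \<Longrightarrow> c x v = e"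
  using N_sub N_col sym[of x v] by auto

lemma nbr_col: "x \<in> N \<Longrightarrow> y \<in> N \<Longrightarrow> x \<noteq> y \<Longrightarrow> c x y \<noteq> e \<Longrightarrow> c x y = f"
  using col[of x y] N_Q by blast

text \<open>An \<open>e\<close>-triangle in \<open>N\<close> would complete a \<open>K4\<close> with
  \<open>v\<close>.\<close>

lemma no_triangle:
  assumes "x \<in> N" "y \<in> N" "z \<in> N" "x \<noteq> y" "y \<noteq> z" "x \<noteq> z" "c x y = e" "c y z = e"
  shows "c x z = f"
proof (rule ccontr)
  assume "c x z \<noteq> f"
  then have "c x z = e" using nbr_col assms by blast
  then show False using no_K4_list[of v x y z] assms N_Q N_col v by auto
qed

text \<open>An \<open>e\<close>-cycle of length four in \<open>N\<close> is the rim of a wheel with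
  hub \<open>v\<close>.\<close>

lemma no_C4:
  assumes "x \<in> N" "y \<in> N" "z \<in> N" "t \<in> N" "distinct [x, y, z, t]" "c x y = e" "c y z = e" "c z t = e"
  shows "c t x = f"
proof (rule ccontr)
  assume "c t x \<noteq> f"
  then have "c t x = e" using nbr_col[of t x] assms by auto
  then have "has_wheel c e Q"
    by (intro has_wheelI[of v x z y t]) (use assms N_Q N_col v sym[of z y] sym[of t x] in auto)
  then show False using no_wheel by blast
qed

lemma outside_book:
  assumes "u \<in> Q - N - {v}" "{p, q, s} \<subseteq> N" "distinct [p, q, s]" "c p q = e" "c u p = e" "c u q = e" "c u s = e"
  shows False
  by (rule no_book[of v u p q s e]) (use assms N_Q N_col v in auto)

text \<open>Each of the at least four vertices outside \<open>N\<close> and \<open>v\<close> sees in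
  \<open>f\<close> one of the three triples of consecutive cycle vertices that contain
  \<open>p0\<close>. Such a triple contains an \<open>f\<close>-chord, so two outside vertices on
  the same triple give \<open>H11\<close>.\<close>

lemma no_C5_aux:
  assumes N: "N = {p0, p1, p2, p3, p4, p5}" and d: "distinct [p0, p1, p2, p3, p4, p5]"
    and cyc: "c p0 p1 = e" "c p1 p2 = e" "c p2 p3 = e" "c p3 p4 = e" "c p4 p0 = e"
    and p5: "c p5 p1 = f" "c p5 p2 = f" "c p5 p3 = f" "c p5 p4 = f"
  shows False
proof -
  have ch: "c p0 p2 = f" "c p1 p3 = f" "c p2 p4 = f" "c p3 p0 = f" "c p4 p1 = f"
    using no_triangle[of p0 p1 p2] no_triangle[of p1 p2 p3] no_triangle[of p2 p3 p4] no_triangle[of p3 p4 p0]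
      no_triangle[of p4 p0 p1] cyc d N by auto
  let ?O = "Q - N - {v}"
  let ?P = "\<lambda>x y z u. c u x = f \<and> c u y = f \<and> c u z = f"
  have P: "?P p0 p3 p4 u \<or> ?P p0 p1 p4 u \<or> ?P p0 p1 p2 u" if u: "u \<in> ?O" for u
  proof -
    have uc: "c u p = e \<or> c u p = f" if "p \<in> N" for p
      using col[of u p] u N_Q[OF that] that by auto
    have e3: "\<not> (c u p = e \<and> c u q = e \<and> c u s = e)" if "{p, q, s} \<subseteq> N" "distinct [p, q, s]" "c p q = e" for p q s
      using outside_book[OF u that] by blast
    have f3: "\<not> (c u p = f \<and> c u q = f \<and> c u s = f)"
      if "{p, q, s} \<subseteq> {p1, p2, p3, p4}" "distinct [p, q, s]" "c p q = f" for p q s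
    proof
      assume "c u p = f \<and> c u q = f \<and> c u s = f"
      moreover have "c p5 p = f" "c p5 q = f" "c p5 s = f" using that(1) p5 by auto
      moreover have "p \<in> N" "q \<in> N" "s \<in> N" "p \<noteq> p5" "q \<noteq> p5" "s \<noteq> p5" "p5 \<in> N" using that(1) N d by auto
      moreover then have "distinct [u, p5, p, q, s]" "{u, p5, p, q, s} \<subseteq> Q" using u that(2) N_Q(1) by auto
      ultimately show False using no_book[of u p5 p q s f] that(3) by blast
    qed
    have e2: "\<not> (c u p = e \<and> c u q = e)"
      if "p \<in> N" "q \<in> N" "w \<in> N" "distinct [p, q, w]" "c p w = e" "c q w = e" for p q w
    proof
      assume "c u p = e \<and> c u q = e"
      then have "c p u = e" "c q u = e" using sym[of u] by auto
      moreover have "distinct [p, q, v, w, u]" "{p, q, v, w, u} \<subseteq> Q" using that N_Q v u by auto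
      ultimately show False using no_book[of p q v w u e] N_Q(3) N_col that by auto
    qed
    have "\<not> (c u p1 = f \<and> c u p3 = f \<and> c u p2 = f)" "\<not> (c u p4 = f \<and> c u p1 = f \<and> c u p2 = f)"
      "\<not> (c u p1 = f \<and> c u p3 = f \<and> c u p4 = f)" "\<not> (c u p2 = f \<and> c u p4 = f \<and> c u p3 = f)"
      using f3[of p1 p3 p2] f3[of p4 p1 p2] f3[of p1 p3 p4] f3[of p2 p4 p3] d ch by auto
    moreover have "\<not> (c u p1 = e \<and> c u p3 = e)" "\<not> (c u p2 = e \<and> c u p4 = e)" "\<not> (c u p1 = e \<and> c u p4 = e)"
      using e2[of p1 p3 p2] e2[of p2 p4 p3] e2[of p1 p4 p0] cyc N d sym[of p3 p2] sym[of p4 p3] sym[of p1 p0] by auto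
    moreover have "\<not> (c u p1 = e \<and> c u p2 = e \<and> c u p0 = e)" "\<not> (c u p2 = e \<and> c u p3 = e \<and> c u p0 = e)"
      "\<not> (c u p3 = e \<and> c u p4 = e \<and> c u p0 = e)"
      using e3[of p1 p2 p0] e3[of p2 p3 p0] e3[of p3 p4 p0] cyc N d by auto
    moreover have "c u p0 = e \<or> c u p0 = f" "c u p1 = e \<or> c u p1 = f" "c u p2 = e \<or> c u p2 = f"
      "c u p3 = e \<or> c u p3 = f" "c u p4 = e \<or> c u p4 = f"
      using uc N by auto
    ultimately show ?thesis by metis
  qed
  have two: "u = u'" if "u \<in> ?O" "u' \<in> ?O" "?P x y z u" "?P x y z u'" "{x, y, z} \<subseteq> N" "distinct [x, y, z]" "c x y = f"
    for u u' x y z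
  proof (rule ccontr)
    assume "u \<noteq> u'"
    then have "distinct [u, u', x, y, z]" "{u, u', x, y, z} \<subseteq> Q" using that N_Q(1) by auto
    then show False using no_book[of u u' x y z f] that by blast
  qed
  have fin: "finite ?O" using finite_Q by simp
  have le1: "card {u \<in> ?O. ?P x y z u} \<le> 1" if "{x, y, z} \<subseteq> N" "distinct [x, y, z]" "c x y = f" for x y z
  proof -
    have "\<forall>u\<in>{u \<in> ?O. ?P x y z u}. \<forall>u'\<in>{u \<in> ?O. ?P x y z u}. u = u'" using two[of _ _ x y z] that by blast
    moreover have "finite {u \<in> ?O. ?P x y z u}" by (rule finite_subset[OF _ fin]) blast
    ultimately show ?thesis unfolding One_nat_def using card_le_Suc0_iff_eq by blast
  qed
  have "4 \<le> card ?O"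
  proof -
    have fN: "finite N" using finite_Q N_sub finite_subset by blast
    have "v \<notin> N" using N_sub by blast
    then have "card (insert v N) = 7" using card_N fN by simp
    moreover have "card (Q - insert v N) = card Q - card (insert v N)"
      using fN N_sub v by (intro card_Diff_subset) auto
    moreover have "?O = Q - insert v N" by blast
    ultimately show ?thesis using card_Q by simp
  qed
  moreover have "?O \<subseteq> {u \<in> ?O. ?P p3 p0 p4 u} \<union> {u \<in> ?O. ?P p4 p1 p0 u} \<union> {u \<in> ?O. ?P p0 p2 p1 u}"
    using P by auto
  then have "card ?O \<le> card ({u \<in> ?O. ?P p3 p0 p4 u} \<union> {u \<in> ?O. ?P p4 p1 p0 u} \<union> {u \<in> ?O. ?P p0 p2 p1 u})"
    by (intro card_mono finite_UnI finite_subset[OF _ fin]) blast+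
  moreover have "\<dots> \<le> card {u \<in> ?O. ?P p3 p0 p4 u} + card {u \<in> ?O. ?P p4 p1 p0 u} + card {u \<in> ?O. ?P p0 p2 p1 u}"
    by (meson add_le_mono1 card_Un_le order_trans)
  moreover have "card {u \<in> ?O. ?P p3 p0 p4 u} \<le> 1" "card {u \<in> ?O. ?P p4 p1 p0 u} \<le> 1" "card {u \<in> ?O. ?P p0 p2 p1 u} \<le> 1"
    by (intro le1; use d N ch in auto)+
  ultimately show False by linarith
qed

text \<open>Without \<open>e\<close>-triangles and \<open>e\<close>-cycles of length four, the sixth
  vertex has at most one \<open>e\<close>-neighbour on the cycle; a rotation puts it at
  \<open>p0\<close>.\<close>

lemma no_C5:
  assumes N: "N = {p0, p1, p2, p3, p4, p5}" and d: "distinct [p0, p1, p2, p3, p4, p5]"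
    and cyc: "c p0 p1 = e" "c p1 p2 = e" "c p2 p3 = e" "c p3 p4 = e" "c p4 p0 = e"
  shows False
proof -
  have p5: "c p5 p = e \<or> c p5 p = f" if "p \<in> {p0, p1, p2, p3, p4}" for p
    using nbr_col[of p5 p] N d that by auto
  have adj: "c p5 y = f" if "x \<in> N" "y \<in> N" "distinct [p5, x, y]" "c x y = e" "c p5 x = e" for x y
    using no_triangle[of p5 x y] that N by auto
  have opp: "c p5 y = f" if "x \<in> N" "y \<in> N" "z \<in> N" "distinct [p5, x, z, y]" "c x z = e" "c z y = e" "c p5 x = e" for x y z
    using no_C4[of p5 x z y] that N sym[of y p5] by auto
  have rev: "c p1 p0 = e" "c p2 p1 = e" "c p3 p2 = e" "c p4 p3 = e" "c p0 p4 = e" using cyc sym by metis+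
  have one: "c p5 b = f \<and> c p5 y = f \<and> c p5 z = f \<and> c p5 t = f"
    if "c p5 a = e" "{a, b, y, z, t} \<subseteq> {p0, p1, p2, p3, p4}" "distinct [a, b, y, z, t]"
      "c a b = e" "c b y = e" "c a t = e" "c t z = e" for a b y z t
  proof -
    have "p5 \<notin> {p0, p1, p2, p3, p4}" using d by auto
    then have "{a, b, y, z, t} \<subseteq> N" "p5 \<notin> {a, b, y, z, t}" using that(2) N by blast+
    then have "a \<in> N" "b \<in> N" "y \<in> N" "z \<in> N" "t \<in> N"
      "p5 \<noteq> a" "p5 \<noteq> b" "p5 \<noteq> y" "p5 \<noteq> z" "p5 \<noteq> t"
      by simp_all
    then show ?thesis
      using adj[of a b] opp[of a y b] opp[of a z t] adj[of a t] that(1,3-) by auto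
  qed
  show False
  proof (cases "c p5 p0 = e \<or> c p5 p1 = e \<or> c p5 p2 = e \<or> c p5 p3 = e \<or> c p5 p4 = e")
    case False
    then show False using no_C5_aux[OF N d cyc] p5 by blast
  next
    case True
    then show False
    proof (elim disjE)
      assume "c p5 p0 = e"
      then have "c p5 p1 = f \<and> c p5 p2 = f \<and> c p5 p3 = f \<and> c p5 p4 = f"
        by (rule one) (use d cyc rev in auto)
      then show False by (intro no_C5_aux[OF N d cyc]) auto
    next
      assume "c p5 p1 = e"
      then have "c p5 p2 = f \<and> c p5 p3 = f \<and> c p5 p4 = f \<and> c p5 p0 = f"
        by (rule one) (use d cyc rev in auto)
      then show False by (intro no_C5_aux[of p1 p2 p3 p4 p0 p5]) (use N d cyc in auto)
    next
      assume "c p5 p2 = e"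
      then have "c p5 p3 = f \<and> c p5 p4 = f \<and> c p5 p0 = f \<and> c p5 p1 = f"
        by (rule one) (use d cyc rev in auto)
      then show False by (intro no_C5_aux[of p2 p3 p4 p0 p1 p5]) (use N d cyc in auto)
    next
      assume "c p5 p3 = e"
      then have "c p5 p4 = f \<and> c p5 p0 = f \<and> c p5 p1 = f \<and> c p5 p2 = f"
        by (rule one) (use d cyc rev in auto)
      then show False by (intro no_C5_aux[of p3 p4 p0 p1 p2 p5]) (use N d cyc in auto)
    next
      assume "c p5 p4 = e"
      then have "c p5 p0 = f \<and> c p5 p1 = f \<and> c p5 p2 = f \<and> c p5 p3 = f"
        by (rule one) (use d cyc rev in auto)
      then show False by (intro no_C5_aux[of p4 p0 p1 p2 p3 p5]) (use N d cyc in auto)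
    qed
  qed
qed

text \<open>In colour \<open>f\<close> the set \<open>N\<close> is a prism, in colour
  \<open>e\<close> a 6-cycle. One more vertex \<open>u\<close> exists, and any choice of colours
  from \<open>u\<close> to \<open>N\<close> creates \<open>H11\<close> or a \<open>K4\<close> in
  colour \<open>f\<close>.\<close>

lemma no_C6:
  assumes N: "N = {a1, a2, a3, b1, b2, b3}" and d: "distinct [a1, a2, a3, b1, b2, b3]"
    and ff: "c a1 a2 = f" "c a1 a3 = f" "c a2 a3 = f" "c b1 b2 = f" "c b1 b3 = f" "c b2 b3 = f"
      "c a1 b1 = f" "c a2 b2 = f" "c a3 b3 = f"
    and ee: "c a1 b2 = e" "c a1 b3 = e" "c a2 b1 = e" "c a2 b3 = e" "c a3 b1 = e" "c a3 b2 = e"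
  shows False
proof -
  have "card (Q - insert v N) \<noteq> 0"
  proof -
    have fN: "finite N" using finite_Q N_sub finite_subset by blast
    have "card (insert v N) \<le> 7" using card_N fN by (simp add: card_insert_if)
    moreover have "card Q - card (insert v N) \<le> card (Q - insert v N)"
      using fN by (intro diff_card_le_card_Diff) simp
    ultimately show ?thesis using card_Q by simp
  qed
  then obtain u where u: "u \<in> Q - N - {v}" by (metis Diff_insert all_not_in_conv card.empty)
  have uc: "c u p = e \<or> c u p = f" if "p \<in> N" for p
    using col[of u p] u N_Q[OF that] that by auto
  interpret sw: H11_free c Q f e by (rule swap)
  have K4: "\<not> (c u p = f \<and> c u q = f \<and> c u s = f)"
    if "{p, q, s} \<subseteq> N" "distinct [p, q, s]" "c p q = f" "c p s = f" "c q s = f" for p q s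
    using sw.no_K4_list[of u p q s] that u N_Q(1) by auto
  have e3: "\<not> (c u p = e \<and> c u q = e \<and> c u s = e)" if "{p, q, s} \<subseteq> N" "distinct [p, q, s]" "c p q = e" for p q s
    using outside_book[OF u that] by blast
  have f3: "\<not> (c u p = f \<and> c u q = f \<and> c u s = f)"
    if "{p, q, s, t} \<subseteq> N" "distinct [p, q, s, t]" "c p q = f" "c q s = f" "c s t = f" "c t p = f" for p q s t
  proof
    assume *: "c u p = f \<and> c u q = f \<and> c u s = f"
    show False
      by (rule no_book[of p s q u t f]) (use * that u N_Q(1) sym[of p] sym[of s] sym[of q u] in auto)
  qed
  have rev: "c a2 a1 = f" "c a3 a1 = f" "c a3 a2 = f" "c b2 b1 = f" "c b3 b1 = f" "c b3 b2 = f"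
    "c b1 a1 = f" "c b2 a2 = f" "c b3 a3 = f"
    using ff sym by metis+
  have "\<not> (c u a1 = f \<and> c u a2 = f \<and> c u a3 = f)" "\<not> (c u b1 = f \<and> c u b2 = f \<and> c u b3 = f)"
    using K4[of a1 a2 a3] K4[of b1 b2 b3] ff d N by auto
  moreover have "\<not> (c u a1 = e \<and> c u b2 = e \<and> c u a2 = e)"
    "\<not> (c u a1 = e \<and> c u b2 = e \<and> c u a3 = e)"
    "\<not> (c u a1 = e \<and> c u b2 = e \<and> c u b1 = e)"
    "\<not> (c u a1 = e \<and> c u b2 = e \<and> c u b3 = e)"
    "\<not> (c u a1 = e \<and> c u b3 = e \<and> c u a2 = e)"
    "\<not> (c u a1 = e \<and> c u b3 = e \<and> c u a3 = e)"
    "\<not> (c u a1 = e \<and> c u b3 = e \<and> c u b1 = e)"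
    "\<not> (c u a1 = e \<and> c u b3 = e \<and> c u b2 = e)"
    "\<not> (c u a2 = e \<and> c u b1 = e \<and> c u a1 = e)"
    "\<not> (c u a2 = e \<and> c u b1 = e \<and> c u a3 = e)"
    "\<not> (c u a2 = e \<and> c u b1 = e \<and> c u b2 = e)"
    "\<not> (c u a2 = e \<and> c u b1 = e \<and> c u b3 = e)"
    "\<not> (c u a2 = e \<and> c u b3 = e \<and> c u a1 = e)"
    "\<not> (c u a2 = e \<and> c u b3 = e \<and> c u a3 = e)"
    "\<not> (c u a2 = e \<and> c u b3 = e \<and> c u b1 = e)"
    "\<not> (c u a2 = e \<and> c u b3 = e \<and> c u b2 = e)"
    "\<not> (c u a3 = e \<and> c u b1 = e \<and> c u a1 = e)"
    "\<not> (c u a3 = e \<and> c u b1 = e \<and> c u a2 = e)"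
    "\<not> (c u a3 = e \<and> c u b1 = e \<and> c u b2 = e)"
    "\<not> (c u a3 = e \<and> c u b1 = e \<and> c u b3 = e)"
    "\<not> (c u a3 = e \<and> c u b2 = e \<and> c u a1 = e)"
    "\<not> (c u a3 = e \<and> c u b2 = e \<and> c u a2 = e)"
    "\<not> (c u a3 = e \<and> c u b2 = e \<and> c u b1 = e)"
    "\<not> (c u a3 = e \<and> c u b2 = e \<and> c u b3 = e)"
    by (rule e3; use ee d N in auto)+
  moreover have "\<not> (c u a1 = f \<and> c u a2 = f \<and> c u b2 = f)"
    "\<not> (c u a1 = f \<and> c u a3 = f \<and> c u b3 = f)"
    "\<not> (c u a2 = f \<and> c u a1 = f \<and> c u b1 = f)"
    "\<not> (c u a2 = f \<and> c u a3 = f \<and> c u b3 = f)"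
    "\<not> (c u a3 = f \<and> c u a1 = f \<and> c u b1 = f)"
    "\<not> (c u a3 = f \<and> c u a2 = f \<and> c u b2 = f)"
    using f3[of a1 a2 b2 b1] f3[of a1 a3 b3 b1] f3[of a2 a1 b1 b2] f3[of a2 a3 b3 b2] f3[of a3 a1 b1 b3] f3[of a3 a2 b2 b3]
      ff rev d N by auto
  moreover have "c u a1 = e \<or> c u a1 = f" "c u a2 = e \<or> c u a2 = f" "c u a3 = e \<or> c u a3 = f"
    "c u b1 = e \<or> c u b1 = f" "c u b2 = e \<or> c u b2 = f" "c u b3 = e \<or> c u b3 = f"
    using uc N by auto
  ultimately show False by sat
qed

text \<open>Otherwise \<open>a''\<close> and \<open>b\<close> both see \<open>a\<close>,
  \<open>a'\<close>, \<open>w\<close> in \<open>f\<close>, and \<open>a a'\<close> is the extra edge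
  of \<open>H11\<close>.\<close>

lemma kite:
  assumes "distinct [a, a', a'', b, w]" "{a, a', a'', b, w} \<subseteq> N" "c a a' = f" "c a a'' = f" "c a' a'' = f"
    "c b a = f" "c b a' = f" "c w b = f"
  shows "c w a'' = e"
proof (rule ccontr)
  assume n: "c w a'' \<noteq> e"
  have "c w a'' = f" by (rule nbr_col) (use assms(1,2) n in auto)
  then show False
    using no_book[of a'' b a a' w f] assms N_Q(1) sym[of a''] sym[of b w] by auto
qed

lemma some_e:
  assumes "distinct [a, a', a'', b]" "{a, a', a'', b} \<subseteq> N" "c a a' = f" "c a a'' = f" "c a' a'' = f"
    "c b a = f" "c b a' = f"
  shows "c b a'' = e"
proof (rule ccontr)
  interpret sw: H11_free c Q f e by (rule swap)
  assume n: "c b a'' \<noteq> e"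
  have "c b a'' = f" by (rule nbr_col) (use assms(1,2) n in auto)
  then show False using sw.no_K4_list[of b a a' a''] assms N_Q(1) by auto
qed

text \<open>By \<open>some_e\<close> and \<open>no_triangle\<close>, \<open>b1 a3\<close> has colour
  \<open>e\<close> and \<open>b2 a3\<close> colour \<open>f\<close>. Each way to place
  \<open>b3\<close> then ends in an \<open>e\<close>-cycle of length four or five or in a conflict
  with \<open>kite\<close>.\<close>

lemma edge_opposite_triangle:
  assumes N: "N = {a1, a2, a3, b1, b2, b3}" and d: "distinct [a1, a2, a3, b1, b2, b3]"
    and ff: "c a1 a2 = f" "c a1 a3 = f" "c a2 a3 = f"
    and b1: "c b1 b2 = e" "c b1 a1 = f" "c b1 a2 = f"
  shows False
proof -
  have ff': "c a2 a1 = f" "c a3 a1 = f" "c a3 a2 = f" using ff sym by metis+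
  have ef_dec: "c x y = e \<or> c x y = f" if "x \<in> {b2, b3}" "y \<in> {a1, a2, a3}" for x y
    using nbr_col[of x y] that N d by auto
  have b1a3: "c b1 a3 = e" using some_e[of a1 a2 a3 b1] N d ff b1 by auto
  have b2a3: "c b2 a3 = f" using no_triangle[of b2 b1 a3] N d b1 b1a3 sym[of b2 b1] by auto
  have k: "c w z = e" if "{x, y, z} = {a1, a2, a3}" "distinct [x, y, z]" "b \<in> {b1, b2, b3}" "w \<in> {b1, b2, b3}" "b \<noteq> w"
    "c b x = f" "c b y = f" "c w b = f" "c x y = f" "c x z = f" "c y z = f" for b w x y z
  proof (rule kite[of x y z b w])
    have "b \<notin> {a1, a2, a3}" "w \<notin> {a1, a2, a3}" using that(3,4) d by auto
    then show "distinct [x, y, z, b, w]" using that(1,2,5) by auto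
    show "{x, y, z, b, w} \<subseteq> N" using that(1,3,4) N by blast
  qed (use that in auto)
  have s: "c b z = e" if "{x, y, z} = {a1, a2, a3}" "distinct [x, y, z]" "b \<in> {b2, b3}"
    "c b x = f" "c b y = f" "c x y = f" "c x z = f" "c y z = f" for b x y z
  proof (rule some_e[of x y z b])
    have "b \<notin> {a1, a2, a3}" using that(3) d by auto
    then show "distinct [x, y, z, b]" using that(1,2) by auto
    show "{x, y, z, b} \<subseteq> N" using that(1,3) N by blast
  qed (use that in auto)
  show False
  proof (cases "c b3 b1 = e")
    case False
    then have b31: "c b3 b1 = f" using nbr_col[of b3 b1] N d by auto
    have b3a3: "c b3 a3 = e" by (rule k[of a1 a2 a3 b1 b3]) (use d ff b1 b31 in auto)
    have b23: "c b2 b3 = f"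
      using no_C4[of b3 a3 b1 b2] N d b3a3 b1a3 b1(1) sym[of a3 b1] by auto
    have b32: "c b3 b2 = f" using b23 sym by metis
    have C5: "\<not> (c b2 a1 = e \<and> c b3 a1 = e)" "\<not> (c b2 a2 = e \<and> c b3 a2 = e)"
      using no_C5[of b1 b2 a1 b3 a3 a2] no_C5[of b1 b2 a2 b3 a3 a1] N d b1(1) b3a3 b1a3
        sym[of a1 b3] sym[of a2 b3] sym[of a3 b1] by auto
    have "c b2 a1 = e \<or> c b2 a2 = e" using s[of a2 a3 a1 b2] ef_dec[of b2] b2a3 ff ff' d by auto
    then consider "c b2 a1 = e" "c b2 a2 = e" | "c b2 a1 = e" "c b2 a2 = f" | "c b2 a1 = f" "c b2 a2 = e"
      using ef_dec[of b2 a1] ef_dec[of b2 a2] by auto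
    then show False
    proof cases
      case 1
      then have "c b3 a1 = f" "c b3 a2 = f" using C5 ef_dec[of b3] by auto
      then have "c b2 a3 = e" by (intro k[of a1 a2 a3 b3 b2]) (use d ff b23 in auto)
      then show False using b2a3 ef by simp
    next
      case 2
      then have "c b3 a1 = e" by (intro k[of a2 a3 a1 b2 b3]) (use d ff ff' b32 b2a3 in auto)
      then show False using 2 C5 by blast
    next
      case 3
      then have "c b3 a2 = e" by (intro k[of a1 a3 a2 b2 b3]) (use d ff ff' b32 b2a3 in auto)
      then show False using 3 C5 by blast
    qed
  next
    case b31: True
    have b32: "c b3 b2 = f" using no_triangle[of b3 b1 b2] N d b31 b1(1) by auto
    have b3a3: "c b3 a3 = f" using no_triangle[of b3 b1 a3] N d b31 b1a3 by auto
    have sh: "\<not> (c b2 a = e \<and> c b3 a = e)" if "a \<in> {a1, a2}" for a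
    proof
      assume *: "c b2 a = e \<and> c b3 a = e"
      have "c b3 b1 = f"
        by (rule no_C4[of b1 b2 a b3]) (use that N d * b1(1) sym[of a b3] in auto)
      then show False using b31 ef by simp
    qed
    have b2: "c b2 a1 = e \<or> c b2 a2 = e" using s[of a2 a3 a1 b2] ef_dec[of b2] b2a3 ff ff' d by auto
    have b3: "c b3 a1 = e \<or> c b3 a2 = e" using s[of a2 a3 a1 b3] ef_dec[of b3] b3a3 ff ff' d by auto
    consider "c b2 a1 = e" "c b3 a1 = f" "c b2 a2 = f" | "c b2 a2 = e" "c b3 a2 = f" "c b2 a1 = f"
      using b2 b3 sh ef_dec by (metis insertCI)
    then show False
    proof cases
      case 1
      then have "c b3 a1 = e" by (intro k[of a2 a3 a1 b2 b3]) (use d ff ff' b32 b2a3 in auto)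
      then show False using 1 ef by simp
    next
      case 2
      then have "c b3 a2 = e" by (intro k[of a1 a3 a2 b2 b3]) (use d ff ff' b32 b2a3 in auto)
      then show False using 2 ef by simp
    qed
  qed
qed

text \<open>By \<open>kite\<close>, \<open>b2\<close> and \<open>b3\<close> see \<open>a3\<close> in
  \<open>e\<close>. If \<open>a1\<close> sees one of them in \<open>f\<close>, \<open>kite\<close>
  and \<open>no_C4\<close> lead to a \<open>K4\<close> in \<open>f\<close>; otherwise
  \<open>a1\<close>, \<open>b2\<close>, \<open>a3\<close>, \<open>b3\<close> is an
  \<open>e\<close>-cycle.\<close>

lemma two_f_opposite_triangle:
  assumes N: "N = {a1, a2, a3, b1, b2, b3}" and d: "distinct [a1, a2, a3, b1, b2, b3]"
    and ff: "c a1 a2 = f" "c a1 a3 = f" "c a2 a3 = f" "c b1 b2 = f" "c b1 b3 = f" "c b2 b3 = f"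
    and b1: "c b1 a1 = f" "c b1 a2 = f"
  shows False
proof -
  have ff': "c a2 a1 = f" "c a3 a1 = f" "c a3 a2 = f" "c b2 b1 = f" "c b3 b1 = f" "c b3 b2 = f"
    "c a1 b1 = f" "c a2 b1 = f" using ff b1 sym by metis+
  have main: False if N': "{a1, a2, a3, b1, x, y} \<subseteq> N" and d': "distinct [a1, a2, a3, b1, x, y]"
    and f': "c b1 x = f" "c b1 y = f" "c x y = f" "c x b1 = f" "c y b1 = f" and a1y: "c a1 y = f" for x y
  proof -
    interpret sw: H11_free c Q f e by (rule swap)
    have xa3: "c x a3 = e" by (rule kite[of a1 a2 a3 b1 x]) (use N' d' ff b1 f' in auto)
    have ya3: "c y a3 = e" by (rule kite[of a1 a2 a3 b1 y]) (use N' d' ff b1 f' in auto)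
    have a2x: "c a2 x = e" by (rule kite[of b1 y x a1 a2]) (use N' d' ff' f' a1y sym[of y x] in auto)
    have "c y a2 = f"
      by (rule no_C4[of a2 x a3 y]) (use N' d' a2x xa3 ya3 sym[of a3 y] in auto)
    then have "c a2 y = f" using sym by metis
    then show False using sw.no_K4_list[of a1 a2 b1 y] N' d' ff ff' f' a1y N_Q(1) by auto
  qed
  have "c a1 b2 = e \<and> c a1 b3 = e"
  proof (rule ccontr)
    assume n: "\<not> ?thesis"
    have "c a1 b2 = e \<or> c a1 b2 = f" "c a1 b3 = e \<or> c a1 b3 = f"
      using nbr_col[of a1 b2] nbr_col[of a1 b3] N d by auto
    then consider "c a1 b2 = f" | "c a1 b3 = f" using n by blast
    then show False
    proof cases
      case 1
      show False by (rule main[of b3 b2]) (use N d ff ff' 1 in auto)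
    next
      case 2
      show False by (rule main[of b2 b3]) (use N d ff ff' 2 in auto)
    qed
  qed
  moreover have "c b2 a3 = e" by (rule kite[of a1 a2 a3 b1 b2]) (use N d ff ff' b1 in auto)
  moreover have "c b3 a3 = e" by (rule kite[of a1 a2 a3 b1 b3]) (use N d ff ff' b1 in auto)
  ultimately have "c b3 a1 = f"
    by (intro no_C4[of a1 b2 a3 b3]) (use N d sym[of a3 b3] in auto)
  then show False using \<open>c a1 b2 = e \<and> c a1 b3 = e\<close> ef sym by metis
qed

text \<open>\<open>N\<close> contains an \<open>f\<close>-triangle. The other three vertices form
  one as well, each sees at most one vertex of the first in \<open>f\<close>, and by
  \<open>no_C4\<close> no two share two \<open>e\<close>-neighbours. So the \<open>f\<close>-edges
  between the triangles are a perfect matching, which \<open>no_C6\<close> excludes.\<close>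

lemma contradiction: False
proof -
  have fN: "finite N" using finite_Q N_sub finite_subset by blast
  have "colored_by c {e, f} N" unfolding colored_by_def using col N_Q(1) by blast
  then obtain a1 a2 a3 where a: "a1 \<in> N" "a2 \<in> N" "a3 \<in> N" "a1 \<noteq> a2" "a2 \<noteq> a3" "a1 \<noteq> a3"
    "c a1 a2 = c a2 a3" "c a1 a3 = c a2 a3"
    using mono_triangle_of_six[OF fN, of e f] card_N by auto
  have "c a1 a2 \<noteq> e"
  proof
    assume "c a1 a2 = e"
    then have "c a1 a3 = f" using no_triangle[of a1 a2 a3] a by simp
    then show False using \<open>c a1 a2 = e\<close> a(7,8) ef by simp
  qed
  then have fa: "c a1 a2 = f" "c a1 a3 = f" "c a2 a3 = f" using nbr_col[OF a(1,2,4)] a(7,8) by simp_all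
  have fa': "c a2 a1 = f" "c a3 a1 = f" "c a3 a2 = f" using fa sym by metis+
  have "card (N - {a1, a2, a3}) = card N - card {a1, a2, a3}" using a by (intro card_Diff_subset) auto
  then have "card (N - {a1, a2, a3}) = 3" using card_N a by simp
  then obtain b1 b2 b3 where b: "N - {a1, a2, a3} = {b1, b2, b3}" "b1 \<noteq> b2" "b2 \<noteq> b3" "b1 \<noteq> b3"
    by (auto simp: card_3_iff)
  have N: "N = {a1, a2, a3} \<union> {b1, b2, b3}" and disj: "{a1, a2, a3} \<inter> {b1, b2, b3} = {}" using a b by blast+
  have ecol: "c x y = e \<or> c x y = f" if "x \<in> N" "y \<in> N" "x \<noteq> y" for x y
    using nbr_col[OF that] by blast
  have edge: False if B: "{x, y, z} = {b1, b2, b3}" "distinct [x, y, z]" "c x y = e"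
    and A: "{p, q, s} = {a1, a2, a3}" "distinct [p, q, s]" "c p q = f" "c p s = f" "c q s = f" "c x p = f" "c x q = f"
    for x y z p q s
  proof (rule edge_opposite_triangle[of p q s x y z])
    show "N = {p, q, s, x, y, z}" using N A(1) B(1) by blast
    have "{p, q, s} \<inter> {x, y, z} = {}" unfolding A(1) B(1) by (rule disj)
    then show "distinct [p, q, s, x, y, z]" using A(2) B(2) by auto
  qed (use A B in auto)
  \<comment> \<open>The ends of an \<open>e\<close>-edge \<open>x y\<close> have no common
    \<open>e\<close>-neighbour among \<open>a1\<close>, \<open>a2\<close>, \<open>a3\<close>, so one
    of them sees two of these in \<open>f\<close>.\<close>
  have edge2: "c x y = f" if B: "{x, y, z} = {b1, b2, b3}" "distinct [x, y, z]" for x y z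
  proof (rule ccontr)
    assume n: "c x y \<noteq> f"
    have xy: "x \<in> N" "y \<in> N" "x \<notin> {a1, a2, a3}" "y \<notin> {a1, a2, a3}" "x \<noteq> y"
      using B N disj by auto
    have xe: "c x y = e" "c y x = e" using n ecol[of x y] xy sym[of x y] by auto
    have B': "{y, x, z} = {b1, b2, b3}" "distinct [y, x, z]" using B by auto
    have "\<not> (c x u = e \<and> c y u = e)" if "u \<in> {a1, a2, a3}" for u
    proof
      assume *: "c x u = e \<and> c y u = e"
      have "c x u = f" by (rule no_triangle[of x y u]) (use xy xe * that a in auto)
      then show False using * ef by simp
    qed
    moreover have "c x u = e \<or> c x u = f" "c y u = e \<or> c y u = f" if "u \<in> {a1, a2, a3}" for u
      using ecol[of x u] ecol[of y u] xy that a by auto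
    ultimately consider "c x a1 = f" "c x a2 = f" | "c x a1 = f" "c x a3 = f" | "c x a2 = f" "c x a3 = f"
      | "c y a1 = f" "c y a2 = f" | "c y a1 = f" "c y a3 = f" | "c y a2 = f" "c y a3 = f"
      by (metis insertCI)
    then show False
    proof cases
      case 1 show False by (rule edge[OF B xe(1), of a1 a2 a3]) (use 1 a fa fa' in auto)
    next
      case 2 show False by (rule edge[OF B xe(1), of a1 a3 a2]) (use 2 a fa fa' in auto)
    next
      case 3 show False by (rule edge[OF B xe(1), of a2 a3 a1]) (use 3 a fa fa' in auto)
    next
      case 4 show False by (rule edge[OF B' xe(2), of a1 a2 a3]) (use 4 a fa fa' in auto)
    next
      case 5 show False by (rule edge[OF B' xe(2), of a1 a3 a2]) (use 5 a fa fa' in auto)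
    next
      case 6 show False by (rule edge[OF B' xe(2), of a2 a3 a1]) (use 6 a fa fa' in auto)
    qed
  qed
  have fb: "c b1 b2 = f" "c b1 b3 = f" "c b2 b3 = f"
    using edge2[of b1 b2 b3] edge2[of b1 b3 b2] edge2[of b2 b3 b1] b by auto
  have fb': "c b2 b1 = f" "c b3 b1 = f" "c b3 b2 = f" using fb sym by metis+
  have fA: "c x y = f" if "x \<in> {a1, a2, a3}" "y \<in> {a1, a2, a3}" "x \<noteq> y" for x y
    using that fa fa' by blast
  have fB: "c x y = f" if "x \<in> {b1, b2, b3}" "y \<in> {b1, b2, b3}" "x \<noteq> y" for x y
    using that fb fb' by blast
  have da: "distinct [a1, a2, a3]" and db: "distinct [b1, b2, b3]" using a b by auto
  have two: "\<not> (c x p = f \<and> c x q = f)" if xpq: "x \<in> {b1, b2, b3}" "p \<in> {a1, a2, a3}" "q \<in> {a1, a2, a3}" "p \<noteq> q" for x p q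
  proof
    assume *: "c x p = f \<and> c x q = f"
    obtain y where y: "y \<in> {b1, b2, b3}" "x \<noteq> y" using b(2) by blast
    obtain z where B: "{x, y, z} = {b1, b2, b3}" "distinct [x, y, z]"
      by (rule obtain_third[OF db xpq(1) y])
    obtain s where A: "{p, q, s} = {a1, a2, a3}" "distinct [p, q, s]"
      by (rule obtain_third[OF da xpq(2-4)])
    have "s \<in> {a1, a2, a3}" "z \<in> {b1, b2, b3}" using A(1) B(1) by blast+
    then have ff: "c p q = f" "c p s = f" "c q s = f" "c x y = f" "c x z = f" "c y z = f"
      using fA fB A(2) B(2) that(1-3) y(1) by auto
    show False
    proof (rule two_f_opposite_triangle[of p q s x y z])
      show "N = {p, q, s, x, y, z}" using N A(1) B(1) by blast
      have "{p, q, s} \<inter> {x, y, z} = {}" unfolding A(1) B(1) by (rule disj)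
      then show "distinct [p, q, s, x, y, z]" using A(2) B(2) by auto
    qed (use ff * in auto)
  qed
  have C4: "\<not> (c x p = e \<and> c x q = e \<and> c y p = e \<and> c y q = e)"
    if "x \<in> {b1, b2, b3}" "y \<in> {b1, b2, b3}" "x \<noteq> y" "p \<in> {a1, a2, a3}" "q \<in> {a1, a2, a3}" "p \<noteq> q" for x y p q
  proof
    assume *: "c x p = e \<and> c x q = e \<and> c y p = e \<and> c y q = e"
    have "c q x = f"
      by (rule no_C4[of x p y q]) (use that N disj * sym[of p y] in auto)
    then show False using * ef sym[of x q] by simp
  qed
  have dec0: "c x u = e \<or> c x u = f" if "x \<in> {b1, b2, b3}" "u \<in> {a1, a2, a3}" for x u
    using ecol[of x u] that N disj by blast
  have C6: False if pqs: "{p, q, s} = {a1, a2, a3}" "distinct [p, q, s]" "c b1 p = f" "c b2 q = f" "c b3 s = f"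
    for p q s
  proof (rule no_C6[of p q s b1 b2 b3])
    show "N = {p, q, s, b1, b2, b3}" using N pqs(1) by blast
    have "{p, q, s} \<inter> {b1, b2, b3} = {}" unfolding pqs(1) by (rule disj)
    then show "distinct [p, q, s, b1, b2, b3]" using pqs(2) db by auto
    have m: "p \<in> {a1, a2, a3}" "q \<in> {a1, a2, a3}" "s \<in> {a1, a2, a3}" using pqs(1) by blast+
    have n: "p \<noteq> q" "p \<noteq> s" "q \<noteq> s" using pqs(2) by auto
    have E: "c u x = e" if "x \<in> {b1, b2, b3}" "u \<in> {a1, a2, a3}" "c x u' = f" "u' \<in> {a1, a2, a3}" "u' \<noteq> u" for x u u'
      using two[OF that(1,4,2,5)] dec0[OF that(1,2)] that(3) sym[of u x] by auto
    show "c p b2 = e" using E[OF _ m(1) pqs(4) m(2)] n by blast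
    show "c p b3 = e" using E[OF _ m(1) pqs(5) m(3)] n by blast
    show "c q b1 = e" using E[OF _ m(2) pqs(3) m(1)] n by blast
    show "c q b3 = e" using E[OF _ m(2) pqs(5) m(3)] n by blast
    show "c s b1 = e" using E[OF _ m(3) pqs(3) m(1)] n by blast
    show "c s b2 = e" using E[OF _ m(3) pqs(4) m(2)] n by blast
    show "c p q = f" "c p s = f" "c q s = f" using fA m n by blast+
    show "c p b1 = f" "c q b2 = f" "c s b3 = f" using pqs(3-5) sym[of p b1] sym[of q b2] sym[of s b3] by simp_all
  qed (rule fb)+
  have dec: "c b1 a1 = e \<or> c b1 a1 = f" "c b1 a2 = e \<or> c b1 a2 = f" "c b1 a3 = e \<or> c b1 a3 = f"
    "c b2 a1 = e \<or> c b2 a1 = f" "c b2 a2 = e \<or> c b2 a2 = f" "c b2 a3 = e \<or> c b2 a3 = f"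
    "c b3 a1 = e \<or> c b3 a1 = f" "c b3 a2 = e \<or> c b3 a2 = f" "c b3 a3 = e \<or> c b3 a3 = f"
    by (rule dec0; simp)+
  have two': "\<not> (c b1 a1 = f \<and> c b1 a2 = f)" "\<not> (c b1 a1 = f \<and> c b1 a3 = f)" "\<not> (c b1 a2 = f \<and> c b1 a3 = f)"
    "\<not> (c b2 a1 = f \<and> c b2 a2 = f)" "\<not> (c b2 a1 = f \<and> c b2 a3 = f)" "\<not> (c b2 a2 = f \<and> c b2 a3 = f)"
    "\<not> (c b3 a1 = f \<and> c b3 a2 = f)" "\<not> (c b3 a1 = f \<and> c b3 a3 = f)" "\<not> (c b3 a2 = f \<and> c b3 a3 = f)"
    by (rule two; use a in auto)+
  have C4': "\<not> (c b1 a1 = e \<and> c b1 a2 = e \<and> c b2 a1 = e \<and> c b2 a2 = e)"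
    "\<not> (c b1 a1 = e \<and> c b1 a3 = e \<and> c b2 a1 = e \<and> c b2 a3 = e)"
    "\<not> (c b1 a2 = e \<and> c b1 a3 = e \<and> c b2 a2 = e \<and> c b2 a3 = e)"
    "\<not> (c b1 a1 = e \<and> c b1 a2 = e \<and> c b3 a1 = e \<and> c b3 a2 = e)"
    "\<not> (c b1 a1 = e \<and> c b1 a3 = e \<and> c b3 a1 = e \<and> c b3 a3 = e)"
    "\<not> (c b1 a2 = e \<and> c b1 a3 = e \<and> c b3 a2 = e \<and> c b3 a3 = e)"
    "\<not> (c b2 a1 = e \<and> c b2 a2 = e \<and> c b3 a1 = e \<and> c b3 a2 = e)"
    "\<not> (c b2 a1 = e \<and> c b2 a3 = e \<and> c b3 a1 = e \<and> c b3 a3 = e)"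
    "\<not> (c b2 a2 = e \<and> c b2 a3 = e \<and> c b3 a2 = e \<and> c b3 a3 = e)"
    by (rule C4; use a b in auto)+
  have C6': "\<not> (c b1 a1 = f \<and> c b2 a2 = f \<and> c b3 a3 = f)" "\<not> (c b1 a1 = f \<and> c b2 a3 = f \<and> c b3 a2 = f)"
    "\<not> (c b1 a2 = f \<and> c b2 a1 = f \<and> c b3 a3 = f)" "\<not> (c b1 a2 = f \<and> c b2 a3 = f \<and> c b3 a1 = f)"
    "\<not> (c b1 a3 = f \<and> c b2 a1 = f \<and> c b3 a2 = f)" "\<not> (c b1 a3 = f \<and> c b2 a2 = f \<and> c b3 a1 = f)"
    using C6[of a1 a2 a3] C6[of a1 a3 a2] C6[of a2 a1 a3] C6[of a2 a3 a1] C6[of a3 a1 a2] C6[of a3 a2 a1] a by auto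
  show False
    using dec two' C4' C6' by sat
qed

end

text \<open>There is no 5-regular graph on eleven vertices, so some vertex has six neighbours in one colour.\<close>

lemma (in sym_coloring) ramsey_H11:
  assumes "finite Q" "card Q = 11" "colored_by c {i, j} Q" "i \<noteq> j"
  shows "mono_copy_in H11 c Q"
proof (rule ccontr)
  assume no: "\<not> ?thesis"
  have free: "H11_free c Q i j" "H11_free c Q j i"
    using assms no colored_byD[OF assms(3)] by unfold_locales auto
  have deg: "card {y \<in> Q. y \<noteq> x \<and> c x y = i} + card {y \<in> Q. y \<noteq> x \<and> c x y = j} = 10" if "x \<in> Q" for x
  proof -
    have "card {y \<in> Q. y \<noteq> x \<and> c x y = i} + card {y \<in> Q. y \<noteq> x \<and> c x y = j}
        = card ({y \<in> Q. y \<noteq> x \<and> c x y = i} \<union> {y \<in> Q. y \<noteq> x \<and> c x y = j})"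
      using assms(1,4) by (intro card_Un_disjoint[symmetric]) auto
    also have "{y \<in> Q. y \<noteq> x \<and> c x y = i} \<union> {y \<in> Q. y \<noteq> x \<and> c x y = j} = Q - {x}"
      using assms(3) that by (auto simp: colored_by_def)
    finally show ?thesis using assms(1,2) that by simp
  qed
  have six: "\<exists>x\<in>Q. \<exists>e\<in>{i, j}. 6 \<le> card {y \<in> Q. y \<noteq> x \<and> c x y = e}"
  proof (rule ccontr)
    assume "\<not> ?thesis"
    then have "card {y \<in> Q. y \<noteq> x \<and> c x y = i} = 5" if "x \<in> Q" for x
      using deg[OF that] that by fastforce
    then have "(\<Sum>x\<in>Q. card {y \<in> Q. y \<noteq> x \<and> c x y = i}) = 55" using assms(2) by simp
    moreover have "even (\<Sum>x\<in>Q. card {y \<in> Q. y \<noteq> x \<and> c x y = i})"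
      by (rule even_sum_degrees[OF assms(1)]) (simp add: sym)
    ultimately show False by simp
  qed
  then obtain x e where x: "x \<in> Q" "e \<in> {i, j}" "6 \<le> card {y \<in> Q. y \<noteq> x \<and> c x y = e}" by blast
  then obtain N where N: "N \<subseteq> {y \<in> Q. y \<noteq> x \<and> c x y = e}" "card N = 6"
    by (meson obtain_subset_with_card_n)
  obtain g where "H11_free c Q e g" using free x(2) by blast
  then interpret H11_free c Q e g .
  interpret H11_free_nbrs c Q e g x N
    by unfold_locales (use x(1) N in auto)
  show False by (rule contradiction)
qed

section \<open>Triangles and \<open>H10\<close>\<close>

text \<open>The largest number of vertices without rainbow or monochromatic triangle, by
  \<open>triangle_free_bound\<close> and \<open>avoidable_K3\<close>.\<close>

fun tri_val :: "nat \<Rightarrow> nat" where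
  "tri_val 0 = 1"
| "tri_val (Suc 0) = 2"
| "tri_val (Suc (Suc k)) = 5 * tri_val k"

lemma tri_val_double: "2 * tri_val k \<le> tri_val (Suc k)"
  by (induction k rule: tri_val.induct) auto

lemma tri_val_pos: "1 \<le> tri_val k"
  by (induction k rule: tri_val.induct) auto

text \<open>For one and two colours, colourings built on a monochromatic \<open>K4\<close>, which is
  too small for \<open>H10\<close>, beat the triangle-free ones.\<close>

definition h10_val :: "nat \<Rightarrow> nat" where
  "h10_val k = (if k = 1 then 4 else if k = 2 then 6 else tri_val k)"

definition has_triangle :: "('a \<Rightarrow> 'a \<Rightarrow> nat) \<Rightarrow> 'a set \<Rightarrow> bool" where
  "has_triangle c X \<longleftrightarrow> (\<exists>x\<in>X. \<exists>y\<in>X. \<exists>z\<in>X. x \<noteq> y \<and> y \<noteq> z \<and> x \<noteq> z \<and> c x y = c y z \<and> c x z = c y z)"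

lemma has_triangle_mono: "has_triangle c X \<Longrightarrow> X \<subseteq> Y \<Longrightarrow> has_triangle c Y"
  unfolding has_triangle_def by blast

lemma has_triangleI:
  assumes "x \<in> X" "y \<in> X" "z \<in> X" "x \<noteq> y" "y \<noteq> z" "x \<noteq> z" "c x y = e" "c y z = e" "c x z = e"
  shows "has_triangle c X"
  unfolding has_triangle_def using assms by (intro bexI[of _ x] bexI[of _ y] bexI[of _ z]) simp_all

context sym_coloring
begin

lemma joined_avoids_triangle_free:
  assumes "\<not> has_triangle c X" "A \<subseteq> X" "b \<in> X - A" "\<And>a. a \<in> A \<Longrightarrow> c a b = e"
  shows "avoids c e A"
  unfolding avoids_def
proof (intro ballI impI notI)
  fix x y assume xy: "x \<in> A" "y \<in> A" "x \<noteq> y" "c x y = e"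
  have "has_triangle c X"
    by (rule has_triangleI[of x X y b c e]) (use xy assms in auto)
  then show False using assms(1) by blast
qed

lemma colored_by_avoid: "colored_by c D X \<Longrightarrow> A \<subseteq> X \<Longrightarrow> avoids c e A \<Longrightarrow> colored_by c (D - {e}) A"
  unfolding colored_by_def avoids_def by blast

text \<open>If some part sees everything else in one colour, the part and its complement both avoid
  it, and \<open>tri_val_double\<close> suffices. Otherwise every part avoids both colours, and
  R(3,3) <= 6 leaves at most five parts.\<close>

theorem triangle_free_bound:
  assumes "finite X" "rainbow_free c X" "finite D" "colored_by c D X" "\<not> has_triangle c X"
  shows "card X \<le> tri_val (card D)"
  using assms
proof (induction "card D" arbitrary: X D rule: less_induct)
  case less
  consider "card X \<le> 1" | "2 \<le> card X" "card D = 0" | "2 \<le> card X" "card D = 1" | "2 \<le> card X" "2 \<le> card D" by linarith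
  then show ?case
  proof cases
    case 1
    then show ?thesis using tri_val_pos[of "card D"] by linarith
  next
    case 2
    obtain x y where "x \<in> X" "y \<in> X" "x \<noteq> y" using 2(1) by (rule obtain_two)
    then show ?thesis using 2(2) less.prems(3) colored_byD[OF less.prems(4)] by fastforce
  next
    case 3
    then obtain e where e: "D = {e}" by (meson card_1_singletonE)
    show ?thesis
    proof (rule ccontr)
      assume "\<not> ?thesis"
      then have "3 \<le> card X" using 3(2) by simp
      then obtain x y z where "x \<in> X" "y \<in> X" "z \<in> X" "x \<noteq> y" "y \<noteq> z" "x \<noteq> z" by (rule obtain_three)
      then have "has_triangle c X"
        using colored_byD[OF less.prems(4)] e by (intro has_triangleI[of x X y z c e]) auto
      then show False using less.prems(5) by blast
    qed
  next
    case 4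
    show ?thesis
    proof (rule gallai_partition[OF less.prems(1) 4(1) less.prems(2,4) 4(2)])
      fix \<pi> :: "'a \<Rightarrow> 'a" and i j
      assume p: "i \<in> D" "j \<in> D" "i \<noteq> j" "\<exists>x\<in>X. \<exists>y\<in>X. \<pi> x \<noteq> \<pi> y"
        "\<And>x y. x \<in> X \<Longrightarrow> y \<in> X \<Longrightarrow> \<pi> x \<noteq> \<pi> y \<Longrightarrow> c x y \<in> {i, j}"
        "\<And>x x' y. x \<in> X \<Longrightarrow> x' \<in> X \<Longrightarrow> y \<in> X \<Longrightarrow> \<pi> x = \<pi> x' \<Longrightarrow> \<pi> x \<noteq> \<pi> y \<Longrightarrow> c x y = c x' y"
      have sub: "card A \<le> tri_val (card (D - E))" if "A \<subseteq> X" "E \<subseteq> D" "E \<noteq> {}" "colored_by c (D - E) A" for A E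
      proof (rule less.hyps)
        show "card (D - E) < card D" using that(2,3) less.prems(3) by (intro psubset_card_mono) auto
        show "finite A" "finite (D - E)" using that(1) less.prems(1,3) finite_subset by auto
        show "rainbow_free c A" using rainbow_free_subset less.prems(2) that(1) by blast
        show "\<not> has_triangle c A" using has_triangle_mono less.prems(5) that(1) by blast
      qed (rule that(4))
      let ?P = "\<lambda>x. {y \<in> X. \<pi> y = \<pi> x}"
      show "card X \<le> tri_val (card D)"
      proof (cases "\<exists>x\<in>X. \<exists>e\<in>{i, j}. \<forall>y\<in>X. \<pi> y \<noteq> \<pi> x \<longrightarrow> c x y = e")
        case True
        then obtain x e where x: "x \<in> X" "e \<in> {i, j}" "\<And>y. y \<in> X \<Longrightarrow> \<pi> y \<noteq> \<pi> x \<Longrightarrow> c x y = e" by blast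
        obtain b where b: "b \<in> X" "\<pi> b \<noteq> \<pi> x" using p(4) by metis
        let ?B = "X - ?P x"
        have "avoids c e (?P x)"
        proof (rule joined_avoids_triangle_free[OF less.prems(5), of _ b])
          fix a assume "a \<in> ?P x"
          then show "c a b = e" using p(6)[of x a b] x b by simp
        qed (use b in auto)
        then have "colored_by c (D - {e}) (?P x)"
          using colored_by_avoid[OF less.prems(4), of "?P x"] by blast
        then have "card (?P x) \<le> tri_val (card (D - {e}))" using x(2) p(1,2) by (intro sub) auto
        moreover have "avoids c e ?B"
        proof (rule joined_avoids_triangle_free[OF less.prems(5), of _ x])
          fix a assume "a \<in> ?B"
          then show "c a x = e" using x(3)[of a] sym[of a x] by simp
        qed (use x in auto)
        then have "colored_by c (D - {e}) ?B"
          using colored_by_avoid[OF less.prems(4), of ?B] by blast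
        then have "card ?B \<le> tri_val (card (D - {e}))" using x(2) p(1,2) by (intro sub) auto
        moreover have "card X = card (?P x) + card ?B"
          using less.prems(1) card_Diff_subset[of "?P x" X] card_mono[of X "?P x"] by simp
        moreover have "card D = Suc (card (D - {e}))"
          using x(2) p(1,2) less.prems(3) by (metis card.remove insertE singletonD)
        ultimately show ?thesis using tri_val_double[of "card (D - {e})"] by simp
      next
        case False
        have both: "\<exists>y\<in>X. \<pi> y \<noteq> \<pi> x \<and> c x y = e" if x: "x \<in> X" and e: "e \<in> {i, j}" for x e
        proof -
          define e' where "e' = (if e = i then j else i)"
          have e': "e' \<in> {i, j}" "\<And>d. d \<in> {i, j} \<Longrightarrow> d \<noteq> e' \<Longrightarrow> d = e"
            using e by (auto simp: e'_def split: if_splits)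
          obtain y where y: "y \<in> X" "\<pi> y \<noteq> \<pi> x" "c x y \<noteq> e'" using False x e'(1) by blast
          then have "c x y = e" using p(5)[of x y] x e'(2) by simp
          then show ?thesis using y by blast
        qed
        have part: "card (?P x) \<le> tri_val (card (D - {i, j}))" if x: "x \<in> X" for x
        proof (rule sub)
          have av: "avoids c e (?P x)" if e: "e \<in> {i, j}" for e
          proof -
            obtain y where y: "y \<in> X" "\<pi> y \<noteq> \<pi> x" "c x y = e" using both[OF x e] by blast
            show ?thesis
            proof (rule joined_avoids_triangle_free[OF less.prems(5), of _ y])
              fix a assume "a \<in> ?P x"
              then show "c a y = e" using p(6)[of x a y] x y by simp
            qed (use y in auto)
          qed
          have "colored_by c (D - {i}) (?P x)"
            by (rule colored_by_avoid[OF less.prems(4) _ av]) auto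
          then have "colored_by c (D - {i} - {j}) (?P x)"
            by (rule colored_by_avoid[OF _ order_refl av]) simp
          moreover have "D - {i} - {j} = D - {i, j}" by blast
          ultimately show "colored_by c (D - {i, j}) (?P x)" by (simp only:)
        qed (use p(1,2) in blast)+
        obtain R where R: "R \<subseteq> X" "inj_on \<pi> R" "\<pi> ` R = \<pi> ` X" by (rule inj_reps)
        have fR: "finite R" using R(1) less.prems(1) finite_subset by blast
        have "card R \<le> 5"
        proof (rule ccontr)
          assume "\<not> ?thesis"
          moreover have "colored_by c {i, j} R"
            unfolding colored_by_def
          proof (intro ballI impI)
            fix x y assume xy: "x \<in> R" "y \<in> R" "x \<noteq> y"
            then have "\<pi> x \<noteq> \<pi> y" using R(2) by (auto dest: inj_onD)
            then show "c x y \<in> {i, j}" using xy R(1) by (intro p(5)) auto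
          qed
          ultimately have "has_triangle c R"
            using mono_triangle_of_six[OF fR, of i j] unfolding has_triangle_def by auto
          then show False using has_triangle_mono R(1) less.prems(5) by blast
        qed
        have "X = (\<Union>q\<in>R. ?P q)"
        proof (intro equalityI subsetI)
          fix x assume x: "x \<in> X"
          then have "\<pi> x \<in> \<pi> ` R" using R(3) by simp
          then show "x \<in> (\<Union>q\<in>R. ?P q)" using x by auto
        qed blast
        then have "card X \<le> (\<Sum>q\<in>R. card (?P q))" using card_UN_le[OF fR, of ?P] by simp
        also have "\<dots> \<le> (\<Sum>q\<in>R. tri_val (card (D - {i, j})))" using part R(1) by (intro sum_mono) blast
        also have "\<dots> \<le> 5 * tri_val (card (D - {i, j}))" using \<open>card R \<le> 5\<close> by simp
        also have "card D = Suc (Suc (card (D - {i, j})))"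
        proof -
          have "card (D - {i, j}) = card D - card {i, j}" using p(1,2) by (intro card_Diff_subset) auto
          then show ?thesis using p(3) 4(2) by simp
        qed
        then have "5 * tri_val (card (D - {i, j})) = tri_val (card D)" by simp
        finally show ?thesis .
      qed
    qed
  qed
qed

text \<open>Outside a triangle of colour \<open>e\<close> there is no \<open>e\<close>-edge, so
  three vertices are traded for one colour. This is good enough except for two colours, where 3 + 4
  exceeds 6 by one.\<close>

lemma H10_free_bound:
  assumes "finite X" "rainbow_free c X" "finite D" "colored_by c D X" "\<not> mono_copy_in H10 c X"
  shows "card X \<le> h10_val (card D)"
  using assms
proof (induction "card D" arbitrary: X D rule: less_induct)
  case less
  have copy: False if "distinct [x, y, z, u, w]" "{x, y, z, u, w} \<subseteq> X" "c x y = e" "c y z = e" "c x z = e" "c u w = e"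
    for x y z u w e
    using H10_copyI[of x y u w z X e] that less.prems(5) by auto
  show ?case
  proof (cases "has_triangle c X")
    case False
    then have "card X \<le> tri_val (card D)" using triangle_free_bound less.prems by blast
    also have "\<dots> \<le> h10_val (card D)" by (simp add: h10_val_def numeral_2_eq_2)
    finally show ?thesis .
  next
    case True
    then obtain x y z where t: "x \<in> X" "y \<in> X" "z \<in> X" "x \<noteq> y" "y \<noteq> z" "x \<noteq> z" "c x y = c y z" "c x z = c y z"
      unfolding has_triangle_def by blast
    define e where "e = c y z"
    note t = t[folded e_def]
    have eD: "e \<in> D" unfolding e_def by (rule colored_byD[OF less.prems(4) t(2,3,5)])
    have e: "c y z = e" by (simp add: e_def)
    let ?Y = "X - {x, y, z}"
    have "avoids c e ?Y"
      unfolding avoids_def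
    proof (intro ballI impI notI)
      fix u w assume "u \<in> ?Y" "w \<in> ?Y" "u \<noteq> w" "c u w = e"
      then show False using copy[of x y z u w e] t e by auto
    qed
    then have col: "colored_by c (D - {e}) ?Y" using colored_by_avoid[OF less.prems(4), of ?Y e] by blast
    have cD: "card D = Suc (card (D - {e}))" using eD less.prems(3) by (metis card.remove)
    have Y: "card ?Y \<le> h10_val (card (D - {e}))"
    proof (rule less.hyps[OF _ _ _ _ col])
      show "card (D - {e}) < card D" using cD by simp
      show "finite ?Y" "finite (D - {e})" using less.prems(1,3) by auto
      show "rainbow_free c ?Y" using rainbow_free_subset less.prems(2) by blast
      show "\<not> mono_copy_in H10 c ?Y" using mono_copy_in_mono[of H10 c ?Y X] less.prems(5) by blast
    qed
    have "card ?Y = card X - card {x, y, z}" using t by (intro card_Diff_subset) auto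
    then have cX: "card X \<le> card ?Y + 3" using t by simp
    consider "card D = 1" | "card D = 2" | "card D = 3" | "4 \<le> card D" using cD by linarith
    then show ?thesis
    proof cases
      case 1
      then show ?thesis using cX Y cD by (simp add: h10_val_def)
    next
      case 2
      then have "card (D - {e}) = 1" using cD by simp
      then obtain f where f: "D - {e} = {f}" by (rule card_1_singletonE)
      then have De: "D = {e, f}" using eD by blast
      have Yf: "c u w = f" if "u \<in> ?Y" "w \<in> ?Y" "u \<noteq> w" for u w
        using colored_byD[OF col that] f by simp
      \<comment> \<open>Four vertices of \<open>?Y\<close> form a \<open>K4\<close> in colour
        \<open>f\<close>. An \<open>f\<close>-edge from the triangle to \<open>p\<close> or
        \<open>q\<close> completes \<open>H10\<close> in \<open>f\<close>; if there is none, the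
        triangle \<open>x\<close>, \<open>y\<close>, \<open>p\<close> and the edge
        \<open>z q\<close> are \<open>H10\<close> in \<open>e\<close>.\<close>
      have "card ?Y \<le> 3"
      proof (rule ccontr)
        assume "\<not> ?thesis"
        then have "4 \<le> card ?Y" by simp
        then obtain xs where xs: "distinct xs" "set xs \<subseteq> ?Y" "length xs = 4"
          using obtain_distinct_list[of ?Y 4] less.prems(1) by blast
        then obtain p q s u where "xs = [p, q, s, u]" by (auto simp: numeral_eq_Suc length_Suc_conv)
        then have d: "distinct [p, q, s, u]" and "{p, q, s, u} \<subseteq> ?Y" using xs by auto
        then have m: "p \<in> ?Y" "q \<in> ?Y" "s \<in> ?Y" "u \<in> ?Y" by auto
        have cross: "c a b = e" if a: "a \<in> {x, y, z}" and b: "b \<in> {p, q}" for a b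
        proof (rule ccontr)
          assume n: "c a b \<noteq> e"
          have ab: "a \<in> X" "b \<in> X" "a \<noteq> b" using a b m t by auto
          then have abf: "c a b = f" using n colored_byD[OF less.prems(4), of a b] De by auto
          obtain b' where b': "b' \<in> {p, q}" "b' \<noteq> b" using b d by auto
          show False
            by (rule copy[of b' s u a b f]) (use a b b' d m t abf Yf in auto)
        qed
        have "c y p = e" "c x p = e" "c z q = e" by (rule cross; simp)+
        then show False
          using copy[of x y p z q e] t m d by auto
      qed
      then show ?thesis using cX 2 by (simp add: h10_val_def)
    next
      case 3
      then have "h10_val (card (D - {e})) = 6" "h10_val (card D) = 10"
        using cD by (simp_all add: h10_val_def numeral_3_eq_3)
      then show ?thesis using cX Y by simp
    next
      case 4
      then obtain m where "card D = 4 + m" by (metis le_Suc_ex)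
      then have m: "card D = Suc (Suc (Suc (Suc m)))" by simp
      then have "card (D - {e}) = Suc (Suc (Suc m))" using cD by simp
      then have "h10_val (card (D - {e})) = tri_val (Suc (Suc (Suc m)))" "h10_val (card D) = tri_val (Suc (Suc (Suc (Suc m))))"
        using m by (simp_all add: h10_val_def)
      moreover have "5 \<le> tri_val (Suc (Suc (Suc m)))" using tri_val_pos[of "Suc m"] by simp
      ultimately show ?thesis using cX Y tri_val_double[of "Suc (Suc (Suc m))"] by linarith
    qed
  qed
qed

end

section \<open>From colourings to Gallai-Ramsey numbers\<close>

definition avoidable :: "nat ugraph \<Rightarrow> nat \<Rightarrow> nat \<Rightarrow> bool" where
  "avoidable H k n \<longleftrightarrow> (\<exists>c :: nat \<Rightarrow> nat \<Rightarrow> nat. (\<forall>x y. c x y = c y x) \<and> rainbow_free c {1..n} \<and>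
     colored_by c {1..k} {1..n} \<and> \<not> mono_copy_in H c {1..n})"

lemma simple_graph_edge:
  assumes "simple_graph H" "{x, y} \<in> uedges H"
  shows "x \<in> uverts H" "y \<in> uverts H" "x \<noteq> y"
proof -
  have "{x, y} \<subseteq> uverts H" "card {x, y} = 2" using assms unfolding simple_graph_def by blast+
  then show "x \<in> uverts H" "y \<in> uverts H" "x \<noteq> y" by auto
qed

text \<open>Vertices and colours are renumbered along bijections, so that constructions may use any
  finite sets, such as pairs for substitutions.\<close>

lemma avoidableI:
  fixes c :: "'a \<Rightarrow> 'a \<Rightarrow> nat"
  assumes H: "simple_graph H" and sym: "\<And>x y. c x y = c y x" and V: "finite V" "card V = n"
    and C: "finite C" "card C = k" and rf: "rainbow_free c V" and col: "colored_by c C V"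
    and no: "\<not> mono_copy_in H c V"
  shows "avoidable H k n"
proof -
  have cards: "card {1..n} = card V" "card C = card {1..k}" using V C by simp_all
  obtain h where h: "bij_betw h {1..n} V"
    using finite_same_card_bij[OF finite_atLeastAtMost V(1) cards(1)] by blast
  obtain \<phi> where \<phi>: "bij_betw \<phi> C {1..k}"
    using finite_same_card_bij[OF C(1) finite_atLeastAtMost cards(2)] by blast
  then have inj: "inj_on \<phi> C" and im: "\<phi> ` C = {1..k}" unfolding bij_betw_def by blast+
  have hV: "h x \<in> V" if "x \<in> {1..n}" for x using h that unfolding bij_betw_def by blast
  have hinj: "h x \<noteq> h y" if "x \<in> {1..n}" "y \<in> {1..n}" "x \<noteq> y" for x y
    using h that unfolding bij_betw_def inj_on_def by blast
  have cC: "c (h x) (h y) \<in> C" if "x \<in> {1..n}" "y \<in> {1..n}" "x \<noteq> y" for x y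
    by (rule colored_byD[OF col hV hV hinj]) (use that in auto)
  define c' where "c' x y = \<phi> (c (h x) (h y))" for x y
  show ?thesis
    unfolding avoidable_def
  proof (intro exI[of _ c'] conjI allI)
    show "c' x y = c' y x" for x y by (simp add: c'_def sym)
    show "rainbow_free c' {1..n}"
      unfolding rainbow_free_def
    proof (intro ballI impI)
      fix x y z assume xyz: "x \<in> {1..n}" "y \<in> {1..n}" "z \<in> {1..n}" "x \<noteq> y \<and> y \<noteq> z \<and> x \<noteq> z"
      then have "c (h x) (h y) = c (h y) (h z) \<or> c (h y) (h z) = c (h x) (h z) \<or> c (h x) (h y) = c (h x) (h z)"
        by (intro rainbow_freeD[OF rf] hV hinj) auto
      then show "c' x y = c' y z \<or> c' y z = c' x z \<or> c' x y = c' x z" unfolding c'_def by metis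
    qed
    show "colored_by c' {1..k} {1..n}"
      unfolding colored_by_def c'_def using cC im by blast
    show "\<not> mono_copy_in H c' {1..n}"
    proof
      assume "mono_copy_in H c' {1..n}"
      then obtain g e where g: "inj_on g (uverts H)" "g ` uverts H \<subseteq> {1..n}"
        "\<And>x y. {x, y} \<in> uedges H \<Longrightarrow> c' (g x) (g y) = e"
        unfolding mono_copy_in_def by blast
      have gn: "g x \<in> {1..n}" if "x \<in> uverts H" for x using g(2) that by blast
      have "mono_copy_in H c V"
        unfolding mono_copy_in_def
      proof (intro exI[of _ "h \<circ> g"] exI[of _ "inv_into C \<phi> e"] conjI allI impI)
        show "inj_on (h \<circ> g) (uverts H)"
        proof (rule inj_onI, rule ccontr)
          fix x y assume "x \<in> uverts H" "y \<in> uverts H" "(h \<circ> g) x = (h \<circ> g) y" "x \<noteq> y"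
          then show False using hinj[of "g x" "g y"] gn inj_onD[OF g(1), of x y] by auto
        qed
        show "(h \<circ> g) ` uverts H \<subseteq> V" using gn hV by auto
        fix x y assume xy: "{x, y} \<in> uedges H"
        have "g x \<noteq> g y" "g x \<in> {1..n}" "g y \<in> {1..n}"
          using simple_graph_edge[OF H xy] inj_onD[OF g(1)] gn by blast+
        then have "c (h (g x)) (h (g y)) \<in> C" by (intro cC)
        then have "inv_into C \<phi> (c' (g x) (g y)) = c (h (g x)) (h (g y))"
          unfolding c'_def by (rule inv_into_f_f[OF inj])
        then show "c ((h \<circ> g) x) ((h \<circ> g) y) = inv_into C \<phi> e"
          using g(3)[OF xy] by simp
      qed
      then show False using no by blast
    qed
  qed
qed

lemma avoidable_mono:
  assumes "avoidable H k n" "m \<le> n"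
  shows "avoidable H k m"
proof -
  obtain c where c: "\<forall>x y. c x y = c y x" "rainbow_free c {1..n}" "colored_by c {1..k} {1..n}"
    "\<not> mono_copy_in H c {1..n}"
    using assms(1) unfolding avoidable_def by blast
  have sub: "{1..m} \<subseteq> {1..n}" using assms(2) by auto
  have "\<not> mono_copy_in H c {1..m}" using mono_copy_in_mono[OF _ sub] c(4) by blast
  then show ?thesis
    unfolding avoidable_def
    using c(1) rainbow_free_subset[OF c(2) sub] colored_by_subset[OF c(3) sub order_refl] by blast
qed

lemma has_mono_copy_iff:
  assumes H: "simple_graph H"
  shows "has_mono_copy H n col \<longleftrightarrow> mono_copy_in H (\<lambda>x y. col {x, y}) {1..n}"
proof
  assume "has_mono_copy H n col"
  then obtain G f i where G: "is_subgraph G (complete_graph n)" "bij_betw f (uverts H) (uverts G)"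
    "\<forall>x\<in>uverts H. \<forall>y\<in>uverts H. {x, y} \<in> uedges H \<longleftrightarrow> {f x, f y} \<in> uedges G" "\<forall>e\<in>uedges G. col e = i"
    unfolding has_mono_copy_def isomorphic_def by blast
  show "mono_copy_in H (\<lambda>x y. col {x, y}) {1..n}"
    unfolding mono_copy_in_def
  proof (intro exI[of _ f] exI[of _ i] conjI allI impI)
    show "inj_on f (uverts H)" using G(2) by (simp add: bij_betw_def)
    show "f ` uverts H \<subseteq> {1..n}" using G(1,2) by (simp add: bij_betw_def is_subgraph_def complete_graph_def)
    fix x y assume "{x, y} \<in> uedges H"
    then show "col {f x, f y} = i" using simple_graph_edge[OF H, of x y] G(3,4) by blast
  qed
next
  assume "mono_copy_in H (\<lambda>x y. col {x, y}) {1..n}"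
  then obtain g i where g: "inj_on g (uverts H)" "g ` uverts H \<subseteq> {1..n}"
    "\<And>x y. {x, y} \<in> uedges H \<Longrightarrow> col {g x, g y} = i"
    unfolding mono_copy_in_def by blast
  define G where "G = \<lparr>uverts = g ` uverts H, uedges = (`) g ` uedges H\<rparr>"
  have sub: "E \<subseteq> uverts H" "card E = 2" if "E \<in> uedges H" for E
    using H that unfolding simple_graph_def by blast+
  have card: "card (g ` E) = 2" if "E \<in> uedges H" for E
    using sub[OF that] g(1) by (metis card_image inj_on_subset)
  have "simple_graph G"
    using H sub(1) card unfolding simple_graph_def G_def by auto
  moreover have "uverts G \<subseteq> uverts (complete_graph n)" using g(2) by (simp add: G_def complete_graph_def)
  moreover have "uedges G \<subseteq> uedges (complete_graph n)"
    using g(2) sub(1) card unfolding G_def complete_graph_def by fastforce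
  ultimately have "is_subgraph G (complete_graph n)" by (simp add: is_subgraph_def)
  moreover have "isomorphic H G"
    unfolding isomorphic_def
  proof (intro exI[of _ g] conjI ballI)
    show "bij_betw g (uverts H) (uverts G)" using g(1) by (simp add: bij_betw_def G_def)
    fix x y assume xy: "x \<in> uverts H" "y \<in> uverts H"
    show "{x, y} \<in> uedges H \<longleftrightarrow> {g x, g y} \<in> uedges G"
    proof
      assume "{x, y} \<in> uedges H"
      then have "g ` {x, y} \<in> (`) g ` uedges H" by (rule imageI)
      then have "g ` {x, y} \<in> uedges G" by (simp only: G_def ugraph.simps)
      then show "{g x, g y} \<in> uedges G" by simp
    next
      assume "{g x, g y} \<in> uedges G"
      then obtain E where E: "E \<in> uedges H" "g ` E = g ` {x, y}" by (auto simp: G_def)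
      then have "E = {x, y}" using inj_on_image_eq_iff[OF g(1), of E "{x, y}"] sub(1)[OF E(1)] xy by simp
      then show "{x, y} \<in> uedges H" using E(1) by simp
    qed
  qed
  moreover have "col e = i" if e: "e \<in> uedges G" for e
  proof -
    obtain E where E: "E \<in> uedges H" "e = g ` E" using e by (auto simp: G_def)
    obtain x y where "E = {x, y}" using sub(2)[OF E(1)] by (auto simp: card_2_iff)
    then show ?thesis using g(3)[of x y] E by simp
  qed
  ultimately show "has_mono_copy H n col" unfolding has_mono_copy_def by blast
qed

lemma has_rainbow_triangle_iff: "has_rainbow_triangle n col \<longleftrightarrow> \<not> rainbow_free (\<lambda>x y. col {x, y}) {1..n}"
  unfolding has_rainbow_triangle_def rainbow_free_def complete_graph_def by auto

lemma edge_coloring_iff: "edge_coloring k n col \<longleftrightarrow> colored_by (\<lambda>x y. col {x, y}) {1..k} {1..n}"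
proof
  assume "edge_coloring k n col"
  then show "colored_by (\<lambda>x y. col {x, y}) {1..k} {1..n}"
    unfolding edge_coloring_def complete_graph_def colored_by_def Pi_def by simp
next
  assume c: "colored_by (\<lambda>x y. col {x, y}) {1..k} {1..n}"
  show "edge_coloring k n col"
    unfolding edge_coloring_def
  proof
    fix E assume "E \<in> uedges (complete_graph n)"
    then have E: "E \<subseteq> {1..n}" "card E = 2" by (simp_all add: complete_graph_def)
    obtain x y where "E = {x, y}" "x \<noteq> y" using E(2) by (auto simp: card_2_iff)
    then show "col E \<in> {1..k}" using colored_byD[OF c, of x y] E(1) by simp
  qed
qed

lemma unavoidable_iff:
  assumes H: "simple_graph H"
  shows "(\<forall>col. edge_coloring k n col \<longrightarrow> has_rainbow_triangle n col \<or> has_mono_copy H n col) \<longleftrightarrow> \<not> avoidable H k n"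
proof
  assume *: "\<forall>col. edge_coloring k n col \<longrightarrow> has_rainbow_triangle n col \<or> has_mono_copy H n col"
  show "\<not> avoidable H k n"
  proof
    assume "avoidable H k n"
    then obtain c where c: "\<And>x y. c x y = c y x" "rainbow_free c {1..n}" "colored_by c {1..k} {1..n}"
      "\<not> mono_copy_in H c {1..n}"
      unfolding avoidable_def by blast
    \<comment> \<open>By symmetry this recovers \<open>c\<close> on all pairs, also when
      \<open>E\<close> is a singleton, so the two functions are equal outright.\<close>
    define col where "col E = c (Min E) (Max E)" for E
    have "col {x, y} = c x y" for x y
      unfolding col_def using c(1) by (cases "x \<le> y") (simp_all add: min_def max_def)
    then have "(\<lambda>x y. col {x, y}) = c" by blast
    then have "\<not> has_mono_copy H n col" "\<not> has_rainbow_triangle n col" "edge_coloring k n col"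
      using c(2-4) by (simp_all only: has_mono_copy_iff[OF H] has_rainbow_triangle_iff edge_coloring_iff simp_thms)
    then show False using * by blast
  qed
next
  assume na: "\<not> avoidable H k n"
  show "\<forall>col. edge_coloring k n col \<longrightarrow> has_rainbow_triangle n col \<or> has_mono_copy H n col"
  proof (intro allI impI, rule ccontr)
    fix col assume "edge_coloring k n col" "\<not> (has_rainbow_triangle n col \<or> has_mono_copy H n col)"
    then have "rainbow_free (\<lambda>x y. col {x, y}) {1..n}" "colored_by (\<lambda>x y. col {x, y}) {1..k} {1..n}"
      "\<not> mono_copy_in H (\<lambda>x y. col {x, y}) {1..n}"
      using has_mono_copy_iff[OF H] has_rainbow_triangle_iff edge_coloring_iff by blast+
    moreover have "\<forall>x y. col {x, y} = col {y, x}" by (simp add: insert_commute)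
    ultimately have "avoidable H k n" unfolding avoidable_def by (intro exI conjI)
    then show False using na by blast
  qed
qed

lemma gallai_ramsey_alt: "simple_graph H \<Longrightarrow> gallai_ramsey k H = (LEAST n. \<not> avoidable H k n)"
  unfolding gallai_ramsey_def by (simp only: unavoidable_iff)

lemma gallai_ramsey_eqI:
  assumes "simple_graph H" "avoidable H k n" "\<not> avoidable H k (n + 1)"
  shows "gallai_ramsey k H = n + 1"
  unfolding gallai_ramsey_alt[OF assms(1)]
proof (rule Least_equality)
  fix m assume "\<not> avoidable H k m"
  then show "n + 1 \<le> m" using avoidable_mono[OF assms(2), of m] by (cases "m \<le> n") simp_all
qed (rule assms(3))

lemma two_colors_rainbow_free:
  assumes "colored_by c {a, b} V" shows "rainbow_free c V"
  unfolding rainbow_free_def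
proof (intro ballI impI)
  fix x y z assume "x \<in> V" "y \<in> V" "z \<in> V" "x \<noteq> y \<and> y \<noteq> z \<and> x \<noteq> z"
  then have "c x y \<in> {a, b}" "c y z \<in> {a, b}" "c x z \<in> {a, b}" using colored_byD[OF assms] by blast+
  then show "c x y = c y z \<or> c y z = c x z \<or> c x y = c x z" by auto
qed

lemma atLeastAtMost_1_2: "{1..2::nat} = {1, 2}"
  by auto

lemma ramsey2_eq: "ramsey2 H = gallai_ramsey 2 H"
proof -
  have "\<not> has_rainbow_triangle n col" if "edge_coloring 2 n col" for n col
    using that two_colors_rainbow_free unfolding has_rainbow_triangle_iff edge_coloring_iff atLeastAtMost_1_2 by blast
  then show ?thesis unfolding ramsey2_def gallai_ramsey_def by meson
qed

lemma avoidable_small: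
  assumes H: "simple_graph H" "n < card (uverts H)" and k: "1 \<le> k \<or> n \<le> 1"
  shows "avoidable H k n"
  unfolding avoidable_def
proof (intro exI[of _ "\<lambda>_ _. 1"] conjI)
  show "rainbow_free (\<lambda>_ _. 1) {1..n}" by (simp add: rainbow_free_def)
  show "colored_by (\<lambda>_ _. 1) {1..k} {1..n}" using k by (auto simp: colored_by_def)
  show "\<not> mono_copy_in H (\<lambda>_ _. 1) {1..n}"
  proof
    assume "mono_copy_in H (\<lambda>_ _. 1) {1..n}"
    then obtain g where "inj_on g (uverts H)" "g ` uverts H \<subseteq> {1..n}" unfolding mono_copy_in_def by blast
    then have "card (uverts H) \<le> card {1..n}" by (intro card_inj_on_le) auto
    then show False using H(2) by simp
  qed
qed simp

text \<open>Connectivity through functions constant along edges, the form that keeps a copy inside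
  one block: there \<open>p\<close> is the index of the block.\<close>

definition connected_graph :: "nat ugraph \<Rightarrow> bool" where
  "connected_graph H \<longleftrightarrow> (\<forall>p :: nat \<Rightarrow> nat. (\<forall>x y. {x, y} \<in> uedges H \<longrightarrow> p x = p y) \<longrightarrow>
     (\<forall>x\<in>uverts H. \<forall>y\<in>uverts H. p x = p y))"

definition contains_triangle :: "nat ugraph \<Rightarrow> bool" where
  "contains_triangle H \<longleftrightarrow> (\<exists>x y z. {x, y} \<in> uedges H \<and> {y, z} \<in> uedges H \<and> {x, z} \<in> uedges H)"

text \<open>Adjacency in the 5-cycle on the residues mod 5. The complement is again a 5-cycle, so
  neither colour class has a triangle.\<close>

definition pent :: "nat \<Rightarrow> nat \<Rightarrow> bool" where
  "pent a b \<longleftrightarrow> (a + 1) mod 5 = b \<or> (b + 1) mod 5 = a"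

lemma pent_sym: "pent a b = pent b a"
  by (auto simp: pent_def)

lemma pent_no_triangle:
  assumes "a < 5" "b < 5" "d < 5" "a \<noteq> b" "b \<noteq> d" "a \<noteq> d"
  shows "\<not> (pent a b = pent b d \<and> pent a d = pent b d)"
proof -
  have "a \<in> {0, 1, 2, 3, 4}" "b \<in> {0, 1, 2, 3, 4}" "d \<in> {0, 1, 2, 3, 4}" using assms(1-3) by auto
  then show ?thesis using assms(4-6) unfolding pent_def by (elim insertE emptyE; simp)
qed

text \<open>Five copies of the colouring are joined by two new colours as in the pentagon. In an old
  colour, connectivity confines a copy of \<open>H\<close> to one block; in a new colour its
  triangle would map to a monochromatic triangle of the pentagon colouring.\<close>

lemma avoidable_blowup:
  assumes H: "simple_graph H" "connected_graph H" "contains_triangle H" and av: "avoidable H k n"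
  shows "avoidable H (k + 2) (5 * n)"
proof -
  obtain c where c: "\<And>x y. c x y = c y x" "rainbow_free c {1..n}" "colored_by c {1..k} {1..n}"
    "\<not> mono_copy_in H c {1..n}"
    using av unfolding avoidable_def by blast
  define c' where "c' u w = (if snd u = snd w then c (fst u) (fst w)
      else if pent (snd u) (snd w) then k + 1 else k + 2)" for u w :: "nat \<times> nat"
  let ?V = "{1..n} \<times> {..<5 :: nat}"
  have inside: "c' u w \<in> {1..k}" if "u \<in> ?V" "w \<in> ?V" "u \<noteq> w" "snd u = snd w" for u w
  proof -
    have "fst u \<noteq> fst w" using that(3,4) by (simp add: prod_eq_iff)
    then show ?thesis using colored_byD[OF c(3), of "fst u" "fst w"] that by (auto simp: c'_def)
  qed
  show ?thesis
  proof (rule avoidableI[OF H(1), of c' ?V "5 * n" "{1..k + 2}" "k + 2"])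
    show "c' u w = c' w u" for u w by (auto simp: c'_def c(1) pent_sym[of "snd u"])
    show "rainbow_free c' ?V"
      unfolding rainbow_free_def
    proof (intro ballI impI)
      fix u w t assume uwt: "u \<in> ?V" "w \<in> ?V" "t \<in> ?V" "u \<noteq> w \<and> w \<noteq> t \<and> u \<noteq> t"
      show "c' u w = c' w t \<or> c' w t = c' u t \<or> c' u w = c' u t"
      proof (cases "snd u = snd w \<and> snd w = snd t")
        case True
        then have "fst u \<noteq> fst w" "fst w \<noteq> fst t" "fst u \<noteq> fst t" using uwt(4) by (simp_all add: prod_eq_iff)
        then show ?thesis
          using True rainbow_freeD[OF c(2), of "fst u" "fst w" "fst t"] uwt(1-3) by (auto simp: c'_def)
      next
        case False
        then show ?thesis by (auto simp: c'_def pent_sym)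
      qed
    qed
    show "colored_by c' {1..k + 2} ?V"
      unfolding colored_by_def
    proof (intro ballI impI)
      fix u w assume uw: "u \<in> ?V" "w \<in> ?V" "u \<noteq> w"
      show "c' u w \<in> {1..k + 2}"
      proof (cases "snd u = snd w")
        case True
        then show ?thesis using inside[OF uw] by auto
      next
        case False
        then show ?thesis by (simp add: c'_def)
      qed
    qed
    show "\<not> mono_copy_in H c' ?V"
    proof
      assume "mono_copy_in H c' ?V"
      then obtain g e where g: "inj_on g (uverts H)" "g ` uverts H \<subseteq> ?V"
        "\<And>x y. {x, y} \<in> uedges H \<Longrightarrow> c' (g x) (g y) = e"
        unfolding mono_copy_in_def by blast
      have gV: "g x \<in> ?V" "g y \<in> ?V" "g x \<noteq> g y" if "{x, y} \<in> uedges H" for x y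
        using simple_graph_edge[OF H(1) that] g(1,2) by (auto dest: inj_onD)
      show False
      proof (cases "\<forall>x y. {x, y} \<in> uedges H \<longrightarrow> snd (g x) = snd (g y)")
        case True
        then have s: "snd (g x) = snd (g y)" if "x \<in> uverts H" "y \<in> uverts H" for x y
          using spec[OF H(2)[unfolded connected_graph_def], of "\<lambda>v. snd (g v)"] that by blast
        have "mono_copy_in H c {1..n}"
          unfolding mono_copy_in_def
        proof (intro exI[of _ "fst \<circ> g"] exI[of _ e] conjI allI impI)
          show "inj_on (fst \<circ> g) (uverts H)"
          proof (rule inj_onI)
            fix x y assume xy: "x \<in> uverts H" "y \<in> uverts H" "(fst \<circ> g) x = (fst \<circ> g) y"
            then have "g x = g y" using s[of x y] by (simp add: prod_eq_iff)
            then show "x = y" using inj_onD[OF g(1)] xy(1,2) by blast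
          qed
          show "(fst \<circ> g) ` uverts H \<subseteq> {1..n}" using g(2) by fastforce
          fix x y assume "{x, y} \<in> uedges H"
          then show "c ((fst \<circ> g) x) ((fst \<circ> g) y) = e"
            using g(3)[of x y] True by (simp add: c'_def)
        qed
        then show False using c(4) by blast
      next
        case False
        then obtain x y where xy: "{x, y} \<in> uedges H" "snd (g x) \<noteq> snd (g y)" by blast
        then have e: "e \<notin> {1..k}" using g(3)[OF xy(1)] by (auto simp: c'_def split: if_splits)
        obtain p q s where t: "{p, q} \<in> uedges H" "{q, s} \<in> uedges H" "{p, s} \<in> uedges H"
          using H(3) unfolding contains_triangle_def by blast
        have ne: "snd (g a) \<noteq> snd (g b)" if "{a, b} \<in> uedges H" for a b
          using inside[OF gV[OF that]] g(3)[OF that] e by auto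
        have "pent (snd (g a)) (snd (g b)) \<longleftrightarrow> e = k + 1" if "{a, b} \<in> uedges H" for a b
          using g(3)[OF that] ne[OF that] by (auto simp: c'_def split: if_splits)
        moreover have "snd (g p) < 5" "snd (g q) < 5" "snd (g s) < 5"
          using gV[OF t(1)] gV[OF t(2)] by auto
        ultimately show False
          using pent_no_triangle[of "snd (g p)" "snd (g q)" "snd (g s)"] t ne by metis
      qed
    qed
  qed auto
qed

section \<open>The family\<close>

text \<open>Two copies of \<open>K4\<close> in colour 1, everything between them in colour 2: a
  connected graph on five vertices does not fit into \<open>K4\<close>, and the bipartite colour 2
  has no triangle.\<close>

lemma avoidable_two_K4:
  assumes H: "simple_graph H" "connected_graph H" "contains_triangle H" "card (uverts H) = 5"
  shows "avoidable H 2 8"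
proof -
  define c :: "nat \<Rightarrow> nat \<Rightarrow> nat" where "c x y = (if (x \<le> 4) = (y \<le> 4) then 1 else 2)" for x y
  have c1: "c x y = 1 \<longleftrightarrow> (x \<le> 4 \<longleftrightarrow> y \<le> 4)" and c2: "c x y = 1 \<or> c x y = 2" for x y by (auto simp: c_def)
  show ?thesis
    unfolding avoidable_def
  proof (intro exI[of _ c] conjI allI)
    show "c x y = c y x" for x y by (auto simp: c_def)
    show col: "colored_by c {1..2} {1..8}" unfolding colored_by_def atLeastAtMost_1_2 using c2 by blast
    show "rainbow_free c {1..8}" using two_colors_rainbow_free[OF col[unfolded atLeastAtMost_1_2]] .
    show "\<not> mono_copy_in H c {1..8}"
    proof
      assume "mono_copy_in H c {1..8}"
      then obtain g e where g: "inj_on g (uverts H)" "g ` uverts H \<subseteq> {1..8}"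
        "\<And>x y. {x, y} \<in> uedges H \<Longrightarrow> c (g x) (g y) = e"
        unfolding mono_copy_in_def by blast
      obtain x y z where t: "{x, y} \<in> uedges H" "{y, z} \<in> uedges H" "{x, z} \<in> uedges H"
        using H(3) unfolding contains_triangle_def by blast
      have "c (g x) (g y) = e" "c (g y) (g z) = e" "c (g x) (g z) = e" using g(3) t by blast+
      then have e: "e = 1" using c1 c2 by metis
      define p where "p v = (if g v \<le> 4 then 0 else 1 :: nat)" for v
      have "\<forall>x y. {x, y} \<in> uedges H \<longrightarrow> p x = p y" using g(3) e c1 by (metis p_def)
      then have "\<forall>u\<in>uverts H. \<forall>w\<in>uverts H. p u = p w" using spec[OF H(2)[unfolded connected_graph_def], of p] by blast
      then have same: "g u \<le> 4 \<longleftrightarrow> g w \<le> 4" if "u \<in> uverts H" "w \<in> uverts H" for u w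
        using that by (metis p_def zero_neq_one)
      have "uverts H \<noteq> {}" using H(4) by auto
      then obtain u where u: "u \<in> uverts H" by blast
      obtain B where B: "B = {1..4} \<or> B = {5..8::nat}" "g ` uverts H \<subseteq> B"
      proof (cases "g u \<le> 4")
        case True
        then have "g ` uverts H \<subseteq> {1..4}" using same[OF u] g(2) by fastforce
        then show ?thesis using that by blast
      next
        case False
        then have "g ` uverts H \<subseteq> {5..8}" using same[OF u] g(2) by fastforce
        then show ?thesis using that by blast
      qed
      have "card (uverts H) \<le> card B" using B by (intro card_inj_on_le[OF g(1)]) auto
      then show False using B(1) H(4) by auto
    qed
  qed
qed

lemma gr_val_eq:
  assumes "1 \<le> k"
  shows "gr_val r k = (if even k then r * 5 ^ ((k - 2) div 2) else 4 * 5 ^ ((k - 1) div 2))"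
  using assms by (induction r k rule: gr_val.induct) (auto elim!: oddE evenE)

lemma tri_val_eq: "tri_val k = (if even k then 5 ^ (k div 2) else 2 * 5 ^ ((k - 1) div 2))"
  by (induction k rule: tri_val.induct) (auto elim!: oddE evenE)

lemma uverts_family: "H \<in> graph_family \<Longrightarrow> uverts H = {1..5}"
  unfolding graph_family_def by (elim insertE emptyE; simp only: verts_family)

lemma connected_family:
  assumes "H \<in> graph_family - {H10}"
  shows "connected_graph H"
  unfolding connected_graph_def
proof (intro allI impI ballI)
  fix p :: "nat \<Rightarrow> nat" and x y
  assume p: "\<forall>x y. {x, y} \<in> uedges H \<longrightarrow> p x = p y" and xy: "x \<in> uverts H" "y \<in> uverts H"
  have "p 1 = p 2 \<and> p 3 = p 2 \<and> p 4 = p 2 \<and> p 5 = p 2"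
    using assms spec[OF spec[OF p, of 1], of 2] spec[OF spec[OF p, of 1], of 5] spec[OF spec[OF p, of 2], of 3]
      spec[OF spec[OF p, of 2], of 4] spec[OF spec[OF p, of 2], of 5] spec[OF spec[OF p, of 3], of 4]
      spec[OF spec[OF p, of 3], of 5] spec[OF spec[OF p, of 4], of 5]
    unfolding graph_family_def by (elim DiffE insertE emptyE; simp add: edges_family doubleton_eq_iff)
  moreover have "uverts H = {1, 2, 3, 4, 5}"
    using uverts_family[of H] assms atLeastAtMost_1_5 by simp
  ultimately show "p x = p y" using xy by auto
qed

lemma triangle_family: "H \<in> graph_family \<Longrightarrow> contains_triangle H"
proof -
  have tri: "contains_triangle K" if "{2, a} \<in> uedges K" "{a, b} \<in> uedges K" "{2, b} \<in> uedges K" for a b K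
    using that unfolding contains_triangle_def by blast
  have "contains_triangle H1" "contains_triangle H2" "contains_triangle H3" "contains_triangle H4" "contains_triangle H10"
    by (rule tri[of 1 _ 5]; simp add: edges_family doubleton_eq_iff)+
  moreover have "contains_triangle H5" "contains_triangle H6"
    by (rule tri[of 3 _ 5]; simp add: edges_family doubleton_eq_iff)+
  moreover have "contains_triangle H11"
    by (rule tri[of 3 _ 4]; simp add: edges_family doubleton_eq_iff)
  ultimately show "H \<in> graph_family \<Longrightarrow> contains_triangle H" unfolding graph_family_def by blast
qed

lemma family_copy:
  assumes "mono_copy_in H5 c V" "mono_copy_in H6 c V" "mono_copy_in H11 c V" "H \<in> graph_family - {H10}"
  shows "mono_copy_in H c V"
  using assms subgraph_copies(1,3)[OF assms(1)] subgraph_copies(2)[OF assms(2)] subgraph_copies(4)[OF assms(3)]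
  unfolding graph_family_def by (elim DiffE insertE emptyE) simp_all

lemma (in sym_coloring) two_colored_family_copy:
  assumes H: "H \<in> graph_family - {H10}" and Q: "finite Q" "card Q = 11" "colored_by c {i, j} Q" "i \<noteq> j"
  shows "mono_copy_in H c Q"
  using ramsey_H5[OF Q(1) _ Q(3)] ramsey_H6[OF Q(1) _ Q(3)] ramsey_H11[OF Q] Q(2)
  by (intro family_copy[OF _ _ _ H]) simp_all

lemma (in sym_coloring) family_copies:
  assumes "H \<in> graph_family - {H10}"
  shows "has_wheel c e V \<Longrightarrow> mono_copy_in H c V" "has_K33e c e V \<Longrightarrow> mono_copy_in H c V"
  by (rule family_copy[OF _ _ _ assms]; simp add: wheel_copies K33e_copies)+

lemma ramsey2_family:
  assumes H: "H \<in> graph_family - {H10}"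
  obtains r where "ramsey2 H = r + 1" "8 \<le> r" "r \<le> 10" "avoidable H 2 r" "\<not> avoidable H 2 (r + 1)"
proof -
  have fam: "H \<in> graph_family" using H by blast
  note sg = simple_graph_family[OF fam]
  have "uverts H = {1..5}" by (rule uverts_family[OF fam])
  then have 8: "avoidable H 2 8"
    using avoidable_two_K4[OF sg connected_family[OF H] triangle_family[OF fam]] by simp
  have 11: "\<not> avoidable H 2 11"
  proof
    assume "avoidable H 2 11"
    then obtain c :: "nat \<Rightarrow> nat \<Rightarrow> nat" where c: "\<forall>x y. c x y = c y x" "colored_by c {1..2} {1..11}" "\<not> mono_copy_in H c {1..11}"
      unfolding avoidable_def by blast
    interpret sym_coloring c by unfold_locales (use c(1) in blast)
    have "mono_copy_in H c {1..11}"
      by (rule two_colored_family_copy[OF H _ _ c(2)[unfolded atLeastAtMost_1_2]]) simp_all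
    then show False using c(3) by blast
  qed
  define R where "R = (LEAST n. \<not> avoidable H 2 n)"
  have R: "\<not> avoidable H 2 R" "R \<le> 11" "\<And>m. m < R \<Longrightarrow> avoidable H 2 m"
    unfolding R_def using LeastI[of "\<lambda>n. \<not> avoidable H 2 n", OF 11] Least_le[of "\<lambda>n. \<not> avoidable H 2 n", OF 11]
      not_less_Least[of _ "\<lambda>n. \<not> avoidable H 2 n"] by blast+
  have "9 \<le> R"
  proof (rule ccontr)
    assume "\<not> ?thesis"
    then show False using avoidable_mono[OF 8, of R] R(1) by simp
  qed
  moreover have "ramsey2 H = R"
    unfolding ramsey2_eq gallai_ramsey_alt[OF sg] R_def ..
  ultimately show ?thesis using R by (intro that[of "R - 1"]) auto
qed

text \<open>The lower bound follows the recursion of \<open>gr_val\<close>: four vertices for one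
  colour, an extremal colouring for two, and a substitution for every two further colours.\<close>

lemma gallai_ramsey_family:
  assumes H: "H \<in> graph_family - {H10}" and k: "1 \<le> k" and r: "ramsey2 H = r + 1"
  shows "gallai_ramsey k H = gr_val r k + 1"
proof -
  have fam: "H \<in> graph_family" using H by blast
  note sg = simple_graph_family[OF fam]
  have "uverts H = {1..5}" by (rule uverts_family[OF fam])
  then have verts: "card (uverts H) = 5" by simp
  obtain r' where "ramsey2 H = r' + 1" and r810: "8 \<le> r'" "r' \<le> 10" and av: "avoidable H 2 r'" "\<not> avoidable H 2 (r' + 1)"
    using ramsey2_family[OF H] by blast
  then have r': "r' = r" using r by simp
  note r810 = r810[unfolded r'] and av = av[unfolded r']
  show ?thesis
  proof (rule gallai_ramsey_eqI[OF sg])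
    show "avoidable H k (gr_val r k)" using k av(1)
    proof (induction r k rule: gr_val.induct)
      case (1 r)
      then show ?case by simp
    next
      case (2 r)
      then show ?case using avoidable_small[OF sg, of 4 1] verts by simp
    next
      case (3 r)
      then show ?case by (simp add: numeral_2_eq_2)
    next
      case (4 r k)
      then show ?case
        using avoidable_blowup[OF sg connected_family[OF H] triangle_family[OF fam], of "Suc k"] by simp
    qed
    show "\<not> avoidable H k (gr_val r k + 1)"
    proof
      assume "avoidable H k (gr_val r k + 1)"
      then obtain c where c: "\<forall>x y. c x y = c y x" "rainbow_free c {1..gr_val r k + 1}"
        "colored_by c {1..k} {1..gr_val r k + 1}" "\<not> mono_copy_in H c {1..gr_val r k + 1}"
        unfolding avoidable_def by blast
      let ?V = "{1..gr_val r k + 1}"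
      interpret sym_coloring c by unfold_locales (use c(1) in blast)
      have two: "card W \<le> r" if W: "W \<subseteq> ?V" "colored_by c {i, j} W" for W i j
      proof (rule ccontr)
        assume "\<not> ?thesis"
        then obtain U where U: "U \<subseteq> W" "card U = r + 1" by (metis Suc_eq_plus1 not_less_eq_eq obtain_subset_with_card_n)
        \<comment> \<open>\<open>two_colored\<close> admits \<open>i = j\<close>; a second colour is
          then added so that there are exactly two.\<close>
        define D where "D = (if i = j then {i, Suc i} else {i, j})"
        have D: "{i, j} \<subseteq> D" "finite D" "card D = 2" by (auto simp: D_def)
        have UV: "U \<subseteq> ?V" using U(1) W(1) by blast
        have "avoidable H 2 (r + 1)"
          by (rule avoidableI[OF sg sym finite_subset[OF UV] U(2) D(2,3) rainbow_free_subset[OF c(2) UV]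
                colored_by_subset[OF W(2) U(1) D(1)]])
            (use mono_copy_in_mono[OF _ UV] c(4) in auto)
        then show False using av(2) by blast
      qed
      interpret ramsey_bound c ?V r
        by unfold_locales (use c family_copies[OF H] two r810 in blast)+
      have "card ?V \<le> gr_val r (card {1..k})" by (rule card_le_gr_val[OF order_refl _ c(3)]) simp
      then show False by simp
    qed
  qed
qed

section \<open>Lower bounds for \<open>H10\<close>\<close>

definition K3_graph :: "nat ugraph" where
  "K3_graph = \<lparr>uverts = {1, 2, 3}, uedges = {{1, 2}, {2, 3}, {1, 3}}\<rparr>"

lemma K3_graph_props: "simple_graph K3_graph" "connected_graph K3_graph" "contains_triangle K3_graph"
proof -
  show "simple_graph K3_graph" by (simp add: simple_graph_def K3_graph_def)
  show "connected_graph K3_graph" by (auto simp: connected_graph_def K3_graph_def)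
  show "contains_triangle K3_graph"
    unfolding contains_triangle_def by (intro exI[of _ 1] exI[of _ 2] exI[of _ 3]) (simp add: K3_graph_def)
qed

lemma avoidable_K3: "avoidable K3_graph k (tri_val k)"
proof (induction k rule: tri_val.induct)
  case 1
  then show ?case using avoidable_small[OF K3_graph_props(1), of 1 0] by (simp add: K3_graph_def)
next
  case 2
  then show ?case using avoidable_small[OF K3_graph_props(1), of 2 1] by (simp add: K3_graph_def)
next
  case (3 k)
  then show ?case using avoidable_blowup[OF K3_graph_props, of k] by simp
qed

lemma K3_copy_of_H10: "mono_copy_in H10 c V \<Longrightarrow> mono_copy_in K3_graph c V"
  by (rule mono_copy_in_transfer[where \<phi> = "pick5 1 2 5 0 0"], assumption, unfold verts_family atLeastAtMost_1_5)
    (simp_all add: K3_graph_def edges_family doubleton_eq_iff)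

text \<open>\<open>H10\<close> is disconnected, so the substitution is applied to the triangle that
  it contains.\<close>

lemma avoidable_H10_tri: "avoidable H10 k (tri_val k)"
  using avoidable_K3[of k] K3_copy_of_H10 unfolding avoidable_def by blast

text \<open>Colour 1 is a \<open>K4\<close>, too small for five vertices. Every edge of colour 2
  meets \<open>{5, 6}\<close>, so a triangle of colour 2 uses both 5 and 6 and leaves no disjoint
  edge.\<close>

lemma avoidable_H10_2: "avoidable H10 2 6"
proof -
  define c :: "nat \<Rightarrow> nat \<Rightarrow> nat" where "c x y = (if x \<le> 4 \<and> y \<le> 4 then 1 else 2)" for x y
  show ?thesis
    unfolding avoidable_def
  proof (intro exI[of _ c] conjI allI)
    show "c x y = c y x" for x y by (auto simp: c_def)
    have "colored_by c {1, 2} {1..6}" by (simp add: colored_by_def c_def)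
    then show "colored_by c {1..2} {1..6}" "rainbow_free c {1..6}"
      unfolding atLeastAtMost_1_2 by (assumption, rule two_colors_rainbow_free)
    show "\<not> mono_copy_in H10 c {1..6}"
    proof
      assume "mono_copy_in H10 c {1..6}"
      then obtain g e where g: "inj_on g (uverts H10)" "g ` uverts H10 \<subseteq> {1..6}"
        "\<And>x y. {x, y} \<in> uedges H10 \<Longrightarrow> c (g x) (g y) = e"
        unfolding mono_copy_in_def by blast
      note g = g[unfolded verts_family atLeastAtMost_1_5]
      have cols: "c (g 1) (g 2) = e" "c (g 1) (g 5) = e" "c (g 2) (g 5) = e" "c (g 3) (g 4) = e"
        by (rule g(3); simp add: edges_family)+
      have in5: "1 \<in> {1, 2, 3, 4, 5 :: nat}" "2 \<in> {1, 2, 3, 4, 5 :: nat}" "3 \<in> {1, 2, 3, 4, 5 :: nat}"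
        "4 \<in> {1, 2, 3, 4, 5 :: nat}" "5 \<in> {1, 2, 3, 4, 5 :: nat}"
        by simp_all
      have gm: "g v \<in> {1..6}" if "v \<in> {1, 2, 3, 4, 5}" for v using g(2) that by blast
      note mem = gm[OF in5(1)] gm[OF in5(2)] gm[OF in5(3)] gm[OF in5(4)] gm[OF in5(5)]
      show False
      proof (cases "e = 1")
        case True
        have le: "x \<le> 4 \<and> y \<le> 4" if "c x y = e" for x y
        proof (rule ccontr)
          assume "\<not> (x \<le> 4 \<and> y \<le> 4)"
          then have "c x y = 2" unfolding c_def by (rule if_not_P)
          then show False using that True by simp
        qed
        have "g 1 \<le> 4" "g 2 \<le> 4" "g 3 \<le> 4" "g 4 \<le> 4" "g 5 \<le> 4"
          using le[OF cols(1)] le[OF cols(2)] le[OF cols(4)] by simp_all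
        then have "g ` {1, 2, 3, 4, 5} \<subseteq> {1..4}" using mem by simp
        then have "card {1, 2, 3, 4, 5 :: nat} \<le> card {1..4 :: nat}" by (intro card_inj_on_le[OF g(1)]) auto
        then show False by simp
      next
        case False
        have big: "x \<in> {5, 6} \<or> y \<in> {5, 6}" if "c x y = e" "x \<in> {1..6}" "y \<in> {1..6}" for x y
        proof -
          have "\<not> (x \<le> 4 \<and> y \<le> 4)"
          proof
            assume "x \<le> 4 \<and> y \<le> 4"
            then have "c x y = 1" unfolding c_def by (rule if_P)
            then show False using that(1) False by simp
          qed
          then show ?thesis using that(2,3) by auto
        qed
        have "g 1 \<in> {5, 6} \<or> g 2 \<in> {5, 6}" "g 1 \<in> {5, 6} \<or> g 5 \<in> {5, 6}" "g 2 \<in> {5, 6} \<or> g 5 \<in> {5, 6}" "g 3 \<in> {5, 6} \<or> g 4 \<in> {5, 6}"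
          by (rule big[OF cols(1) mem(1,2)] big[OF cols(2) mem(1,5)] big[OF cols(3) mem(2,5)] big[OF cols(4) mem(3,4)])+
        moreover have ne: "g x \<noteq> g y" if "x \<in> {1, 2, 3, 4, 5}" "y \<in> {1, 2, 3, 4, 5}" "x \<noteq> y" for x y
          using inj_onD[OF g(1) _ that(1,2)] that(3) by blast
        have "g 1 \<noteq> g 2" "g 1 \<noteq> g 5" "g 2 \<noteq> g 5" "g 3 \<noteq> g 1" "g 3 \<noteq> g 2" "g 3 \<noteq> g 5"
          "g 4 \<noteq> g 1" "g 4 \<noteq> g 2" "g 4 \<noteq> g 5"
          by (rule ne; simp)+
        ultimately show False unfolding insert_iff empty_iff by metis
      qed
    qed
  qed
qed

lemma gallai_ramsey_H10:
  assumes "1 \<le> k"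
  shows "gallai_ramsey k H10 = h10_val k + 1"
proof (rule gallai_ramsey_eqI)
  show sg: "simple_graph H10" by (rule simple_graph_family) (simp add: graph_family_def)
  have "avoidable H10 1 4" by (rule avoidable_small[OF sg]) (simp_all add: verts_family)
  then show "avoidable H10 k (h10_val k)"
    using avoidable_H10_2 avoidable_H10_tri[of k] by (simp add: h10_val_def)
  show "\<not> avoidable H10 k (h10_val k + 1)"
  proof
    assume "avoidable H10 k (h10_val k + 1)"
    then obtain c where c: "\<forall>x y. c x y = c y x" "rainbow_free c {1..h10_val k + 1}"
      "colored_by c {1..k} {1..h10_val k + 1}" "\<not> mono_copy_in H10 c {1..h10_val k + 1}"
      unfolding avoidable_def by blast
    interpret sym_coloring c by unfold_locales (use c(1) in blast)
    show False using H10_free_bound[OF _ c(2) _ c(3,4)] by simp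
  qed
qed

theorem theorem1p3:
  fixes k :: nat and H :: "nat ugraph"
  assumes "k \<ge> 1"
  shows "(H \<in> graph_family - {H10} \<longrightarrow>
            gallai_ramsey k H =
              (if even k then (ramsey2 H - 1) * 5 ^ ((k - 2) div 2) + 1
               else 4 * 5 ^ ((k - 1) div 2) + 1)) \<and>
         (H = H10 \<longrightarrow>
            gallai_ramsey 1 H = 5 \<and> gallai_ramsey 2 H = 7 \<and>
            (k \<ge> 4 \<and> even k \<longrightarrow> gallai_ramsey k H = 5 ^ (k div 2) + 1) \<and>
            (k \<ge> 3 \<and> odd k \<longrightarrow> gallai_ramsey k H = 2 * 5 ^ ((k - 1) div 2) + 1))"
proof (intro conjI impI)
  assume H: "H \<in> graph_family - {H10}"
  then obtain r where r: "ramsey2 H = r + 1" by (rule ramsey2_family)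
  show "gallai_ramsey k H = (if even k then (ramsey2 H - 1) * 5 ^ ((k - 2) div 2) + 1
      else 4 * 5 ^ ((k - 1) div 2) + 1)"
    using gallai_ramsey_family[OF H assms r] gr_val_eq[OF assms, of r] r by simp
next
  assume "H = H10"
  then show "gallai_ramsey 1 H = 5" "gallai_ramsey 2 H = 7"
    by (simp_all add: gallai_ramsey_H10 h10_val_def)
next
  assume "H = H10" "k \<ge> 4 \<and> even k"
  then show "gallai_ramsey k H = 5 ^ (k div 2) + 1"
    by (simp add: gallai_ramsey_H10 h10_val_def tri_val_eq)
next
  assume "H = H10" "k \<ge> 3 \<and> odd k"
  then show "gallai_ramsey k H = 2 * 5 ^ ((k - 1) div 2) + 1"
    using assms by (simp add: gallai_ramsey_H10 h10_val_def tri_val_eq)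
qed

end
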